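(* For any $a>0$ there exists a set $C\subset\mathbb{T}^2$ of second Baire category for which the following holds. (i) For every $(\alpha,\beta)\in C$ there exist arbitrarily large $\lambda$ such that $$R_2[-a,a](\lambda)\ge\frac{\log\lambda}{\log\log\log\lambda}.$$ (ii) For every $(\alpha,\beta)\in C$ there exists an infinite sequence $L_1<L_2<\cdots\to\infty$ such that $$\lim_{j\to\infty}R_2[-a,a](L_j)=2\pi a.$$ Here $R_2[-a,a](\lambda)$ is the pair correlation function of the sequence $0\le\lambda_1\le\lambda_2\le\cdots\to\infty$ of values of $(m-\alpha)^2+(n-\beta)^2$ at lattice points $(m,n)\in\mathbb{Z}^2$.
   Context: $\mathbb{T}^2=\mathbb{R}^2/\mathbb{Z}^2$. The sequence $(\lambda_j)$ (which depends only on $(\alpha,\beta)$ modulo $\mathbb{Z}^2$) lists the values of $(m-\alpha)^2+(n-\beta)^2$, $(m,n)\in\mathbb{Z}^2$, in nondecreasing order and with multiplicity. The pair correlation function is $$R_2[a,b](\lambda)=\frac{1}{\pi\lambda}\#\{(j,k): j\neq k,\ \lambda_j\le\lambda,\ \lambda_k\le\lambda,\ a\le\lambda_j-\lambda_k\le b\}.$$ A set of first Baire category is a countable union of nowhere dense sets; sets of second Baire category are all those sets which are not of first category. *)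

theory Defs
  imports "HOL-Analysis.Analysis"
begin

definition torus_rel :: "real \<times> real \<Rightarrow> real \<times> real \<Rightarrow> bool" where
  "torus_rel p q \<longleftrightarrow> fst p - fst q \<in> \<int> \<and> snd p - snd q \<in> \<int>"

lemma equivp_torus_rel: "equivp torus_rel"
proof (rule equivpI)
  show "reflp torus_rel"
    by (auto simp: reflp_def torus_rel_def)
  show "symp torus_rel"
    unfolding symp_def torus_rel_def by (metis Ints_minus minus_diff_eq)
  show "transp torus_rel"
  proof (rule transpI)
    fix p q r assume "torus_rel p q" "torus_rel q r"
    then have "(fst p - fst q) + (fst q - fst r) \<in> \<int>" "(snd p - snd q) + (snd q - snd r) \<in> \<int>"
      unfolding torus_rel_def by (blast intro: Ints_add)+
    then show "torus_rel p r"
      by (simp add: torus_rel_def)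
  qed
qed

quotient_type torus = "real \<times> real" / torus_rel
  by (rule equivp_torus_rel)

instantiation torus :: topological_space
begin

definition open_torus :: "torus set \<Rightarrow> bool" where
  "open_torus U \<longleftrightarrow> open (abs_torus -` U)"

instance
proof
  show "open (UNIV :: torus set)"
    by (simp add: open_torus_def)
  show "open (S \<inter> T)" if "open S" "open T" for S T :: "torus set"
    using that by (simp add: open_torus_def vimage_Int open_Int)
  show "open (\<Union>K)" if "\<forall>S\<in>K. open S" for K :: "torus set set"
    using that by (auto simp: open_torus_def vimage_Union)
qed

end

definition nowhere_dense :: "'a::topological_space set \<Rightarrow> bool" where
  "nowhere_dense S \<longleftrightarrow> interior (closure S) = {}"

definition first_category :: "'a::topological_space set \<Rightarrow> bool" where
  "first_category S \<longleftrightarrow> (\<exists>F :: nat \<Rightarrow> 'a set. (\<forall>n. nowhere_dense (F n)) \<and> S = (\<Union>n. F n))"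

definition second_category :: "'a::topological_space set \<Rightarrow> bool" where
  "second_category S \<longleftrightarrow> \<not> first_category S"

definition lattice_value :: "real \<times> real \<Rightarrow> int \<times> int \<Rightarrow> real" where
  "lattice_value p x = (of_int (fst x) - fst p)\<^sup>2 + (of_int (snd x) - snd p)\<^sup>2"

text \<open>The bijection makes each value occur as often as it is attained.\<close>

definition lists_values :: "real \<times> real \<Rightarrow> (nat \<Rightarrow> real) \<Rightarrow> bool" where
  "lists_values p l \<longleftrightarrow>
     mono l \<and> (\<exists>e :: nat \<Rightarrow> int \<times> int. bij e \<and> (\<forall>j. l j = lattice_value p (e j)))"

lemma finite_lattice_value_le: "finite {x. lattice_value p x \<le> c}"
proof -
  define B where "B = max c 0 + 1"
  have B: "B \<ge> 1" "c \<le> B"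
    by (auto simp: B_def)
  have le: "\<bar>t\<bar> \<le> B" if "t\<^sup>2 \<le> B" for t :: real
  proof (rule power2_le_imp_le)
    have "B \<le> B\<^sup>2"
      using B(1) by (simp add: power2_eq_square)
    then show "\<bar>t\<bar>\<^sup>2 \<le> B\<^sup>2"
      using that by simp
  qed (use B in simp)
  have "{x. lattice_value p x \<le> c} \<subseteq>
      {\<lfloor>fst p - B\<rfloor>..\<lceil>fst p + B\<rceil>} \<times> {\<lfloor>snd p - B\<rfloor>..\<lceil>snd p + B\<rceil>}"
  proof
    fix x assume "x \<in> {x. lattice_value p x \<le> c}"
    then have s: "(of_int (fst x) - fst p)\<^sup>2 + (of_int (snd x) - snd p)\<^sup>2 \<le> c"
      by (simp add: lattice_value_def)
    have "\<bar>of_int (fst x) - fst p\<bar> \<le> B" "\<bar>of_int (snd x) - snd p\<bar> \<le> B"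
      using s B(2) zero_le_power2[of "of_int (fst x) - fst p"]
        zero_le_power2[of "of_int (snd x) - snd p"] by (intro le; linarith)+
    then have "\<lfloor>fst p - B\<rfloor> \<le> fst x" "fst x \<le> \<lceil>fst p + B\<rceil>"
        "\<lfloor>snd p - B\<rfloor> \<le> snd x" "snd x \<le> \<lceil>snd p + B\<rceil>"
      by linarith+
    then show "x \<in> {\<lfloor>fst p - B\<rfloor>..\<lceil>fst p + B\<rceil>} \<times> {\<lfloor>snd p - B\<rfloor>..\<lceil>snd p + B\<rceil>}"
      by (cases x) auto
  qed
  then show ?thesis
    by (rule finite_subset) simp
qed

lemma lists_values_exists: "\<exists>l. lists_values p l"
proof -
  let ?f = "lattice_value p"
  define P where "P = (\<lambda>(e :: nat \<Rightarrow> int \<times> int) n x.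
    x \<notin> e ` {..<n} \<and> (\<forall>y. y \<notin> e ` {..<n} \<longrightarrow> ?f x \<le> ?f y))"
  have "\<exists>e. \<forall>n. P e n (e n)"
  proof (rule dependent_wellorder_choice)
    fix r and e g :: "nat \<Rightarrow> int \<times> int" and n
    assume "\<And>m. m < n \<Longrightarrow> e m = g m"
    then have "e ` {..<n} = g ` {..<n}"
      by (intro image_cong) auto
    then show "P e n r = P g n r"
      by (simp add: P_def)
  next
    fix n and e :: "nat \<Rightarrow> int \<times> int"
    have "infinite (UNIV :: (int \<times> int) set)"
      by (simp add: finite_prod)
    then obtain z where z: "z \<notin> e ` {..<n}"
      by (metis ex_new_if_finite finite_imageI finite_lessThan)
    let ?A = "{y. ?f y \<le> ?f z} - e ` {..<n}"
    have A: "finite ?A" "?A \<noteq> {}"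
      using z finite_lattice_value_le by auto
    define x where "x = arg_min_on ?f ?A"
    have "x \<in> ?A"
      unfolding x_def by (rule arg_min_if_finite(1)[OF A])
    moreover have "?f x \<le> ?f y" if "y \<in> ?A" for y
      unfolding x_def by (rule arg_min_least[OF A that])
    ultimately have "P e n x"
      unfolding P_def by (smt (verit) Diff_iff mem_Collect_eq)
    then show "\<exists>r. P e n r" ..
  qed
  then obtain e where e: "\<And>n. P e n (e n)"
    by blast
  have inj: "inj e"
  proof (rule injI)
    fix i j assume "e i = e j"
    then show "i = j"
      using e[of i] e[of j] unfolding P_def
      by (metis imageI lessThan_iff linorder_neqE_nat)
  qed
  have mono: "mono (\<lambda>n. ?f (e n))"
  proof (rule monoI)
    fix i j :: nat assume "i \<le> j"
    have "e j \<notin> e ` {..<j}"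
      using e[of j] by (simp add: P_def)
    then have "e j \<notin> e ` {..<i}"
      using \<open>i \<le> j\<close> by auto
    then show "?f (e i) \<le> ?f (e j)"
      using e[of i] unfolding P_def by blast
  qed
  have "surj e"
  proof (rule ccontr)
    assume "\<not> surj e"
    then obtain y where "y \<notin> range e"
      by auto
    then have "?f (e n) \<le> ?f y" for n
      using e[of n] unfolding P_def by blast
    then have "range e \<subseteq> {x. ?f x \<le> ?f y}"
      by auto
    then have "finite (range e)"
      using finite_lattice_value_le finite_subset by blast
    then show False
      using inj finite_imageD by blast
  qed
  with inj have "bij e"
    by (simp add: bij_def)
  with mono have "lists_values p (\<lambda>n. ?f (e n))"
    unfolding lists_values_def by blast
  then show ?thesis
    by blast
qed

lemma lists_values_le_iff:
  assumes "lists_values p l"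
  shows "l j \<le> c \<longleftrightarrow> j < card {x. lattice_value p x \<le> c}"
proof -
  obtain e where e: "bij e" "\<And>j. l j = lattice_value p (e j)" and l: "mono l"
    using assms by (auto simp: lists_values_def)
  have im: "e ` {j. l j \<le> c} = {x. lattice_value p x \<le> c}"
    using e(1) by (auto simp: e(2) image_iff) (metis bij_pointE)
  have inj: "inj_on e {j. l j \<le> c}"
    using e(1) by (meson bij_is_inj inj_on_subset subset_UNIV)
  have card: "card {j. l j \<le> c} = card {x. lattice_value p x \<le> c}"
    using card_image[OF inj] im by simp
  have fin: "finite {j. l j \<le> c}"
    using finite_lattice_value_le[of p c] im inj by (metis finite_image_iff)
  show ?thesis
  proof
    assume "l j \<le> c"
    then have "{..j} \<subseteq> {j. l j \<le> c}"
      using l by (auto dest: monoD intro: order_trans)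
    then have "card {..j} \<le> card {j. l j \<le> c}"
      by (rule card_mono[OF fin])
    then show "j < card {x. lattice_value p x \<le> c}"
      by (simp add: card)
  next
    assume j: "j < card {x. lattice_value p x \<le> c}"
    show "l j \<le> c"
    proof (rule ccontr)
      assume "\<not> l j \<le> c"
      then have "{i. l i \<le> c} \<subseteq> {..<j}"
        using l by (auto simp: not_le) (metis leD le_less_linear monoD order_trans)
      then have "card {i. l i \<le> c} \<le> card {..<j}"
        by (intro card_mono) auto
      then show False
        using j by (simp add: card)
    qed
  qed
qed

lemma lists_values_unique:
  assumes "lists_values p l" "lists_values p l'"
  shows "l = l'"
proof
  fix j
  have "l j \<le> c \<longleftrightarrow> l' j \<le> c" for c
    using assms by (simp add: lists_values_le_iff)
  then show "l j = l' j"
    by (meson order_antisym order_refl)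
qed

lemma lists_values_ex1: "\<exists>!l. lists_values p l"
  using lists_values_exists lists_values_unique by blast

lemma lists_values_cong_aux:
  assumes "torus_rel p q" "lists_values p l"
  shows "lists_values q l"
proof -
  obtain a b :: int where ab: "fst p - fst q = of_int a" "snd p - snd q = of_int b"
    using assms(1) unfolding torus_rel_def by (auto elim!: Ints_cases)
  obtain e where e: "bij e" "\<And>j. l j = lattice_value p (e j)" and l: "mono l"
    using assms(2) by (auto simp: lists_values_def)
  define s where "s = (\<lambda>x :: int \<times> int. (fst x - a, snd x - b))"
  have "bij s"
    by (rule o_bij[of "\<lambda>x. (fst x + a, snd x + b)"]) (auto simp: s_def)
  then have "bij (s \<circ> e)"
    using e(1) by (rule bij_comp[rotated])
  moreover have "lattice_value p x = lattice_value q (s x)" for x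
  proof -
    have "fst p = fst q + of_int a" "snd p = snd q + of_int b"
      using ab by linarith+
    then show ?thesis
      by (simp add: lattice_value_def s_def algebra_simps)
  qed
  ultimately show ?thesis
    using e(2) l unfolding lists_values_def by (intro conjI exI[of _ "s \<circ> e"]) auto
qed

lemma lists_values_cong: "torus_rel p q \<Longrightarrow> lists_values p = lists_values q"
  using lists_values_cong_aux equivp_symp[OF equivp_torus_rel] by blast

text \<open>The sequence \<open>\<lambda>\<^sub>1 \<le> \<lambda>\<^sub>2 \<le> \<dots>\<close> is indexed from \<open>0\<close>.\<close>

lift_definition lambda_seq :: "torus \<Rightarrow> nat \<Rightarrow> real" is "\<lambda>p. THE l. lists_values p l"
  by (simp add: lists_values_cong)

lemma lists_values_lambda_seq: "lists_values p (lambda_seq (abs_torus p))"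
  unfolding lambda_seq.abs_eq by (rule theI'[OF lists_values_ex1])

definition pair_correlation :: "(nat \<Rightarrow> real) \<Rightarrow> real \<Rightarrow> real \<Rightarrow> real \<Rightarrow> real" where
  "pair_correlation l a b L =
     1 / (pi * L) *
     real (card {(j, k). j \<noteq> k \<and> l j \<le> L \<and> l k \<le> L \<and> a \<le> l j - l k \<and> l j - l k \<le> b})"

lemma finite_pairs:
  assumes "lists_values p l"
  shows "finite {(j, k). j \<noteq> k \<and> l j \<le> L \<and> l k \<le> L \<and> a \<le> l j - l k \<and> l j - l k \<le> b}"
proof -
  have "finite {j. l j \<le> L}"
    by (simp add: lists_values_le_iff[OF assms])
  then have "finite ({j. l j \<le> L} \<times> {j. l j \<le> L})"
    by simp
  then show ?thesis
    by (rule finite_subset[rotated]) auto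
qed

definition R2 :: "torus \<Rightarrow> real \<Rightarrow> real \<Rightarrow> real \<Rightarrow> real" where
  "R2 t = pair_correlation (lambda_seq t)"

end

theory Submission
  imports Defs "HOL-Number_Theory.Cong"
begin

text \<open>
  Write \<open>N\<^sub>p(L)\<close> for the number of ordered pairs of distinct lattice points \<open>x, y\<close> whose squared distances
  from \<open>p\<close> are at most \<open>L\<close> and differ by at most \<open>a\<close>; then \<open>R\<^sub>2[-a,a](L) = N\<^sub>p(L) / (\<pi> L)\<close>. The projection of
  the plane onto the torus is continuous and open, so by Baire's theorem it suffices to find countably many
  dense open sets of the plane such that (i) and (ii) hold at every point common to all of them
  (\<open>second_category_torusI\<close>). These sets come from two facts, each valid in every nonempty open set.

  Large values. At a rational point \<open>p = (b/N, c/N)\<close> very many lattice points are at exactly the same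
  distance from \<open>p\<close>: the Gaussian integers \<open>\<alpha>\<beta>\<close> and \<open>\<alpha>\<close> times the conjugate of \<open>\<beta>\<close> have the same modulus,
  and if \<open>\<alpha> \<equiv> -(b + ic)\<close> and \<open>\<beta> \<equiv> 1\<close> modulo \<open>N\<close>, both are \<open>N\<close> times the difference of a lattice point and
  \<open>p\<close>. Counting them gives \<open>N\<^sub>p(L) \<ge> k L log L\<close> for all large \<open>L\<close>, with \<open>k > 0\<close> depending on \<open>p\<close>
  (\<open>card_equal_pairs_rational\<close>). For large \<open>L\<close> this beats \<open>\<pi> L log L / log log log L\<close>, and it also beats
  \<open>\<pi> L \<sqdot> 2\<pi>a\<close>; equal values remain close when \<open>p\<close> moves a little, so the bounds hold near \<open>p\<close>.

  Small values. For every \<open>\<epsilon> > 0\<close> and every nonempty open \<open>U\<close> there are \<open>p \<in> U\<close> and arbitrarily large \<open>L\<close> with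
  \<open>N\<^sub>p(L) < \<pi>(2\<pi>a + \<epsilon>)L\<close> (\<open>exists_low_pair_count\<close>). This is an averaging argument: \<open>N\<^sub>p(L)\<close> is integrated over a
  period square against a nonnegative trigonometric polynomial \<open>F\<close> concentrated near a point of \<open>U\<close>. Sorting
  the pairs by their difference \<open>h = y - x\<close> and summing over the translates of the square turns the integral
  into a sum over \<open>h\<close> of integrals of \<open>F\<close> over strips of width \<open>a/|h|\<close> and length at most \<open>sqrt (4L - |h|\<^sup>2)\<close>
  orthogonal to \<open>h\<close>. The mean of \<open>F\<close> contributes a Riemann sum of \<open>sqrt (1 - |x|\<^sup>2) / |x|\<close> over the unit disc,
  which gives \<open>2\<pi>\<^sup>2 a L\<close> times the mean; the other frequencies of \<open>F\<close> oscillate along all but few of the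
  strips and contribute \<open>O(L\<^bsup>3/4\<^esup>)\<close>. A small value persists near \<open>p\<close>, since \<open>N\<^sub>p(L)\<close> is
  upper semicontinuous in \<open>p\<close>.

  A point common to all these open sets satisfies (i). For (ii), fix such a \<open>p\<close>: arbitrarily far out there are
  \<open>L\<^sub>1 < L\<^sub>2\<close> with \<open>N\<^sub>p(L\<^sub>1) \<ge> \<pi> L\<^sub>1 \<sqdot> 2\<pi>a\<close> and \<open>N\<^sub>p(L\<^sub>2) \<le> \<pi> L\<^sub>2 (2\<pi>a + \<epsilon>)\<close>. As \<open>N\<^sub>p\<close> is nondecreasing in \<open>L\<close>, the
  quotient \<open>N\<^sub>p(L) / (\<pi> L)\<close> jumps only upwards, so on its way down it takes a value between \<open>2\<pi>a\<close> and
  \<open>2\<pi>a + \<epsilon>\<close> (\<open>monotone_meets_line\<close>).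
\<close>

section \<open>Pairs of lattice points at nearly the same distance\<close>

definition close_pairs :: "real \<Rightarrow> real \<times> real \<Rightarrow> real \<Rightarrow> ((int \<times> int) \<times> (int \<times> int)) set" where
  "close_pairs a p L = {(x, y). x \<noteq> y \<and> lattice_value p x \<le> L \<and> lattice_value p y \<le> L \<and>
     \<bar>lattice_value p x - lattice_value p y\<bar> \<le> a}"

lemma finite_close_pairs: "finite (close_pairs a p L)"
  by (rule finite_subset[of _ "{x. lattice_value p x \<le> L} \<times> {x. lattice_value p x \<le> L}"])
    (auto simp: close_pairs_def finite_lattice_value_le)

lemma R2_eq_card_close_pairs:
  "R2 (abs_torus p) (- a) a L = card (close_pairs a p L) / (pi * L)"
proof -
  define l where "l = lambda_seq (abs_torus p)"
  obtain e where e: "bij e" "\<And>j. l j = lattice_value p (e j)"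
    using lists_values_lambda_seq[of p] by (auto simp: lists_values_def l_def)
  define J where "J = {(j, k). j \<noteq> k \<and> l j \<le> L \<and> l k \<le> L \<and> - a \<le> l j - l k \<and> l j - l k \<le> a}"
  have "inj (map_prod e e)"
    using e(1) by (simp add: bij_is_inj prod.inj_map)
  moreover have "map_prod e e ` J = close_pairs a p L"
  proof (rule set_eqI)
    fix z :: "(int \<times> int) \<times> (int \<times> int)"
    obtain j k where z: "z = (e j, e k)"
      using e(1) by (metis bij_pointE surj_pair)
    have "z \<in> map_prod e e ` J \<longleftrightarrow> (j, k) \<in> J"
      unfolding z using \<open>inj (map_prod e e)\<close> by (metis inj_image_mem_iff map_prod_simp)
    also have "\<dots> \<longleftrightarrow> z \<in> close_pairs a p L"
      using e bij_is_inj[OF e(1)] by (auto simp: z J_def close_pairs_def inj_eq abs_le_iff)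
    finally show "z \<in> map_prod e e ` J \<longleftrightarrow> z \<in> close_pairs a p L" .
  qed
  ultimately have "card J = card (close_pairs a p L)"
    by (metis card_image inj_on_subset subset_UNIV)
  then show ?thesis
    unfolding R2_def pair_correlation_def l_def[symmetric] J_def[symmetric] by simp
qed

lemma card_close_pairs_mono:
  assumes "L \<le> L'"
  shows "card (close_pairs a p L) \<le> card (close_pairs a p L')"
  using assms by (intro card_mono finite_close_pairs) (auto simp: close_pairs_def)

lemma tendsto_lattice_value: "((\<lambda>q. lattice_value q x) \<longlongrightarrow> lattice_value p x) (nhds p)"
  unfolding lattice_value_def by (intro tendsto_intros filterlim_ident)

lemma tendsto_lattice_value_diff:
  "((\<lambda>q. \<bar>lattice_value q x - lattice_value q y\<bar>) \<longlongrightarrow> \<bar>lattice_value p x - lattice_value p y\<bar>) (nhds p)"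
  by (intro tendsto_intros tendsto_lattice_value)

text \<open>
  Equal values stay within \<open>a\<close> of each other, and values below \<open>L\<close> stay below \<open>L\<close>, when the centre moves
  slightly: this makes coincidences at one point count at all nearby points.
\<close>

lemma eventually_close_pairs_superset:
  assumes "finite E" "a > 0"
    "\<And>x y. (x, y) \<in> E \<Longrightarrow> x \<noteq> y \<and> lattice_value p x = lattice_value p y \<and> lattice_value p x < L"
  shows "\<forall>\<^sub>F q in nhds p. E \<subseteq> close_pairs a q L"
proof -
  have "\<forall>\<^sub>F q in nhds p. z \<in> close_pairs a q L" if "z \<in> E" for z
  proof -
    obtain x y where z: "z = (x, y)"
      by (cases z)
    note E = assms(3)[OF that[unfolded z]]
    have "\<forall>\<^sub>F q in nhds p. lattice_value q x < L" "\<forall>\<^sub>F q in nhds p. lattice_value q y < L"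
      using E by (auto intro!: order_tendstoD(2)[OF tendsto_lattice_value])
    moreover have "\<forall>\<^sub>F q in nhds p. \<bar>lattice_value q x - lattice_value q y\<bar> < a"
      using E assms(2) by (intro order_tendstoD(2)[OF tendsto_lattice_value_diff]) auto
    ultimately show ?thesis
      by eventually_elim (use E in \<open>auto simp: z close_pairs_def\<close>)
  qed
  then have "\<forall>\<^sub>F q in nhds p. \<forall>z\<in>E. z \<in> close_pairs a q L"
    by (intro eventually_ball_finite assms) auto
  then show ?thesis
    by eventually_elim auto
qed

text \<open>
  A bound uniform for all centres near \<open>p\<close>, so that only finitely many lattice points matter there.
\<close>

lemma lattice_value_le_of_near:
  assumes "dist q p < 1"
  shows "lattice_value p x \<le> 2 * lattice_value q x + 2"
proof -
  have *: "(u - s)\<^sup>2 \<le> 2 * (u - t)\<^sup>2 + 2 * (t - s)\<^sup>2" for u s t :: real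
    using zero_le_power2[of "(u - t) - (t - s)"] by (simp add: power2_eq_square algebra_simps)
  have "(dist q p)\<^sup>2 = (fst q - fst p)\<^sup>2 + (snd q - snd p)\<^sup>2"
    by (simp add: dist_prod_def dist_real_def)
  moreover have "(dist q p)\<^sup>2 \<le> 1"
    using assms by (simp add: power_le_one)
  ultimately have d: "(fst q - fst p)\<^sup>2 + (snd q - snd p)\<^sup>2 \<le> 1"
    by simp
  have "lattice_value p x \<le> (2 * (of_int (fst x) - fst q)\<^sup>2 + 2 * (fst q - fst p)\<^sup>2) +
      (2 * (of_int (snd x) - snd q)\<^sup>2 + 2 * (snd q - snd p)\<^sup>2)"
    unfolding lattice_value_def by (intro add_mono *)
  also have "\<dots> = 2 * lattice_value q x + 2 * ((fst q - fst p)\<^sup>2 + (snd q - snd p)\<^sup>2)"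
    by (simp add: lattice_value_def distrib_left)
  also have "\<dots> \<le> 2 * lattice_value q x + 2 * 1"
    by (intro add_left_mono mult_left_mono d) simp
  finally show ?thesis
    by simp
qed

text \<open>
  Upper semicontinuity of the pair count: the conditions on a pair are closed, and among the finitely many
  pairs that can matter near \<open>p\<close>, each one that violates a condition at \<open>p\<close> violates it nearby.
\<close>

lemma eventually_close_pairs_subset:
  "\<forall>\<^sub>F q in nhds p. close_pairs a q L \<subseteq> close_pairs a p L"
proof -
  define X where "X = {x. lattice_value p x \<le> 2 * L + 2}"
  have "\<forall>\<^sub>F q in nhds p. z \<notin> close_pairs a q L" if "z \<in> X \<times> X - close_pairs a p L" for z
  proof -
    obtain x y where z: "z = (x, y)"
      by (cases z)
    have "x = y \<or> L < lattice_value p x \<or> L < lattice_value p y \<or>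
        a < \<bar>lattice_value p x - lattice_value p y\<bar>"
      using that by (auto simp: z close_pairs_def not_le)
    then consider "x = y" | "L < lattice_value p x" | "L < lattice_value p y"
      | "a < \<bar>lattice_value p x - lattice_value p y\<bar>"
      by blast
    then show ?thesis
    proof cases
      case 1
      then show ?thesis by (simp add: z close_pairs_def)
    next
      case 2
      from order_tendstoD(1)[OF tendsto_lattice_value this] show ?thesis
        by eventually_elim (auto simp: z close_pairs_def)
    next
      case 3
      from order_tendstoD(1)[OF tendsto_lattice_value this] show ?thesis
        by eventually_elim (auto simp: z close_pairs_def)
    next
      case 4
      from order_tendstoD(1)[OF tendsto_lattice_value_diff this] show ?thesis
        by eventually_elim (auto simp: z close_pairs_def)
    qed
  qed
  moreover have "finite (X \<times> X - close_pairs a p L)"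
    by (simp add: X_def finite_lattice_value_le)
  ultimately have "\<forall>\<^sub>F q in nhds p. \<forall>z\<in>X \<times> X - close_pairs a p L. z \<notin> close_pairs a q L"
    by (intro eventually_ball_finite) auto
  moreover have "\<forall>\<^sub>F q in nhds p. dist q p < 1"
    by (rule eventually_nhds_metric[THEN iffD2]) (auto intro!: exI[of _ 1])
  ultimately show ?thesis
  proof eventually_elim
    case (elim q)
    have "close_pairs a q L \<subseteq> X \<times> X"
    proof
      fix z assume "z \<in> close_pairs a q L"
      then obtain x y where z: "z = (x, y)" "lattice_value q x \<le> L" "lattice_value q y \<le> L"
        by (auto simp: close_pairs_def)
      then show "z \<in> X \<times> X"
        using lattice_value_le_of_near[OF elim(2), of x] lattice_value_le_of_near[OF elim(2), of y]
        by (simp add: X_def)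
    qed
    with elim(1) show ?case by auto
  qed
qed

text \<open>
  An intermediate value theorem without continuity: \<open>f L / L\<close> can jump only upwards, so between a point where
  it is at least \<open>c\<close> and a later one where it is at most \<open>c'\<close> it meets \<open>[c, c']\<close>. If \<open>f\<close> is below the line of slope
  \<open>c\<close> at the right end, the last point at which it reaches that line lies exactly on it.
\<close>

lemma monotone_meets_line:
  fixes f :: "real \<Rightarrow> real"
  assumes mono: "\<And>L L'. L \<le> L' \<Longrightarrow> f L \<le> f L'"
    and c: "0 < c" "c \<le> c'" and L: "0 \<le> L1" "L1 \<le> L2" "c * L1 \<le> f L1" "f L2 \<le> c' * L2"
  obtains L where "L1 \<le> L" "c * L \<le> f L" "f L \<le> c' * L"
proof (cases "c * L2 \<le> f L2")
  case True
  with L that show ?thesis by auto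
next
  case False
  define S where "S = {L \<in> {L1..L2}. c * L \<le> f L}"
  define m where "m = Sup S"
  have S: "L1 \<in> S" "bdd_above S"
    using L by (auto simp: S_def)
  then have m1: "L1 \<le> m"
    unfolding m_def by (rule cSup_upper)
  have m2: "m \<le> L2"
    unfolding m_def using S by (intro cSup_least) (auto simp: S_def)
  have "s \<le> f m / c" if "s \<in> S" for s
  proof -
    have "c * s \<le> f s" "f s \<le> f m"
      using that cSup_upper[OF that S(2)] by (auto simp: S_def m_def intro!: mono)
    then show ?thesis
      using c by (simp add: field_simps)
  qed
  \<comment> \<open>The supremum is attained, as \<open>f\<close> is nondecreasing.\<close>
  then have "m \<le> f m / c"
    unfolding m_def using S by (intro cSup_least) (auto simp: m_def)
  then have ge: "c * m \<le> f m"
    using c by (simp add: field_simps)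
  then have lt: "m < L2"
    using False m2 by (metis order_le_less)
  have "f m / c \<le> m"
  proof (rule dense_ge_bounded[OF lt])
    fix x assume x: "m < x" "x < L2"
    then have "x \<notin> S"
      using cSup_upper[OF _ S(2)] unfolding m_def by fastforce
    then have "f x < c * x"
      using x m1 by (auto simp: S_def)
    moreover have "f m \<le> f x"
      using x by (intro mono) simp
    ultimately show "f m / c \<le> x"
      using c by (simp add: field_simps)
  qed
  then have "f m \<le> c * m"
    using c by (simp add: field_simps)
  also have "\<dots> \<le> c' * m"
    using c m1 L by (intro mult_right_mono) auto
  finally show ?thesis
    using that[OF m1 ge] by simp
qed

section \<open>Second category on the torus\<close>

text \<open>
  The saturation of an open set of the plane is the union of its integer translates.
\<close>

lemma open_abs_torus_image:
  assumes "open U"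
  shows "open (abs_torus ` U)"
proof -
  have "abs_torus -` abs_torus ` U = (\<Union>z::int \<times> int. (\<lambda>p. p + (of_int (fst z), of_int (snd z))) ` U)"
  proof (rule set_eqI)
    fix p :: "real \<times> real"
    have "p \<in> abs_torus -` abs_torus ` U \<longleftrightarrow> (\<exists>u\<in>U. torus_rel p u)"
      by (auto simp: image_iff torus.abs_eq_iff)
    also have "\<dots> \<longleftrightarrow> (\<exists>u\<in>U. \<exists>i j. p = u + (of_int i, of_int j))"
    proof -
      have "torus_rel p u \<longleftrightarrow> (\<exists>i j. p = u + (of_int i, of_int j))" for u
        by (cases p; cases u) (auto simp: torus_rel_def Ints_def image_iff algebra_simps)
      then show ?thesis by simp
    qed
    also have "\<dots> \<longleftrightarrow> p \<in> (\<Union>z::int \<times> int. (\<lambda>p. p + (of_int (fst z), of_int (snd z))) ` U)"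
      by (auto simp: image_iff)
    finally show "p \<in> abs_torus -` abs_torus ` U \<longleftrightarrow>
        p \<in> (\<Union>z::int \<times> int. (\<lambda>p. p + (of_int (fst z), of_int (snd z))) ` U)" .
  qed
  moreover have "open ((\<lambda>p. p + w) ` U)" for w :: "real \<times> real"
    using open_translation[OF assms, of w] by (simp add: add.commute)
  ultimately show ?thesis
    unfolding open_torus_def by (auto intro!: open_UN)
qed

text \<open>
  An open set inside the preimage of the closure would project to an open set inside the closure.
\<close>

lemma nowhere_dense_torus_complement:
  fixes F :: "torus set"
  assumes "nowhere_dense F"
  shows "open (- (abs_torus -` closure F))" "closure (- (abs_torus -` closure F)) = UNIV"
proof -
  have "open (- closure F)"
    by auto
  then show "open (- (abs_torus -` closure F))"
    by (simp add: open_torus_def vimage_Compl)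
  have "interior (abs_torus -` closure F) = {}"
  proof -
    have "abs_torus ` interior (abs_torus -` closure F) \<subseteq> interior (closure F)"
      using interior_subset by (intro interior_maximal open_abs_torus_image) fastforce+
    then show ?thesis
      using assms by (auto simp: nowhere_dense_def)
  qed
  then show "closure (- (abs_torus -` closure F)) = UNIV"
    by (simp add: closure_complement)
qed

text \<open>
  If the nowhere dense sets \<open>F n\<close> covered \<open>C\<close>, the complements of the preimages of their closures would be
  further dense open sets of the plane, and Baire's theorem would yield a point outside all of them that
  projects into \<open>C\<close>.
\<close>

lemma second_category_torusI:
  fixes \<W> :: "(real \<times> real) set set"
  assumes W: "countable \<W>" "\<And>W. W \<in> \<W> \<Longrightarrow> open W" "\<And>W. W \<in> \<W> \<Longrightarrow> closure W = UNIV"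
    and C: "\<And>p. p \<in> \<Inter>\<W> \<Longrightarrow> abs_torus p \<in> C"
  shows "second_category C"
  unfolding second_category_def
proof
  assume "first_category C"
  then obtain F :: "nat \<Rightarrow> torus set" where F: "\<And>n. nowhere_dense (F n)" "C = (\<Union>n. F n)"
    by (auto simp: first_category_def)
  define G where "G = \<W> \<union> range (\<lambda>n. - (abs_torus -` closure (F n)))"
  have "UNIV \<subseteq> closure (\<Inter>G)"
    by (rule Baire) (auto simp: G_def W nowhere_dense_torus_complement[OF F(1)])
  then obtain p where p: "p \<in> \<Inter>G"
    by (metis UNIV_not_empty closure_empty ex_in_conv subset_empty)
  then have "abs_torus p \<in> C"
    by (intro C) (auto simp: G_def)
  then obtain n where "abs_torus p \<in> F n"
    by (auto simp: F(2))
  then have "abs_torus p \<in> closure (F n)"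
    using closure_subset by blast
  moreover have "- (abs_torus -` closure (F n)) \<in> G"
    by (auto simp: G_def)
  ultimately show False
    using p by blast
qed

section \<open>Many coincidences at rational points\<close>

lemma card_cong_class_le:
  fixes l B :: nat
  assumes "l > 0" "\<And>i i'. i \<in> X \<Longrightarrow> i' \<in> X \<Longrightarrow> i mod l = i' mod l" "X \<subseteq> {..<B}"
  shows "card X \<le> B div l + 1"
proof -
  have "inj_on (\<lambda>i. i div l) X"
    by (rule inj_onI) (metis assms(2) div_mult_mod_eq)
  moreover have "(\<lambda>i. i div l) ` X \<subseteq> {..B div l}"
    using assms(3) by (auto intro!: div_le_mono)
  ultimately have "card X \<le> card {..B div l}"
    by (metis card_image card_mono finite_atMost)
  then show ?thesis by simp
qed

text \<open>
  Comparison with a telescoping sum: \<open>(2k + 1)\<^sup>2 \<ge> 4k(k + 1)\<close>.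
\<close>

lemma sum_inverse_odd_squares_le:
  "(\<Sum>k=1..B. 1 / (2 * real k + 1)\<^sup>2) \<le> 1/4"
proof -
  have "(\<Sum>k=1..B. 1 / (2 * real k + 1)\<^sup>2) \<le> (1 - 1 / (real B + 1)) / 4"
  proof (induction B)
    case (Suc B)
    have "4 * (real B + 1) * (real B + 2) \<le> (2 * real (Suc B) + 1)\<^sup>2"
      by (simp add: power2_eq_square algebra_simps)
    then have "1 / (2 * real (Suc B) + 1)\<^sup>2 \<le> 1 / (4 * (real B + 1) * (real B + 2))"
      by (intro divide_left_mono) (auto intro!: mult_pos_pos)
    also have "\<dots> = (1 / (real B + 1) - 1 / (real B + 2)) / 4"
      by (simp add: field_simps)
    finally have "(\<Sum>k=1..B. 1 / (2 * real k + 1)\<^sup>2) + 1 / (2 * real (Suc B) + 1)\<^sup>2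
        \<le> (1 - 1 / (real B + 1)) / 4 + (1 / (real B + 1) - 1 / (real B + 2)) / 4"
      by (rule add_mono[OF Suc])
    also have "\<dots> = (1 - 1 / (real B + 2)) / 4"
      by (simp add: diff_divide_distrib)
    finally have "(\<Sum>k=1..B. 1 / (2 * real k + 1)\<^sup>2) + 1 / (2 * real (Suc B) + 1)\<^sup>2
        \<le> (1 - 1 / (real B + 2)) / 4" .
    then show ?case
      by (simp add: add.commute)
  qed simp
  also have "\<dots> \<le> 1/4"
    by simp
  finally show ?thesis .
qed

definition coprime_box :: "nat \<Rightarrow> nat \<Rightarrow> (nat \<times> nat) set" where
  "coprime_box N B = {(i, j). i < B \<and> 1 \<le> j \<and> j \<le> B \<and> coprime (1 + N * i) (N * j)}"

text \<open>
  Coprime pairs in the progressions \<open>1 + N i\<close> and \<open>N j\<close> have density at least \<open>1/2\<close>, without any error term.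
  A common prime divisor \<open>l\<close> does not divide \<open>N\<close>, hence is odd because \<open>N\<close> is even. It divides at most \<open>B/l\<close> of
  the \<open>j\<close>, and at most \<open>B/l + 1 \<le> 2B/l\<close> of the numbers \<open>1 + N i\<close> when \<open>l \<le> B\<close>; the sum of \<open>2/l\<^sup>2\<close> over odd
  \<open>l \<ge> 3\<close> is at most \<open>1/2\<close>.
\<close>

lemma card_coprime_box:
  fixes N B :: nat
  assumes "even N"
  shows "(real B)\<^sup>2 / 2 \<le> card (coprime_box N B)"
proof -
  define X where "X l = {i. i < B \<and> l dvd 1 + N * i}" for l
  define Y where "Y l = {j. 1 \<le> j \<and> j \<le> B \<and> l dvd j}" for l
  \<comment> \<open>The pairs with a common divisor \<open>2k + 1\<close>; such a divisor is at most \<open>B\<close> because it divides \<open>j \<le> B\<close>.\<close>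
  define bad where "bad = (\<Union>k\<in>{1..B}. X (2*k+1) \<times> Y (2*k+1))"
  have finX: "finite (X l)" and finY: "finite (Y l)" for l
    by (auto simp: X_def Y_def)
  have finb: "finite bad"
    using finX finY by (auto simp: bad_def)
  have cardX: "card (X l) \<le> B div l + 1" if "l > 0" for l
  proof (rule card_cong_class_le[OF that])
    fix i i' assume i: "i \<in> X l" "i' \<in> X l"
    have "coprime l N"
    proof (rule coprimeI)
      fix d assume d: "d dvd l" "d dvd N"
      have "d dvd 1 + N * i"
        using d(1) i(1) unfolding X_def by (blast intro: dvd_trans)
      moreover have "d dvd N * i"
        using d(2) by simp
      ultimately show "is_unit d"
        using dvd_add_left_iff by blast
    qed
    moreover have "[1 + N * i = 1 + N * i'] (mod l)"
      using i unfolding X_def by (simp add: cong_def mod_eq_0_iff_dvd del: add_Suc)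
    ultimately show "i mod l = i' mod l"
      by (metis cong_add_lcancel_nat cong_def cong_mult_lcancel_nat coprime_commute)
  qed (auto simp: X_def)
  have cardY: "card (Y l) \<le> B div l" if "l > 0" for l
  proof -
    have "Y l \<subseteq> (\<lambda>i. l * i) ` {1..B div l}"
      using that by (auto simp: Y_def elim!: dvdE) (metis (no_types, lifting) One_nat_def Suc_leI atLeastAtMost_iff div_le_mono image_eqI mult_is_0 nonzero_mult_div_cancel_left not_gr0)
    then show ?thesis
      using card_mono[of "(\<lambda>i. l * i) ` {1..B div l}" "Y l"] card_image_le[of "{1..B div l}" "\<lambda>i. l * i"] by simp
  qed
  have XY: "card (X l \<times> Y l) \<le> 2 * (real B)\<^sup>2 / (real l)\<^sup>2" if "l > 0" for l
  proof (cases "l \<le> B")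
    case True
    have b: "real (B div l) \<le> B / l"
      by (rule of_nat_div_le_of_nat)
    have "1 \<le> real B / l"
      using True that by simp
    then have "real (card (X l)) \<le> 2 * (B / l)"
      using cardX[OF that] b by linarith
    moreover have "real (card (Y l)) \<le> B / l"
      using cardY[OF that] b by linarith
    ultimately have "real (card (X l)) * card (Y l) \<le> 2 * (B / l) * (B / l)"
      by (intro mult_mono) auto
    then show ?thesis
      by (simp add: card_cartesian_product power2_eq_square)
  next
    case False
    then have "Y l = {}"
      by (auto simp: Y_def dest: dvd_imp_le)
    then show ?thesis by simp
  qed
  have "card bad \<le> (\<Sum>k\<in>{1..B}. card (X (2*k+1) \<times> Y (2*k+1)))"
    unfolding bad_def by (rule card_UN_le) simp
  then have "real (card bad) \<le> real (\<Sum>k\<in>{1..B}. card (X (2*k+1) \<times> Y (2*k+1)))"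
    by (simp only: of_nat_le_iff)
  also have "\<dots> = (\<Sum>k=1..B. real (card (X (2*k+1) \<times> Y (2*k+1))))"
    by (simp only: of_nat_sum)
  also have "\<dots> \<le> (\<Sum>k=1..B. 2 * (real B)\<^sup>2 / (real (2*k+1))\<^sup>2)"
    by (intro sum_mono XY) simp
  also have "\<dots> = 2 * (real B)\<^sup>2 * (\<Sum>k=1..B. 1 / (2 * real k + 1)\<^sup>2)"
    by (simp add: sum_distrib_left add.commute)
  also have "\<dots> \<le> 2 * (real B)\<^sup>2 * (1/4)"
    by (intro mult_left_mono sum_inverse_odd_squares_le) simp
  finally have cb: "real (card bad) \<le> (real B)\<^sup>2 / 2" by simp
  have sub: "{..<B} \<times> {1..B} \<subseteq> coprime_box N B \<union> bad"
  proof clarsimp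
    fix i j assume ij: "i < B" "Suc 0 \<le> j" "j \<le> B" and nb: "(i, j) \<notin> bad"
    have "coprime (1 + N * i) (N * j)"
    proof (rule ccontr)
      assume "\<not> coprime (1 + N * i) (N * j)"
      then obtain l where l: "prime l" "l dvd 1 + N * i" "l dvd N * j"
        using prime_factor_nat[of "gcd (1 + N * i) (N * j)"] by (auto simp: coprime_iff_gcd_eq_1)
      have nN: "\<not> l dvd N"
        using l(1,2) by (metis dvd_add_left_iff dvd_mult2 not_prime_unit)
      then have lj: "l dvd j"
        using l(1,3) by (simp add: prime_dvd_mult_iff)
      have "odd l"
        using nN assms l(1) primes_dvd_imp_eq two_is_prime_nat by blast
      then obtain k where k: "l = 2 * k + 1"
        by (elim oddE)
      have "k \<noteq> 0"
        using k l(1) not_prime_1 by (metis add_0 mult_0_right)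
      moreover have "k \<le> B"
        using lj ij dvd_imp_le[OF lj] k by linarith
      ultimately have "(i, j) \<in> bad"
        unfolding bad_def X_def Y_def using k l lj ij by (intro UN_I[of k]) auto
      then show False using nb by simp
    qed
    then show "(i, j) \<in> coprime_box N B"
      using ij by (auto simp: coprime_box_def)
  qed
  have finc: "finite (coprime_box N B)"
    by (rule finite_subset[of _ "{..<B} \<times> {1..B}"]) (auto simp: coprime_box_def)
  have "B * B \<le> card (coprime_box N B \<union> bad)"
    using card_mono[OF _ sub] finb finc by simp
  also have "\<dots> \<le> card (coprime_box N B) + card bad"
    by (rule card_Un_le)
  finally have "real (B * B) \<le> real (card (coprime_box N B) + card bad)"
    by (simp only: of_nat_le_iff)
  then show ?thesis
    using cb by (simp add: power2_eq_square)
qed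


text \<open>
  The dyadic shells are disjoint, and each of them carries a comparable share of the sum of \<open>1/|\<beta>|\<^sup>2\<close>; adding these
  shares over about \<open>log L\<close> shells produces the logarithm.
\<close>

definition coprime_shell :: "nat \<Rightarrow> nat \<Rightarrow> (nat \<times> nat) set" where
  "coprime_shell N r = coprime_box N (2 ^ (r + 1)) - {..<2 ^ r} \<times> {1..2 ^ r}"

lemma finite_coprime_box: "finite (coprime_box N B)"
  by (rule finite_subset[of _ "{..<B} \<times> {1..B}"]) (auto simp: coprime_box_def)

lemma finite_coprime_shell: "finite (coprime_shell N r)"
  by (simp add: coprime_shell_def finite_coprime_box)

text \<open>
  The box of side \<open>2\<^bsup>r+1\<^esup>\<close> contains at least \<open>2 \<sqdot> 4\<^sup>r\<close> coprime pairs, and the box removed from it has only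
  \<open>4\<^sup>r\<close> elements.
\<close>

lemma card_coprime_shell:
  assumes "even N"
  shows "4 ^ r \<le> real (card (coprime_shell N r))"
proof -
  have "real (card (coprime_box N (2 ^ (r + 1)))) \<ge> (real (2 ^ (r + 1)))\<^sup>2 / 2"
    by (rule card_coprime_box[OF assms])
  moreover have "(real (2 ^ (r + 1)))\<^sup>2 / 2 = 2 * 4 ^ r"
    by (simp add: power_mult_distrib power2_eq_square flip: power_mult_distrib)
  moreover have "card (coprime_box N (2 ^ (r + 1))) - card ({..<2 ^ r :: nat} \<times> {1..2 ^ r :: nat})
      \<le> card (coprime_shell N r)"
    unfolding coprime_shell_def by (rule diff_card_le_card_Diff) simp
  then have "real (card (coprime_box N (2 ^ (r + 1)))) \<le>
      real (card (coprime_shell N r)) + real (card ({..<2 ^ r :: nat} \<times> {1..2 ^ r :: nat}))"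
    by linarith
  moreover have "real (card ({..<2 ^ r :: nat} \<times> {1..2 ^ r :: nat})) = 4 ^ r"
    by (simp add: card_cartesian_product flip: power_mult_distrib)
  ultimately show ?thesis
    by linarith
qed

lemma coprime_shell_disjoint:
  assumes "r \<noteq> r'"
  shows "coprime_shell N r \<inter> coprime_shell N r' = {}"
proof -
  have *: "coprime_shell N r \<inter> coprime_shell N r' = {}" if "r < r'" for r r'
  proof -
    have "(2::nat) ^ (r + 1) \<le> 2 ^ r'"
      using that by (intro power_increasing) auto
    then show ?thesis
      by (auto simp: coprime_shell_def coprime_box_def)
  qed
  show ?thesis
    using assms *[of r r'] *[of r' r] by (metis inf_commute linorder_neqE_nat)
qed

definition equal_pairs :: "real \<times> real \<Rightarrow> real \<Rightarrow> ((int \<times> int) \<times> (int \<times> int)) set" where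
  "equal_pairs p L = {(x, y). x \<noteq> y \<and> lattice_value p x = lattice_value p y \<and> lattice_value p x < L}"

lemma finite_equal_pairs: "finite (equal_pairs p L)"
  by (rule finite_subset[of _ "{x. lattice_value p x \<le> L} \<times> {x. lattice_value p x \<le> L}"])
    (auto simp: equal_pairs_def finite_lattice_value_le)

text \<open>
  For \<open>m \<ge> 1\<close> these are the positive integers congruent to \<open>-b\<close> modulo \<open>N\<close>, in increasing order.
\<close>

definition residue_rep :: "nat \<Rightarrow> int \<Rightarrow> nat \<Rightarrow> int" where
  "residue_rep N b m = int N * int m - b mod int N"

lemma residue_rep_bounds:
  assumes "N > 0" "1 \<le> m" "m \<le> A"
  shows "0 < residue_rep N b m" "residue_rep N b m \<le> int N * int A"
proof -
  have "0 \<le> b mod int N" "b mod int N < int N"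
    using assms by auto
  moreover have "int N * 1 \<le> int N * int m" "int N * int m \<le> int N * int A"
    using assms by (auto intro!: mult_left_mono)
  ultimately show "0 < residue_rep N b m" "residue_rep N b m \<le> int N * int A"
    unfolding residue_rep_def by linarith+
qed

lemma residue_rep_inj:
  assumes "N > 0" "residue_rep N b m = residue_rep N b m'"
  shows "m = m'"
  using assms by (simp add: residue_rep_def)

text \<open>
  Let \<open>\<alpha>\<close> be the Gaussian integer with coordinates \<open>A, C\<close> and \<open>\<beta>\<close> the one with coordinates \<open>1 + N i, N j\<close>.
  These are the two lattice points whose differences from \<open>(b/N, c/N)\<close>, multiplied by \<open>N\<close>, are \<open>\<alpha>\<beta>\<close> and \<open>\<alpha>\<close>
  times the conjugate of \<open>\<beta>\<close>.
\<close>

definition conj_pair :: "nat \<Rightarrow> int \<Rightarrow> int \<Rightarrow> (nat \<times> nat) \<times> (nat \<times> nat) \<Rightarrow> (int \<times> int) \<times> (int \<times> int)" where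
  "conj_pair N b c = (\<lambda>((i, j), (m, n)).
     let A = residue_rep N b m; C = residue_rep N c n in
     ((int m + b div int N + A * int i - C * int j, int n + c div int N + A * int j + C * int i),
      (int m + b div int N + A * int i + C * int j, int n + c div int N - A * int j + C * int i)))"

lemma conj_pair_eqs:
  fixes N :: nat and b c :: int and i j m n :: nat
  defines "A \<equiv> residue_rep N b m" and "C \<equiv> residue_rep N c n"
    and "s \<equiv> 1 + int N * int i" and "t \<equiv> int N * int j"
  assumes "conj_pair N b c ((i, j), (m, n)) = ((x1, x2), (y1, y2))"
  shows "int N * x1 - b = A * s - C * t" "int N * x2 - c = A * t + C * s"
    "int N * y1 - b = A * s + C * t" "int N * y2 - c = C * s - A * t"
proof -
  have b: "int N * (int m + b div int N) - b = A"
    by (simp add: A_def residue_rep_def algebra_simps minus_mod_eq_mult_div [symmetric])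
  have c: "int N * (int n + c div int N) - c = C"
    by (simp add: C_def residue_rep_def algebra_simps minus_mod_eq_mult_div [symmetric])
  define M where "M = int m + b div int N"
  define K where "K = int n + c div int N"
  have b': "int N * M = A + b" and c': "int N * K = C + c"
    using b c by (simp_all add: M_def K_def)
  have eqs: "x1 = M + A * int i - C * int j" "x2 = K + A * int j + C * int i"
    "y1 = M + A * int i + C * int j" "y2 = K - A * int j + C * int i"
    using assms(5) by (auto simp: conj_pair_def Let_def A_def C_def M_def K_def)
  show "int N * x1 - b = A * s - C * t"
    unfolding eqs s_def t_def using b' by (simp add: algebra_simps)
  show "int N * x2 - c = A * t + C * s"
    unfolding eqs s_def t_def using c' by (simp add: algebra_simps)
  show "int N * y1 - b = A * s + C * t"
    unfolding eqs s_def t_def using b' by (simp add: algebra_simps)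
  show "int N * y2 - c = C * s - A * t"
    unfolding eqs s_def t_def using c' by (simp add: algebra_simps)
qed

lemma lattice_value_rational:
  assumes "N > 0"
  shows "lattice_value (of_int b / of_nat N, of_int c / of_nat N) (x1, x2) =
    of_int ((int N * x1 - b)\<^sup>2 + (int N * x2 - c)\<^sup>2) / (real N)\<^sup>2"
  using assms by (simp add: lattice_value_def field_simps power2_eq_square)

text \<open>
  Both points have the value \<open>|\<alpha>|\<^sup>2 |\<beta>|\<^sup>2 / N\<^sup>2\<close>; they differ because neither \<open>\<alpha>\<close> nor the imaginary part of \<open>\<beta>\<close>
  vanishes.
\<close>

lemma conj_pair_equal_pairs:
  assumes N: "N > 0" and j: "1 \<le> j" and m: "1 \<le> m" "m \<le> A" and n: "1 \<le> n" "n \<le> A"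
    and ij: "1 + N * i \<le> N * B" "j \<le> B" and L: "4 * (real N * real A * real B)\<^sup>2 < L"
  shows "conj_pair N b c ((i, j), (m, n)) \<in> equal_pairs (of_int b / of_nat N, of_int c / of_nat N) L"
proof -
  obtain x1 x2 y1 y2 where xy: "conj_pair N b c ((i, j), (m, n)) = ((x1, x2), (y1, y2))"
    by (metis surj_pair)
  define P where "P = residue_rep N b m"
  define Q where "Q = residue_rep N c n"
  define s where "s = 1 + int N * int i"
  define t where "t = int N * int j"
  note eqs = conj_pair_eqs[OF xy, folded P_def Q_def s_def t_def]
  have P: "0 < P" "P \<le> int N * int A" and Q: "0 < Q" "Q \<le> int N * int A"
    using residue_rep_bounds[OF N m] residue_rep_bounds[OF N n] by (auto simp: P_def Q_def)
  have "s \<le> int N * int B"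
    using ij(1) unfolding s_def by (metis of_nat_1 of_nat_add of_nat_le_iff of_nat_mult)
  then have s: "0 < s" "s \<le> int N * int B"
    by (auto simp: s_def add_pos_nonneg)
  have t: "0 < t" "t \<le> int N * int B"
    using N j ij(2) by (auto simp: t_def)
  have vx: "(int N * x1 - b)\<^sup>2 + (int N * x2 - c)\<^sup>2 = (P\<^sup>2 + Q\<^sup>2) * (s\<^sup>2 + t\<^sup>2)"
    unfolding eqs by algebra
  have vy: "(int N * y1 - b)\<^sup>2 + (int N * y2 - c)\<^sup>2 = (P\<^sup>2 + Q\<^sup>2) * (s\<^sup>2 + t\<^sup>2)"
    unfolding eqs by algebra
  have "(P\<^sup>2 + Q\<^sup>2) * (s\<^sup>2 + t\<^sup>2) \<le>
      ((int N * int A)\<^sup>2 + (int N * int A)\<^sup>2) * ((int N * int B)\<^sup>2 + (int N * int B)\<^sup>2)"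
    using P Q s t by (intro mult_mono add_mono power_mono) auto
  then have "real_of_int ((P\<^sup>2 + Q\<^sup>2) * (s\<^sup>2 + t\<^sup>2)) \<le>
      real_of_int (((int N * int A)\<^sup>2 + (int N * int A)\<^sup>2) * ((int N * int B)\<^sup>2 + (int N * int B)\<^sup>2))"
    by (simp only: of_int_le_iff)
  also have "\<dots> = 4 * (real N * real A * real B)\<^sup>2 * (real N)\<^sup>2"
    by (simp add: power2_eq_square algebra_simps)
  also have "\<dots> < L * (real N)\<^sup>2"
    using L N by simp
  finally have lt: "real_of_int ((P\<^sup>2 + Q\<^sup>2) * (s\<^sup>2 + t\<^sup>2)) / (real N)\<^sup>2 < L"
    using N by (simp add: field_simps)
  have "x1 \<noteq> y1"
  proof
    assume "x1 = y1"
    then have "P * s - Q * t = P * s + Q * t"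
      using eqs by metis
    then show False
      using Q(1) t(1) by simp
  qed
  then show ?thesis
    unfolding xy equal_pairs_def using lt by (simp add: lattice_value_rational[OF N] vx vy)
qed

text \<open>
  The quotient of the two products is \<open>\<beta>\<close> over its conjugate, which determines \<open>\<beta>\<close> up to a real factor. As its
  coordinates are nonnegative and coprime, \<open>\<beta>\<close> itself is determined, and then so is \<open>\<alpha>\<close>.
\<close>

lemma conj_pair_inj:
  assumes N: "N > 0"
    and cop: "coprime (1 + N * i) (N * j)" "coprime (1 + N * i') (N * j')"
    and m: "1 \<le> m" "1 \<le> m'"
    and eq: "conj_pair N b c ((i, j), (m, n)) = conj_pair N b c ((i', j'), (m', n'))"
  shows "i = i' \<and> j = j' \<and> m = m' \<and> n = n'"
proof -
  obtain x1 x2 y1 y2 where xy: "conj_pair N b c ((i, j), (m, n)) = ((x1, x2), (y1, y2))"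
    by (metis surj_pair)
  then have xy': "conj_pair N b c ((i', j'), (m', n')) = ((x1, x2), (y1, y2))"
    using eq by simp
  define P where "P = residue_rep N b m"
  define Q where "Q = residue_rep N c n"
  define s where "s = 1 + int N * int i"
  define t where "t = int N * int j"
  note eqs = conj_pair_eqs[OF xy, folded P_def Q_def s_def t_def]
  define P' where "P' = residue_rep N b m'"
  define Q' where "Q' = residue_rep N c n'"
  define s' where "s' = 1 + int N * int i'"
  define t' where "t' = int N * int j'"
  note eqs' = conj_pair_eqs[OF xy', folded P'_def Q'_def s'_def t'_def]
  have P: "0 < P" "0 < P'"
    using residue_rep_bounds(1)[OF N m(1) order_refl] residue_rep_bounds(1)[OF N m(2) order_refl]
    by (auto simp: P_def P'_def)
  have s: "0 < s" "0 < s'"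
    by (auto simp: s_def s'_def add_pos_nonneg)
  have 1: "P * s = P' * s'" "P * t = P' * t'" "Q * s = Q' * s'"
    using eqs eqs' by linarith+
  have "(P * P') * (s * t') = (P * s) * (P' * t')"
    by simp
  also have "\<dots> = (P' * s') * (P * t)"
    using 1 by simp
  also have "\<dots> = (P * P') * (s' * t)"
    by simp
  finally have "s * t' = s' * t"
    using P by simp
  then have "int ((1 + N * i) * (N * j')) = int ((1 + N * i') * (N * j))"
    unfolding s_def s'_def t_def t'_def by (simp only: of_nat_mult of_nat_add of_nat_1)
  then have "(1 + N * i) * (N * j') = (1 + N * i') * (N * j)"
    by (simp only: of_nat_eq_iff)
  then have "1 + N * i = 1 + N * i' \<and> N * j' = N * j"
    using coprime_crossproduct_nat cop by blast
  then have ij: "i = i'" "j = j'"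
    using N by auto
  then have "s = s'"
    by (simp add: s_def s'_def)
  then have "P = P'" "Q = Q'"
    using 1 s by auto
  then show ?thesis
    using ij residue_rep_inj[OF N] by (auto simp: P_def P'_def Q_def Q'_def)
qed

text \<open>
  For \<open>\<beta>\<close> in the shell of size \<open>2\<^sup>r\<close>, both coordinates of \<open>\<alpha>\<close> may run over about \<open>sqrt L / (8 N 2\<^sup>r)\<close> values.
  Multiplied by the \<open>4\<^sup>r\<close> choices of \<open>\<beta>\<close>, the pairs of each shell number at least a constant multiple of
  \<open>L\<close>.
\<close>

lemma card_equal_pairs_dyadic:
  fixes R N :: nat
  assumes N: "N > 0" "even N" and L: "L > 0" and R: "2 ^ R \<le> sqrt L / (4 * real N)"
  shows "real R * L / (256 * (real N)\<^sup>2) \<le> card (equal_pairs (of_int b / of_nat N, of_int c / of_nat N) L)"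
proof -
  define A where "A r = nat \<lfloor>sqrt L / (4 * real N * 2 ^ (r + 1))\<rfloor>" for r :: nat
  define S where "S r = coprime_shell N r \<times> ({1..A r} \<times> {1..A r})" for r
  define E where "E = equal_pairs (of_int b / of_nat N, of_int c / of_nat N) L"
  have A_le: "real (A r) \<le> sqrt L / (4 * real N * 2 ^ (r + 1))" for r
    unfolding A_def using L by (intro of_nat_floor) simp
  have A_ge: "sqrt L / (8 * real N * 2 ^ (r + 1)) \<le> real (A r)" if "r < R" for r
  proof -
    define u where "u = sqrt L / (4 * real N * 2 ^ (r + 1))"
    have "(2::real) ^ (r + 1) \<le> 2 ^ R"
      using that by (intro power_increasing) auto
    with R have "(2::real) ^ (r + 1) \<le> sqrt L / (4 * real N)"
      by linarith
    then have "1 \<le> u"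
      using N unfolding u_def by (simp add: field_simps)
    then have fl: "1 \<le> \<lfloor>u\<rfloor>"
      by simp
    then have "real (nat \<lfloor>u\<rfloor>) = of_int \<lfloor>u\<rfloor>" "1 \<le> real_of_int \<lfloor>u\<rfloor>"
      by simp_all
    then have "u / 2 \<le> real (nat \<lfloor>u\<rfloor>)"
      by linarith
    then show ?thesis
      by (simp add: A_def u_def)
  qed
  have sub: "conj_pair N b c ` (\<Union>r<R. S r) \<subseteq> E"
  proof (rule image_subsetI)
    fix z assume "z \<in> (\<Union>r<R. S r)"
    then obtain i j m n r where z: "z = ((i, j), (m, n))" and S: "((i, j), (m, n)) \<in> S r"
      by (metis UN_E surj_pair)
    have ij: "i < 2 ^ (r + 1)" "1 \<le> j" "j \<le> 2 ^ (r + 1)"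
      and mn: "1 \<le> m" "m \<le> A r" "1 \<le> n" "n \<le> A r"
      using S by (auto simp: S_def coprime_shell_def coprime_box_def)
    have "N * (i + 1) \<le> N * 2 ^ (r + 1)"
      using ij(1) by (intro mult_left_mono) auto
    then have i: "1 + N * i \<le> N * 2 ^ (r + 1)"
      using N(1) by simp
    have "real N * real (A r) * real (2 ^ (r + 1)) \<le> sqrt L / 4"
      using A_le[of r] N by (simp add: field_simps)
    then have "(real N * real (A r) * real (2 ^ (r + 1)))\<^sup>2 \<le> (sqrt L / 4)\<^sup>2"
      by (intro power_mono) auto
    then have "4 * (real N * real (A r) * real (2 ^ (r + 1)))\<^sup>2 < L"
      using L by (simp add: power_divide)
    then show "conj_pair N b c z \<in> E"
      unfolding E_def z by (rule conj_pair_equal_pairs[OF N(1) ij(2) mn i ij(3)])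
  qed
  have inj: "inj_on (conj_pair N b c) (\<Union>r<R. S r)"
  proof (rule inj_onI)
    fix z z' assume zS: "z \<in> (\<Union>r<R. S r)" "z' \<in> (\<Union>r<R. S r)"
      and eq': "conj_pair N b c z = conj_pair N b c z'"
    obtain i j m n r where z: "z = ((i, j), (m, n))" and S: "((i, j), (m, n)) \<in> S r"
      using zS(1) by (metis UN_E surj_pair)
    obtain i' j' m' n' r' where z': "z' = ((i', j'), (m', n'))" and S': "((i', j'), (m', n')) \<in> S r'"
      using zS(2) by (metis UN_E surj_pair)
    note eq = eq'[unfolded z z']
    show "z = z'"
      unfolding z z' using conj_pair_inj[OF N(1) _ _ _ _ eq] S S'
      by (auto simp: S_def coprime_shell_def coprime_box_def)
  qed
  have finS: "finite (S r)" for r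
    by (simp add: S_def finite_coprime_shell)
  have cardS: "L / (256 * (real N)\<^sup>2) \<le> real (card (S r))" if "r < R" for r
  proof -
    have "L / (256 * (real N)\<^sup>2) = 4 ^ r * (sqrt L / (8 * real N * 2 ^ (r + 1)))\<^sup>2"
    proof -
      have "((2::real) ^ r)\<^sup>2 = 4 ^ r"
        by (simp add: power2_eq_square flip: power_mult_distrib)
      then show ?thesis
        using L N by (simp add: power_divide power_mult_distrib field_simps)
    qed
    also have "\<dots> \<le> real (card (coprime_shell N r)) * (real (A r))\<^sup>2"
      using A_ge[OF that] L by (intro mult_mono card_coprime_shell N power_mono) auto
    also have "\<dots> = real (card (S r))"
      by (simp add: S_def card_cartesian_product power2_eq_square)
    finally show ?thesis .
  qed
  have "card (\<Union>r<R. S r) = (\<Sum>r<R. card (S r))"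
  proof (rule card_UN_disjoint)
    show "\<forall>r\<in>{..<R}. \<forall>r'\<in>{..<R}. r \<noteq> r' \<longrightarrow> S r \<inter> S r' = {}"
      using coprime_shell_disjoint[of _ _ N] by (fastforce simp: S_def)
  qed (auto simp: finS)
  then have "real R * (L / (256 * (real N)\<^sup>2)) \<le> real (card (\<Union>r<R. S r))"
    using sum_mono[of "{..<R}" "\<lambda>_. L / (256 * (real N)\<^sup>2)" "\<lambda>r. real (card (S r))"] cardS by simp
  also have "\<dots> \<le> real (card E)"
    using card_inj_on_le[OF inj sub] finite_equal_pairs by (simp add: E_def)
  finally show ?thesis
    by (simp add: E_def)
qed

lemma card_equal_pairs_rational:
  fixes N :: nat and b c :: int
  assumes N: "N > 0" "even N"
  obtains k where "k > 0"
    "\<forall>\<^sub>F L in at_top. k * L * ln L \<le> card (equal_pairs (of_int b / of_nat N, of_int c / of_nat N) L)"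
proof -
  define k where "k = 1 / (1024 * (real N)\<^sup>2)"
  have "\<forall>\<^sub>F L in at_top. ln L / 4 \<le> (ln L / 2 - M) / ln 2 - 1" for M :: real
  proof -
    have "\<forall>\<^sub>F L :: real in at_top. 2 * \<bar>M\<bar> + 4 * \<bar>M + 1\<bar> \<le> ln L"
      using ln_at_top by (simp add: filterlim_at_top)
    then show ?thesis
    proof eventually_elim
      case (elim L)
      define D where "D = ln L / 2 - M"
      have D: "0 \<le> D" "ln L / 4 \<le> D - 1"
        using elim abs_ge_self[of M] abs_ge_self[of "M + 1"] abs_ge_zero[of M] abs_ge_zero[of "M + 1"]
        unfolding D_def by argo+
      have "D * ln 2 \<le> D * 1"
        using D(1) ln_2_less_1 by (intro mult_left_mono) auto
      then have "D \<le> D / ln 2"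
        by (simp add: field_simps)
      with D show ?case
        unfolding D_def by linarith
    qed
  qed
  note this[of "ln (4 * real N)"]
  moreover have "\<forall>\<^sub>F L :: real in at_top. 1 < L"
    by (rule eventually_gt_at_top)
  ultimately have "\<forall>\<^sub>F L in at_top. k * L * ln L \<le> card (equal_pairs (of_int b / of_nat N, of_int c / of_nat N) L)"
  proof eventually_elim
    case (elim L)
    define R where "R = nat \<lfloor>log 2 (sqrt L / (4 * real N))\<rfloor>"
    have "log 2 (sqrt L / (4 * real N)) = (ln L / 2 - ln (4 * real N)) / ln 2"
      using elim(2) N by (simp add: log_def ln_div ln_sqrt)
    with elim(1) have lg: "ln L / 4 + 1 \<le> log 2 (sqrt L / (4 * real N))"
      by linarith
    have lnL: "0 < ln L"
      using elim(2) by simp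
    have Rge: "ln L / 4 \<le> real R"
      using lg lnL unfolding R_def by linarith
    have "real R \<le> log 2 (sqrt L / (4 * real N))"
      using lg lnL unfolding R_def by (intro of_nat_floor) linarith
    then have "2 powr real R \<le> 2 powr log 2 (sqrt L / (4 * real N))"
      by (intro powr_mono) auto
    also have "\<dots> = sqrt L / (4 * real N)"
      using elim(2) N by simp
    finally have "2 ^ R \<le> sqrt L / (4 * real N)"
      by (simp add: powr_realpow)
    from card_equal_pairs_dyadic[OF N _ this, of b c]
    have "real R * L / (256 * (real N)\<^sup>2) \<le> card (equal_pairs (of_int b / of_nat N, of_int c / of_nat N) L)"
      using elim(2) by simp
    moreover have "k * L * ln L \<le> real R * L / (256 * (real N)\<^sup>2)"
    proof -
      have "k * L * ln L = (ln L / 4) * (L / (256 * (real N)\<^sup>2))"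
        by (simp add: k_def)
      also have "\<dots> \<le> real R * (L / (256 * (real N)\<^sup>2))"
        using Rge elim(2) by (intro mult_right_mono) auto
      finally show ?thesis by simp
    qed
    ultimately show ?case
      by linarith
  qed
  moreover have "k > 0"
    using N by (simp add: k_def)
  ultimately show ?thesis
    using that by blast
qed

section \<open>Lattice points in a disc and the main term\<close>

definition normsq :: "int \<times> int \<Rightarrow> real" where
  "normsq h = (of_int (fst h))\<^sup>2 + (of_int (snd h))\<^sup>2"

definition punctured_disc :: "real \<Rightarrow> (int \<times> int) set" where
  "punctured_disc r = {h. h \<noteq> (0, 0) \<and> normsq h \<le> r\<^sup>2}"

lemma finite_normsq_le: "finite {h. normsq h \<le> c}"
  using finite_lattice_value_le[of "(0, 0)" c] by (simp add: lattice_value_def normsq_def)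

lemma finite_punctured_disc: "finite (punctured_disc r)"
  by (rule finite_subset[OF _ finite_normsq_le[of "r\<^sup>2"]]) (auto simp: punctured_disc_def)

text \<open>
  For \<open>k \<noteq> 0\<close> this is the unit interval that ends at \<open>k\<close> and lies between \<open>0\<close> and \<open>k\<close>, half open so that different
  \<open>k \<noteq> 0\<close> give disjoint intervals.
\<close>

definition inner_interval :: "int \<Rightarrow> real set" where
  "inner_interval k = (if k > 0 then {of_int k - 1<..of_int k} else {of_int k..<of_int k + 1})"

lemma inner_interval_unique:
  assumes "x \<in> inner_interval k" "x \<in> inner_interval k'" "k \<noteq> 0" "k' \<noteq> 0"
  shows "k = k'"
  using assms by (auto simp: inner_interval_def split: if_splits)

lemma abs_le_of_inner_interval:
  assumes "x \<in> inner_interval k" "k \<noteq> 0"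
  shows "\<bar>x\<bar> \<le> \<bar>of_int k\<bar>"
  using assms by (auto simp: inner_interval_def split: if_splits)

text \<open>
  Each lattice point off the axes owns the unit square that joins it to the next lines towards the origin.
  These squares are disjoint and lie in the disc, so the points off the axes number at most the area; the
  axes carry at most \<open>4 r\<close> further points.
\<close>

lemma card_punctured_disc_le:
  assumes "r \<ge> 0"
  shows "real (card (punctured_disc r)) \<le> pi * r\<^sup>2 + 4 * r"
proof -
  define Q where "Q = {h \<in> punctured_disc r. fst h \<noteq> 0 \<and> snd h \<noteq> 0}"
  define K where "K = {- \<lfloor>r\<rfloor>..\<lfloor>r\<rfloor>} - {0}"
  have finQ: "finite Q"
    by (simp add: Q_def finite_punctured_disc)
  define cell where "cell h = inner_interval (fst h) \<times> inner_interval (snd h)" for h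
  have int1: "emeasure lborel (inner_interval k) = 1" for k
    by (simp add: inner_interval_def)
  have meas: "cell h \<in> sets borel" for h
    unfolding cell_def borel_prod[symmetric]
    by (intro pair_measureI) (simp_all add: inner_interval_def)
  have cell1: "emeasure lborel (cell h) = 1" for h
  proof -
    have "inner_interval k \<in> sets lborel" for k
      by (simp add: inner_interval_def)
    then show ?thesis
      unfolding cell_def lborel_prod[symmetric]
      by (simp add: lborel.emeasure_pair_measure_Times int1)
  qed
  have "of_nat (card Q) = (\<Sum>h\<in>Q. emeasure lborel (cell h))"
    by (simp add: cell1)
  also have "\<dots> = emeasure lborel (\<Union>h\<in>Q. cell h)"
  proof (rule sum_emeasure)
    show "disjoint_family_on cell Q"
      unfolding disjoint_family_on_def
    proof (intro ballI impI)
      fix h h' assume h: "h \<in> Q" "h' \<in> Q" "h \<noteq> h'"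
      show "cell h \<inter> cell h' = {}"
      proof (rule ccontr)
        assume "cell h \<inter> cell h' \<noteq> {}"
        then obtain x y where "x \<in> inner_interval (fst h)" "x \<in> inner_interval (fst h')"
          "y \<in> inner_interval (snd h)" "y \<in> inner_interval (snd h')"
          by (auto simp: cell_def)
        then have "fst h = fst h'" "snd h = snd h'"
          using h inner_interval_unique by (auto simp: Q_def)
        then show False
          using h(3) by (simp add: prod_eq_iff)
      qed
    qed
  qed (auto simp: meas finQ)
  also have "\<dots> \<le> emeasure lborel (cball (0 :: real \<times> real) r)"
  proof (rule emeasure_mono)
    show "(\<Union>h\<in>Q. cell h) \<subseteq> cball 0 r"
    proof clarify
      fix x y h1 h2 assume h: "(h1, h2) \<in> Q" and xy: "(x, y) \<in> cell (h1, h2)"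
      have "\<bar>x\<bar> \<le> \<bar>of_int h1\<bar>" "\<bar>y\<bar> \<le> \<bar>of_int h2\<bar>"
        using h xy abs_le_of_inner_interval by (auto simp: Q_def cell_def)
      then have "x\<^sup>2 + y\<^sup>2 \<le> (of_int h1)\<^sup>2 + (of_int h2)\<^sup>2"
        by (intro add_mono) (simp_all add: abs_le_square_iff)
      also have "\<dots> \<le> r\<^sup>2"
        using h by (simp add: Q_def punctured_disc_def normsq_def)
      finally show "(x, y) \<in> cball 0 r"
        using assms by (simp add: norm_Pair real_le_lsqrt)
    qed
  qed simp
  also have "\<dots> = ennreal (pi * r\<^sup>2)"
    using assms by (simp add: emeasure_cball unit_ball_vol_2 power2_eq_square)
  finally have Q: "real (card Q) \<le> pi * r\<^sup>2"
    using assms by (simp flip: ennreal_of_nat_eq_real_of_nat)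
  have "punctured_disc r \<subseteq> Q \<union> ({0} \<times> K \<union> K \<times> {0})"
  proof
    fix h assume h: "h \<in> punctured_disc r"
    have *: "\<bar>k\<bar> \<le> \<lfloor>r\<rfloor>" if "(real_of_int k)\<^sup>2 \<le> r\<^sup>2" for k
    proof -
      have "\<bar>real_of_int k\<bar> \<le> r"
        using that assms abs_le_square_iff[of "real_of_int k" r] by simp
      then show ?thesis
        by linarith
    qed
    have "(real_of_int (fst h))\<^sup>2 \<le> r\<^sup>2" "(real_of_int (snd h))\<^sup>2 \<le> r\<^sup>2"
      using h zero_le_power2[of "real_of_int (fst h)"] zero_le_power2[of "real_of_int (snd h)"]
      unfolding punctured_disc_def normsq_def mem_Collect_eq by linarith+
    then have "\<bar>fst h\<bar> \<le> \<lfloor>r\<rfloor>" "\<bar>snd h\<bar> \<le> \<lfloor>r\<rfloor>"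
      using * by auto
    then show "h \<in> Q \<union> ({0} \<times> K \<union> K \<times> {0})"
      using h by (cases h) (auto simp: Q_def K_def punctured_disc_def)
  qed
  then have "card (punctured_disc r) \<le> card (Q \<union> ({0} \<times> K \<union> K \<times> {0}))"
    by (intro card_mono) (auto simp: finQ K_def)
  also have "\<dots> \<le> card Q + (card ({0::int} \<times> K) + card (K \<times> {0::int}))"
    by (meson add_left_mono card_Un_le order_trans)
  also have "\<dots> = card Q + 2 * card K"
    by (simp add: card_cartesian_product)
  finally have le: "real (card (punctured_disc r)) \<le> real (card Q) + 2 * real (card K)"
    by linarith
  have "card K = nat (2 * \<lfloor>r\<rfloor>)"
    using assms by (simp add: K_def card_Diff_singleton)
  then have "real (card K) = 2 * of_int \<lfloor>r\<rfloor>"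
    using assms by simp
  then have "real (card K) \<le> 2 * r"
    by linarith
  with Q le show ?thesis
    by linarith
qed

text \<open>
  The summand is the value of \<open>sqrt (1 - |x|\<^sup>2) / |x|\<close> at \<open>x = h / R\<close>, so up to lower order the sum is \<open>R\<^sup>2\<close> times the integral of this function over the unit disc, which is \<open>\<pi>\<^sup>2/2\<close>. The summand
  exceeds \<open>t\<close> exactly when \<open>|h|\<^sup>2 < R\<^sup>2 / (1 + t\<^sup>2)\<close>. Writing it as the length of an interval of such \<open>t\<close> and
  exchanging sum and integral, the bound follows from the count of lattice points in discs and the integral
  of \<open>1 / (1 + t\<^sup>2)\<close>.
\<close>

lemma sum_radial_le:
  assumes R: "R \<ge> 0" and d: "d > 0"
  shows "(\<Sum>h\<in>punctured_disc R. sqrt (R\<^sup>2 - normsq h) / sqrt (normsq h))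
    \<le> (pi + d) * (pi / 2) * R\<^sup>2 + 4 * R / d"
proof -
  define g where "g h = sqrt (R\<^sup>2 - normsq h) / sqrt (normsq h)" for h
  have norm1: "1 \<le> normsq h" if "h \<in> punctured_disc R" for h
  proof -
    have "0 < (fst h)\<^sup>2 + (snd h)\<^sup>2"
      using that by (cases h) (auto simp: punctured_disc_def sum_power2_gt_zero_iff)
    then have "1 \<le> real_of_int ((fst h)\<^sup>2 + (snd h)\<^sup>2)"
      by linarith
    then show ?thesis
      by (simp add: normsq_def)
  qed
  have g: "0 \<le> g h" "g h \<le> R" if "h \<in> punctured_disc R" for h
  proof -
    have n: "1 \<le> normsq h" "normsq h \<le> R\<^sup>2"
      using norm1[OF that] that by (auto simp: punctured_disc_def)
    then show "0 \<le> g h"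
      by (simp add: g_def)
    have "g h \<le> sqrt (R\<^sup>2) / 1"
      unfolding g_def using n by (intro frac_le real_sqrt_le_mono) auto
    then show "g h \<le> R"
      using R by simp
  qed
  have int_g: "((\<lambda>t. if t \<in> {0..g h} then 1 else 0) has_integral g h) {0..R}" if "h \<in> punctured_disc R" for h
  proof -
    have "((\<lambda>t. 1 :: real) has_integral g h) {0..g h}"
      using has_integral_const_real[of "1::real" 0 "g h"] g(1)[OF that] by simp
    then show ?thesis
      using g[OF that] by (subst has_integral_restrict) auto
  qed
  have int1: "((\<lambda>t. \<Sum>h\<in>punctured_disc R. if t \<in> {0..g h} then 1 else 0) has_integral
      (\<Sum>h\<in>punctured_disc R. g h)) {0..R}"
    by (intro has_integral_sum finite_punctured_disc int_g)
  define G where "G t = (pi + d) * R\<^sup>2 * arctan t + 4 / d * t" for t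
  have "((\<lambda>t. (pi + d) * R\<^sup>2 * (1 / (1 + t\<^sup>2)) + 4 / d) has_integral G R - G 0) {0..R}"
  proof (rule fundamental_theorem_of_calculus[OF R])
    fix t
    have "(G has_real_derivative (pi + d) * R\<^sup>2 * (1 / (1 + t\<^sup>2)) + 4 / d) (at t within {0..R})"
      unfolding G_def by (auto intro!: derivative_eq_intros simp: divide_inverse)
    then show "(G has_vector_derivative (pi + d) * R\<^sup>2 * (1 / (1 + t\<^sup>2)) + 4 / d) (at t within {0..R})"
      by (simp add: has_real_derivative_iff_has_vector_derivative)
  qed
  with int1 have "(\<Sum>h\<in>punctured_disc R. g h) \<le> G R - G 0"
  proof (rule has_integral_le)
    fix t assume t: "t \<in> {0..R}"
    define r where "r = R / sqrt (1 + t\<^sup>2)"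
    have r: "0 \<le> r" "r\<^sup>2 = R\<^sup>2 * (1 / (1 + t\<^sup>2))"
      using R by (auto simp: r_def power_divide)
    \<comment> \<open>The number of \<open>h\<close> whose summand reaches \<open>t\<close> is the number of lattice points in a disc of radius \<open>r\<close>.\<close>
    have "(\<Sum>h\<in>punctured_disc R. if t \<in> {0..g h} then 1 else (0::real)) =
        real (card {h \<in> punctured_disc R. t \<in> {0..g h}})"
      using finite_punctured_disc by (simp add: sum.If_cases Int_def)
    also have "\<dots> \<le> real (card (punctured_disc r))"
    proof -
      have "{h \<in> punctured_disc R. t \<in> {0..g h}} \<subseteq> punctured_disc r"
      proof clarify
        fix h1 h2 assume h: "(h1, h2) \<in> punctured_disc R" and "t \<in> {0..g (h1, h2)}"
        define m where "m = normsq (h1, h2)"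
        have m: "1 \<le> m" "m \<le> R\<^sup>2"
          using norm1[OF h] h by (auto simp: punctured_disc_def m_def)
        have "t * sqrt m \<le> sqrt (R\<^sup>2 - m)"
          using \<open>t \<in> {0..g (h1, h2)}\<close> m by (simp add: g_def m_def[symmetric] field_simps)
        then have "(t * sqrt m)\<^sup>2 \<le> (sqrt (R\<^sup>2 - m))\<^sup>2"
          using t m by (intro power_mono) auto
        then have "t\<^sup>2 * m \<le> R\<^sup>2 - m"
          using m by (simp add: power_mult_distrib)
        then have "m * (1 + t\<^sup>2) \<le> R\<^sup>2"
          by (simp add: algebra_simps)
        then have "m \<le> r\<^sup>2"
          unfolding r(2) by (simp add: field_simps add_pos_nonneg)
        then show "(h1, h2) \<in> punctured_disc r"
          using h by (simp add: punctured_disc_def m_def)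
      qed
      then show ?thesis
        by (simp add: card_mono finite_punctured_disc)
    qed
    also have "\<dots> \<le> pi * r\<^sup>2 + 4 * r"
      by (rule card_punctured_disc_le[OF r(1)])
    also have "\<dots> \<le> pi * r\<^sup>2 + (d * r\<^sup>2 + 4 / d)"
    proof -
      \<comment> \<open>The linear term of the disc count is absorbed at the price of a constant, which integrates to \<open>O(R)\<close>.\<close>
      have "0 \<le> (d * r - 2)\<^sup>2 / d"
        using d by simp
      also have "\<dots> = d * r\<^sup>2 + 4 / d - 4 * r"
        using d by (simp add: power2_eq_square field_simps)
      finally show ?thesis by simp
    qed
    also have "\<dots> = (pi + d) * R\<^sup>2 * (1 / (1 + t\<^sup>2)) + 4 / d"
      unfolding r(2) by (simp add: algebra_simps)
    finally show "(\<Sum>h\<in>punctured_disc R. if t \<in> {0..g h} then 1 else 0)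
        \<le> (pi + d) * R\<^sup>2 * (1 / (1 + t\<^sup>2)) + 4 / d" .
  qed
  also have "G R - G 0 \<le> (pi + d) * (pi / 2) * R\<^sup>2 + 4 * R / d"
  proof -
    have "(pi + d) * R\<^sup>2 * arctan R \<le> (pi + d) * R\<^sup>2 * (pi / 2)"
      using d arctan_ubound[of R] by (intro mult_left_mono) (auto simp: add_pos_pos less_imp_le)
    then show ?thesis
      by (simp add: G_def algebra_simps)
  qed
  finally show ?thesis
    by (simp add: g_def)
qed

section \<open>Sums of reciprocals of linear forms\<close>

lemma sum_inverse_le_sqrt: "(\<Sum>k=1..M. 1 / real k) \<le> 2 * sqrt (real M)"
proof (induction M)
  case (Suc M)
  define x y where "x = sqrt (real M)" and "y = sqrt (real (Suc M))"
  have xy: "0 \<le> x" "x \<le> y" "1 \<le> y" "y\<^sup>2 - x\<^sup>2 = 1" "real (Suc M) = y\<^sup>2"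
    by (auto simp: x_def y_def)
  have "(y - x) * (2 * y) \<ge> (y - x) * (y + x)"
    using xy by (intro mult_left_mono) auto
  then have "1 \<le> 2 * y * (y - x)"
    using xy(4) by (simp add: power2_eq_square algebra_simps)
  then have "y * 1 \<le> y * (2 * y * (y - x))"
    using xy by (intro mult_left_mono) auto
  moreover have "1 \<le> y"
    by (rule xy)
  ultimately have "1 \<le> 2 * (y - x) * y\<^sup>2"
    by (simp add: power2_eq_square algebra_simps)
  then have "1 / y\<^sup>2 \<le> 2 * (y - x)"
    using xy by (simp add: field_simps)
  with Suc show ?case
    unfolding xy(5)[symmetric] by (simp add: x_def y_def)
qed simp

text \<open>
  A function \<open>f\<close> whose fibres are separated by \<open>g\<close> takes each nonzero value at most \<open>card G\<close> times.
\<close>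

lemma sum_inverse_abs_le:
  fixes f :: "'a \<Rightarrow> int" and g :: "'a \<Rightarrow> 'b"
  assumes inj: "inj_on (\<lambda>x. (f x, g x)) A"
    and f: "\<And>x. x \<in> A \<Longrightarrow> f x \<noteq> 0 \<and> \<bar>f x\<bar> \<le> int M"
    and g: "g ` A \<subseteq> G" "finite G"
  shows "(\<Sum>x\<in>A. 1 / \<bar>real_of_int (f x)\<bar>) \<le> real (card G) * (4 * sqrt (real M))"
proof -
  define Z where "Z = {k. k \<noteq> 0 \<and> \<bar>k\<bar> \<le> int M}"
  have Z: "Z = int ` {1..M} \<union> (\<lambda>k. - int k) ` {1..M}"
  proof (intro subset_antisym subsetI)
    fix k assume k: "k \<in> Z"
    show "k \<in> int ` {1..M} \<union> (\<lambda>k. - int k) ` {1..M}"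
    proof (cases "k > 0")
      case True
      then show ?thesis
        using k by (intro UnI1 image_eqI[of _ _ "nat k"]) (auto simp: Z_def)
    next
      case False
      then show ?thesis
        using k by (intro UnI2 image_eqI[of _ _ "nat (- k)"]) (auto simp: Z_def)
    qed
  qed (auto simp: Z_def)
  have finZ: "finite Z"
    by (simp add: Z)
  have "(\<Sum>x\<in>A. 1 / \<bar>real_of_int (f x)\<bar>) = (\<Sum>z\<in>(\<lambda>x. (f x, g x)) ` A. 1 / \<bar>real_of_int (fst z)\<bar>)"
    by (simp add: sum.reindex[OF inj])
  also have "\<dots> \<le> (\<Sum>z\<in>Z \<times> G. 1 / \<bar>real_of_int (fst z)\<bar>)"
    using f g finZ by (intro sum_mono2) (auto simp: Z_def)
  also have "\<dots> = (\<Sum>k\<in>Z. \<Sum>y\<in>G. 1 / \<bar>real_of_int k\<bar>)"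
    unfolding sum.cartesian_product by (simp add: case_prod_beta)
  also have "\<dots> = real (card G) * (\<Sum>k\<in>Z. 1 / \<bar>real_of_int k\<bar>)"
    by (simp add: sum_distrib_left)
  also have "(\<Sum>k\<in>Z. 1 / \<bar>real_of_int k\<bar>) = (\<Sum>k=1..M. 1 / real k) + (\<Sum>k=1..M. 1 / real k)"
  proof -
    have "(\<Sum>k\<in>Z. 1 / \<bar>real_of_int k\<bar>) = (\<Sum>k\<in>int ` {1..M}. 1 / \<bar>real_of_int k\<bar>) +
        (\<Sum>k\<in>(\<lambda>k. - int k) ` {1..M}. 1 / \<bar>real_of_int k\<bar>)"
      unfolding Z by (rule sum.union_disjoint) auto
    moreover have "(\<Sum>k\<in>int ` {1..M}. 1 / \<bar>real_of_int k\<bar>) = (\<Sum>k=1..M. 1 / real k)"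
      by (subst sum.reindex) (auto simp: inj_on_def)
    moreover have "(\<Sum>k\<in>(\<lambda>k. - int k) ` {1..M}. 1 / \<bar>real_of_int k\<bar>) = (\<Sum>k=1..M. 1 / real k)"
      by (subst sum.reindex) (auto simp: inj_on_def)
    ultimately show ?thesis by simp
  qed
  also have "\<dots> \<le> 4 * sqrt (real M)"
    using sum_inverse_le_sqrt[of M] by linarith
  finally show ?thesis
    by (simp add: mult_left_mono)
qed

text \<open>
  This is the total error caused by one nonzero frequency. The first alternative is the decay of an
  oscillating integral along a strip; the second is the trivial bound, used for the \<open>h\<close> on the line where the
  frequency is constant along the strip. A nonzero linear form together with a suitable coordinate determines \<open>h\<close>, so each
  nonzero value occurs \<open>O(n)\<close> times, and on the exceptional line the first coordinate determines \<open>h\<close>.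
\<close>

lemma sum_linear_form_le:
  fixes u v :: int and n K :: nat and L :: real
  assumes uv: "u \<noteq> 0 \<or> v \<noteq> 0" "\<bar>u\<bar> \<le> int K" "\<bar>v\<bar> \<le> int K"
    and L: "1 \<le> L" "real n \<le> 2 * sqrt L"
    and A: "A \<subseteq> {h. fst h \<noteq> 0 \<and> \<bar>fst h\<bar> \<le> int n \<and> \<bar>snd h\<bar> \<le> int n}"
  shows "(\<Sum>h\<in>A. if u * fst h + v * snd h \<noteq> 0 then 1 / (pi * \<bar>of_int (u * fst h + v * snd h)\<bar>)
      else 2 * sqrt L / \<bar>of_int (fst h)\<bar>) \<le> (40 * sqrt (real K) + 12) * (sqrt L * sqrt (sqrt L))"
proof -
  define f where "f h = u * fst h + v * snd h" for h :: "int \<times> int"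
  define A1 where "A1 = {h \<in> A. f h \<noteq> 0}"
  define A0 where "A0 = {h \<in> A. f h = 0}"
  have finA: "finite A"
  proof (rule finite_subset[OF A], rule finite_subset)
    show "{h. fst h \<noteq> 0 \<and> \<bar>fst h\<bar> \<le> int n \<and> \<bar>snd h\<bar> \<le> int n} \<subseteq> {- int n..int n} \<times> {- int n..int n}"
      by auto
  qed simp
  have f_le: "\<bar>f h\<bar> \<le> int (2 * K * n)" if "h \<in> A" for h
  proof -
    have "\<bar>f h\<bar> \<le> \<bar>u\<bar> * \<bar>fst h\<bar> + \<bar>v\<bar> * \<bar>snd h\<bar>"
      unfolding f_def by (metis abs_mult abs_triangle_ineq)
    also have "\<dots> \<le> int K * int n + int K * int n"
      using that A uv by (intro add_mono mult_mono) auto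
    finally show ?thesis by simp
  qed
  have A1: "(\<Sum>h\<in>A1. 1 / \<bar>real_of_int (f h)\<bar>) \<le> real (2 * n + 1) * (4 * sqrt (real (2 * K * n)))"
  proof (cases "v = 0")
    case True
    have "(\<Sum>h\<in>A1. 1 / \<bar>real_of_int (f h)\<bar>) \<le> real (card {- int n..int n}) * (4 * sqrt (real (2 * K * n)))"
    proof (rule sum_inverse_abs_le[where g = snd])
      show "inj_on (\<lambda>h. (f h, snd h)) A1"
        using True uv by (auto simp: inj_on_def f_def)
      show "f h \<noteq> 0 \<and> \<bar>f h\<bar> \<le> int (2 * K * n)" if "h \<in> A1" for h
        using that f_le by (auto simp: A1_def)
      show "snd ` A1 \<subseteq> {- int n..int n}"
        using A by (auto simp: A1_def abs_le_iff)
    qed simp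
    then show ?thesis by (simp add: add.commute)
  next
    case False
    have "(\<Sum>h\<in>A1. 1 / \<bar>real_of_int (f h)\<bar>) \<le> real (card {- int n..int n}) * (4 * sqrt (real (2 * K * n)))"
    proof (rule sum_inverse_abs_le[where g = fst])
      show "inj_on (\<lambda>h. (f h, fst h)) A1"
        using False by (auto simp: inj_on_def f_def)
      show "f h \<noteq> 0 \<and> \<bar>f h\<bar> \<le> int (2 * K * n)" if "h \<in> A1" for h
        using that f_le by (auto simp: A1_def)
      show "fst ` A1 \<subseteq> {- int n..int n}"
        using A by (auto simp: A1_def abs_le_iff)
    qed simp
    then show ?thesis by (simp add: add.commute)
  qed
  have A0: "(\<Sum>h\<in>A0. 1 / \<bar>real_of_int (fst h)\<bar>) \<le> 4 * sqrt (real n)"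
  proof -
    have "(\<Sum>h\<in>A0. 1 / \<bar>real_of_int (fst h)\<bar>) \<le> real (card {()}) * (4 * sqrt (real n))"
    proof (rule sum_inverse_abs_le[where g = "\<lambda>_. ()"])
      show "inj_on (\<lambda>h. (fst h, ())) A0"
      proof (rule inj_onI)
        fix h h' assume h: "h \<in> A0" "h' \<in> A0" "(fst h, ()) = (fst h', ())"
        have "u * fst h + v * snd h = 0" "u * fst h' + v * snd h' = 0" "fst h = fst h'" "fst h \<noteq> 0"
          using h A by (auto simp: A0_def f_def)
        moreover from this have "v \<noteq> 0"
          using uv by auto
        ultimately have "snd h = snd h'"
          by (metis add_left_cancel mult_left_cancel)
        then show "h = h'"
          using h(3) by (simp add: prod_eq_iff)
      qed
    qed (use A in \<open>auto simp: A0_def\<close>)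
    then show ?thesis by simp
  qed
  define w where "w = sqrt (sqrt L)"
  have w: "1 \<le> w" "w * w = sqrt L"
    using L by (auto simp: w_def)
  have sL: "1 \<le> sqrt L"
    using L by simp
  have sn: "sqrt (real n) \<le> 3 / 2 * w"
  proof -
    have "sqrt (real n) \<le> sqrt (9 / 4 * sqrt L)"
      using L sL by (intro real_sqrt_le_mono) simp
    also have "\<dots> = 3 / 2 * w"
      by (simp add: w_def real_sqrt_mult real_sqrt_divide)
    finally show ?thesis .
  qed
  have sKn: "sqrt (real (2 * K * n)) \<le> 2 * sqrt (real K) * w"
  proof -
    have "real K * real n \<le> real K * (2 * sqrt L)"
      by (intro mult_left_mono L) simp
    then have "sqrt (real (2 * K * n)) \<le> sqrt (4 * (real K * sqrt L))"
      by (intro real_sqrt_le_mono) simp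
    also have "\<dots> = 2 * sqrt (real K) * w"
      by (simp add: w_def real_sqrt_mult)
    finally show ?thesis .
  qed
  have "(\<Sum>h\<in>A. if f h \<noteq> 0 then 1 / (pi * \<bar>of_int (f h)\<bar>) else 2 * sqrt L / \<bar>of_int (fst h)\<bar>) =
      (\<Sum>h\<in>A1. 1 / (pi * \<bar>real_of_int (f h)\<bar>)) + (\<Sum>h\<in>A0. 2 * sqrt L / \<bar>real_of_int (fst h)\<bar>)"
    using finA by (simp add: sum.If_cases A1_def A0_def Int_def Collect_neg_eq[symmetric] Compl_eq)
  also have "(\<Sum>h\<in>A1. 1 / (pi * \<bar>real_of_int (f h)\<bar>)) \<le> (\<Sum>h\<in>A1. 1 / \<bar>real_of_int (f h)\<bar>)"
  proof (rule sum_mono)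
    fix h assume "h \<in> A1"
    then have "0 < \<bar>real_of_int (f h)\<bar>"
      by (simp add: A1_def)
    moreover have "1 * \<bar>real_of_int (f h)\<bar> \<le> pi * \<bar>real_of_int (f h)\<bar>"
      using pi_ge_two by (intro mult_right_mono) auto
    ultimately show "1 / (pi * \<bar>real_of_int (f h)\<bar>) \<le> 1 / \<bar>real_of_int (f h)\<bar>"
      by (intro divide_left_mono) auto
  qed
  also have "\<dots> \<le> real (2 * n + 1) * (4 * sqrt (real (2 * K * n)))"
    by (rule A1)
  also have "\<dots> \<le> (5 * sqrt L) * (4 * (2 * sqrt (real K) * w))"
  proof (intro mult_mono)
    show "real (2 * n + 1) \<le> 5 * sqrt L"
      using L sL by linarith
  qed (use L sKn in auto)
  also have "(\<Sum>h\<in>A0. 2 * sqrt L / \<bar>real_of_int (fst h)\<bar>) = 2 * sqrt L * (\<Sum>h\<in>A0. 1 / \<bar>real_of_int (fst h)\<bar>)"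
    by (simp add: sum_distrib_left)
  also have "\<dots> \<le> 2 * sqrt L * (4 * (3 / 2 * w))"
    using A0 sn sL by (intro mult_left_mono) auto
  finally have "(\<Sum>h\<in>A. if f h \<noteq> 0 then 1 / (pi * \<bar>of_int (f h)\<bar>) else 2 * sqrt L / \<bar>of_int (fst h)\<bar>)
      \<le> (40 * sqrt (real K) + 12) * (sqrt L * w)"
    by (simp add: algebra_simps)
  then show ?thesis
    unfolding f_def w_def .
qed

lemma sum_inverse_axis_le:
  fixes n :: nat and L :: real
  assumes L: "1 \<le> L" "real n \<le> 2 * sqrt L"
    and A: "A \<subseteq> {h. fst h = 0 \<and> snd h \<noteq> 0 \<and> \<bar>snd h\<bar> \<le> int n}"
  shows "(\<Sum>h\<in>A. 1 / \<bar>real_of_int (snd h)\<bar>) \<le> 6 * sqrt (sqrt L)"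
proof -
  have "(\<Sum>h\<in>A. 1 / \<bar>real_of_int (snd h)\<bar>) \<le> real (card {()}) * (4 * sqrt (real n))"
  proof (rule sum_inverse_abs_le[where g = "\<lambda>_. ()"])
    show "inj_on (\<lambda>h. (snd h, ())) A"
    proof (rule inj_onI)
      fix h h' assume h: "h \<in> A" "h' \<in> A" "(snd h, ()) = (snd h', ())"
      then have "fst h = 0" "fst h' = 0"
        using A by auto
      then show "h = h'"
        using h(3) by (simp add: prod_eq_iff)
    qed
  qed (use A in auto)
  then have "(\<Sum>h\<in>A. 1 / \<bar>real_of_int (snd h)\<bar>) \<le> 4 * sqrt (real n)"
    by simp
  moreover have "sqrt (real n) \<le> sqrt (9 / 4 * sqrt L)"
    using L by (intro real_sqrt_le_mono) (simp add: order_trans)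
  moreover have "sqrt (9 / 4 * sqrt L) = 3 / 2 * sqrt (sqrt L)"
    by (simp add: real_sqrt_mult real_sqrt_divide)
  ultimately show ?thesis
    by linarith
qed

section \<open>A trigonometric kernel concentrated at a point\<close>

text \<open>
  The Fourier coefficients of the even powers of the cosine, see \<open>cos_power_expand\<close>.
\<close>

definition fejer_coeff :: "nat \<Rightarrow> nat \<Rightarrow> real" where
  "fejer_coeff K i = real (2 * K choose i) / 4 ^ K"

lemma fejer_coeff_nonneg: "0 \<le> fejer_coeff K i"
  by (simp add: fejer_coeff_def)

lemma cos_power_expand:
  "cos x ^ (2 * K) = (\<Sum>i\<le>2 * K. fejer_coeff K i * cos (2 * (real i - real K) * x))"
proof -
  have term_eq: "cis x ^ i * cis (- x) ^ (2 * K - i) = cis (2 * (real i - real K) * x)" if "i \<le> 2 * K" for i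
  proof -
    have *: "real (2 * K - i) = 2 * real K - real i"
      using that by simp
    show ?thesis
      unfolding Complex.DeMoivre cis_mult * by (rule arg_cong[of _ _ cis]) (simp add: algebra_simps)
  qed
  have "complex_of_real (cos x) = (cis x + cis (- x)) / 2"
    by (simp add: complex_eq_iff)
  then have "complex_of_real (cos x ^ (2 * K)) = ((cis x + cis (- x)) / 2) ^ (2 * K)"
    by (simp only: of_real_power)
  also have "\<dots> = (cis x + cis (- x)) ^ (2 * K) / 4 ^ K"
    by (simp add: power_divide power_mult)
  also have "(cis x + cis (- x)) ^ (2 * K) =
      (\<Sum>i\<le>2 * K. of_nat (2 * K choose i) * cis x ^ i * cis (- x) ^ (2 * K - i))"
    by (rule binomial_ring)
  also have "\<dots> = (\<Sum>i\<le>2 * K. of_nat (2 * K choose i) * cis (2 * (real i - real K) * x))"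
    by (intro sum.cong refl) (simp add: term_eq mult.assoc)
  finally have "Re (complex_of_real (cos x ^ (2 * K))) =
      Re ((\<Sum>i\<le>2 * K. of_nat (2 * K choose i) * cis (2 * (real i - real K) * x)) / 4 ^ K)"
    by simp
  also have "\<dots> = Re (\<Sum>i\<le>2 * K. complex_of_real (fejer_coeff K i) * cis (2 * (real i - real K) * x))"
    by (simp add: sum_divide_distrib fejer_coeff_def)
  also have "\<dots> = (\<Sum>i\<le>2 * K. fejer_coeff K i * cos (2 * (real i - real K) * x))"
    unfolding Re_sum by (intro sum.cong refl) simp
  finally show ?thesis
    by simp
qed

lemma fejer_coeff_le_1: assumes "i \<le> 2 * K" shows "fejer_coeff K i \<le> 1"
proof -
  have "(2 * K choose i) \<le> 2 ^ (2 * K)"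
    by (rule binomial_le_pow2)
  then have "real (2 * K choose i) \<le> real (2 ^ (2 * K))"
    by (simp only: of_nat_le_iff)
  also have "\<dots> = 4 ^ K"
    by (simp add: power_mult)
  finally have "real (2 * K choose i) \<le> 4 ^ K" .
  then show ?thesis
    by (simp add: fejer_coeff_def)
qed

lemma has_integral_cos_bound:
  fixes b c t r :: real
  assumes "r \<ge> 0"
  shows "\<exists>I. ((\<lambda>z. cos (c + b * z)) has_integral I) {t - r..t + r} \<and>
    \<bar>I\<bar> \<le> (if b \<noteq> 0 then 2 / \<bar>b\<bar> else 2 * r)"
proof (cases "b = 0")
  case True
  have "((\<lambda>z. cos c) has_integral 2 * r * cos c) {t - r..t + r}"
    using has_integral_const_real[of "cos c" "t - r" "t + r"] assms by simp
  moreover have "\<bar>2 * r * cos c\<bar> \<le> 2 * r * 1"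
    using assms by (simp add: abs_mult mult_left_le)
  ultimately show ?thesis
    using True by (intro exI[of _ "2 * r * cos c"]) simp
next
  case False
  define G where "G z = sin (c + b * z) / b" for z
  have "((\<lambda>z. cos (c + b * z)) has_integral G (t + r) - G (t - r)) {t - r..t + r}"
  proof (rule fundamental_theorem_of_calculus)
    fix z
    have "(G has_real_derivative cos (c + b * z)) (at z within {t - r..t + r})"
      unfolding G_def using False by (auto intro!: derivative_eq_intros)
    then show "(G has_vector_derivative cos (c + b * z)) (at z within {t - r..t + r})"
      by (simp add: has_real_derivative_iff_has_vector_derivative)
  qed (use assms in simp)
  moreover have "\<bar>G (t + r) - G (t - r)\<bar> \<le> 2 / \<bar>b\<bar>"
  proof -
    have "\<bar>G z\<bar> \<le> 1 / \<bar>b\<bar>" for z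
      by (simp add: G_def divide_right_mono)
    from this[of "t + r"] this[of "t - r"] show ?thesis
      by linarith
  qed
  ultimately show ?thesis
    using False by auto
qed

text \<open>
  Bounds the integral of a cosine of frequency \<open>b\<close> over an interval of length \<open>2 r\<close>.
\<close>

definition osc_bound :: "real \<Rightarrow> real \<Rightarrow> real" where
  "osc_bound r b = (if b \<noteq> 0 then 2 / \<bar>b\<bar> else 2 * r)"

lemma has_integral_cos_cos_bound:
  fixes a b c d t r :: real
  assumes "r \<ge> 0"
  shows "\<exists>I. ((\<lambda>z. cos (c + a * z) * cos (d + b * z)) has_integral I) {t - r..t + r} \<and>
    \<bar>I\<bar> \<le> (osc_bound r (a + b) + osc_bound r (a - b)) / 2"
proof -
  obtain I where I: "((\<lambda>z. cos ((c + d) + (a + b) * z)) has_integral I) {t - r..t + r}"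
    "\<bar>I\<bar> \<le> osc_bound r (a + b)"
    using has_integral_cos_bound[OF assms, of "c + d" "a + b" t] unfolding osc_bound_def by blast
  obtain J where J: "((\<lambda>z. cos ((c - d) + (a - b) * z)) has_integral J) {t - r..t + r}"
    "\<bar>J\<bar> \<le> osc_bound r (a - b)"
    using has_integral_cos_bound[OF assms, of "c - d" "a - b" t] unfolding osc_bound_def by blast
  have "((\<lambda>z. (cos ((c + d) + (a + b) * z) + cos ((c - d) + (a - b) * z)) / 2) has_integral (I + J) / 2) {t - r..t + r}"
    by (intro has_integral_divide has_integral_add I J)
  moreover have "(cos ((c + d) + (a + b) * z) + cos ((c - d) + (a - b) * z)) / 2 =
      cos (c + a * z) * cos (d + b * z)" for z
  proof -
    have "(c + d) + (a + b) * z = (c + a * z) + (d + b * z)" "(c - d) + (a - b) * z = (c + a * z) - (d + b * z)"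
      by (simp_all add: algebra_simps)
    moreover have "(cos (A + B) + cos (A - B)) / 2 = cos A * cos B" for A B :: real
      by (simp add: cos_add cos_diff)
    ultimately show ?thesis
      by metis
  qed
  ultimately have "((\<lambda>z. cos (c + a * z) * cos (d + b * z)) has_integral (I + J) / 2) {t - r..t + r}"
    by simp
  moreover have "\<bar>(I + J) / 2\<bar> \<le> (osc_bound r (a + b) + osc_bound r (a - b)) / 2"
    using order_trans[OF abs_triangle_ineq add_mono[OF I(2) J(2)]] by simp
  ultimately show ?thesis by blast
qed

definition torus_kernel :: "nat \<Rightarrow> real \<times> real \<Rightarrow> real \<times> real \<Rightarrow> real" where
  "torus_kernel K u p = cos (pi * (fst p - fst u)) ^ (2 * K) * cos (pi * (snd p - snd u)) ^ (2 * K)"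

lemma torus_kernel_nonneg: "0 \<le> torus_kernel K u p"
  by (simp add: torus_kernel_def)

lemma torus_kernel_le_1: "torus_kernel K u p \<le> 1"
proof -
  have "cos x ^ (2 * K) \<le> 1" for x :: real
    by (simp add: power_mult power_le_one abs_square_le_1)
  then show ?thesis
    unfolding torus_kernel_def by (intro mult_le_one) auto
qed

lemma continuous_torus_kernel: "continuous_on UNIV (torus_kernel K u)"
  unfolding torus_kernel_def by (intro continuous_intros)

lemma torus_kernel_measurable [measurable]: "torus_kernel K u \<in> borel_measurable borel"
  by (rule borel_measurable_continuous_onI[OF continuous_torus_kernel])

lemma cos_pi_shift_power: "cos (pi * (x - of_int m)) ^ (2 * K) = cos (pi * x) ^ (2 * K)"
proof -
  have "(cos (pi * (x - of_int m)))\<^sup>2 = (cos (pi * x))\<^sup>2"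
    by (simp add: right_diff_distrib cos_diff power_mult_distrib)
  then show ?thesis
    by (simp add: power_mult)
qed

lemma torus_kernel_periodic: "torus_kernel K u (p - (of_int m, of_int n)) = torus_kernel K u p"
  unfolding torus_kernel_def
  using cos_pi_shift_power[of "fst p - fst u" m] cos_pi_shift_power[of "snd p - snd u" n]
  by (simp add: algebra_simps)

lemma cos_pi_power_le:
  assumes x: "\<And>k :: int. d \<le> \<bar>x - of_int k\<bar>" and d: "0 \<le> d" "d \<le> 1 / 2"
  shows "cos (pi * x) ^ (2 * K) \<le> cos (pi * d) ^ (2 * K)"
proof -
  define y where "y = \<bar>x - of_int (round x)\<bar>"
  have y: "d \<le> y" "y \<le> 1 / 2"
    using x of_int_round_abs_le[of x] by (auto simp: y_def abs_minus_commute)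
  have "cos (pi * x) ^ (2 * K) = cos (pi * (x - of_int (round x))) ^ (2 * K)"
    by (rule cos_pi_shift_power[symmetric])
  also have "\<dots> = cos (pi * y) ^ (2 * K)"
    unfolding y_def by (metis (no_types, opaque_lifting) abs_mult abs_of_nonneg cos_abs_real pi_ge_zero)
  also have "\<dots> \<le> cos (pi * d) ^ (2 * K)"
  proof (rule power_mono)
    have "pi * y \<le> pi * (1 / 2)"
      using y by (intro mult_left_mono) auto
    then show "0 \<le> cos (pi * y)"
      using y d by (intro cos_ge_zero) (auto intro: order_trans[of _ 0])
    show "cos (pi * y) \<le> cos (pi * d)"
      using y d by (intro cos_monotone_0_pi_le) (auto intro!: mult_left_mono)
  qed
  finally show ?thesis .
qed

text \<open>
  A point outside all integer translates of the square with centre \<open>u\<close> and half side \<open>d\<close> has a coordinate that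
  stays at distance at least \<open>d\<close> from the integer translates of the corresponding coordinate of \<open>u\<close>.
\<close>

lemma torus_kernel_small:
  assumes off: "\<And>m n :: int. d \<le> \<bar>fst p - of_int m - fst u\<bar> \<or> d \<le> \<bar>snd p - of_int n - snd u\<bar>"
    and d: "0 \<le> d" "d \<le> 1 / 2"
  shows "torus_kernel K u p \<le> cos (pi * d) ^ (2 * K)"
proof -
  have le1: "cos x ^ (2 * K) \<le> 1" for x :: real
    by (simp add: power_mult power_le_one abs_square_le_1)
  have ge0: "0 \<le> cos x ^ (2 * K)" for x :: real
    by simp
  have *: "x - u - m = x - m - u" for x u m :: real
    by simp
  consider "\<And>m :: int. d \<le> \<bar>fst p - of_int m - fst u\<bar>" | "\<And>n :: int. d \<le> \<bar>snd p - of_int n - snd u\<bar>"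
    using off by blast
  then show ?thesis
  proof cases
    case 1
    then have "cos (pi * (fst p - fst u)) ^ (2 * K) \<le> cos (pi * d) ^ (2 * K)"
      by (intro cos_pi_power_le d) (simp add: *)
    then show ?thesis
      unfolding torus_kernel_def using mult_mono[OF _ le1 ge0 ge0] by fastforce
  next
    case 2
    then have "cos (pi * (snd p - snd u)) ^ (2 * K) \<le> cos (pi * d) ^ (2 * K)"
      by (intro cos_pi_power_le d) (simp add: *)
    then show ?thesis
      unfolding torus_kernel_def using mult_mono[OF le1 _ _ ge0] by fastforce
  qed
qed

text \<open>
  The contribution of the nonzero frequencies \<open>(i - K, j - K)\<close> of the kernel along a segment in the direction
  \<open>(s, 1)\<close>: a product of two cosines is the half sum of two cosines whose frequencies along the segment are
  those below. The coefficients of the kernel, all at most \<open>1\<close>, are dropped.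
\<close>

definition line_error :: "nat \<Rightarrow> real \<Rightarrow> real \<Rightarrow> real" where
  "line_error K s r = (\<Sum>(i, j)\<in>{..2 * K} \<times> {..2 * K} - {(K, K)}.
     osc_bound r (2 * pi * ((real i - real K) * s + (real j - real K))) +
     osc_bound r (2 * pi * ((real i - real K) * s - (real j - real K))))"

lemma osc_bound_nonneg: "r \<ge> 0 \<Longrightarrow> 0 \<le> osc_bound r b"
  by (simp add: osc_bound_def)

text \<open>
  The constant term of the kernel, the square of the central coefficient, is integrated exactly; all other
  terms go into the error.
\<close>

lemma has_integral_kernel_line:
  fixes s k t r :: real
  assumes r: "r \<ge> 0"
  shows "\<exists>I. ((\<lambda>z. torus_kernel K u (k + s * z, z)) has_integral I) {t - r..t + r} \<and>
    0 \<le> I \<and> I \<le> (fejer_coeff K K)\<^sup>2 * (2 * r) + line_error K s r"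
proof -
  define X where "X = {..2 * K} \<times> {..2 * K}"
  define c where "c i = 2 * (real i - real K) * pi" for i
  define f where "f = (\<lambda>(i, j) z. cos (c i * (k - fst u) + c i * s * z) * cos (- c j * snd u + c j * z))"
  define w where "w = (\<lambda>(i, j). fejer_coeff K i * fejer_coeff K j)"
  define M where "M = (\<lambda>(i, j). osc_bound r (c i * s + c j) + osc_bound r (c i * s - c j))"
  have K: "(K, K) \<in> X" "finite X"
    by (auto simp: X_def)
  have kern: "torus_kernel K u (k + s * z, z) = (\<Sum>x\<in>X. w x * f x z)" for z
    unfolding torus_kernel_def cos_power_expand X_def sum_product sum.cartesian_product
    by (rule sum.cong) (auto simp: w_def f_def c_def algebra_simps)
  have "\<exists>I. (f x has_integral I) {t - r..t + r} \<and> \<bar>I\<bar> \<le> M x / 2" for x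
  proof (cases x)
    case (Pair i j)
    then show ?thesis
      using has_integral_cos_cos_bound[OF r, of "c i * (k - fst u)" "c i * s" "- c j * snd u" "c j" t]
      by (simp add: f_def M_def)
  qed
  then obtain I where I: "\<And>x. (f x has_integral I x) {t - r..t + r}" "\<And>x. \<bar>I x\<bar> \<le> M x / 2"
    by metis
  have M0: "0 \<le> M x" for x
    by (cases x) (simp add: M_def osc_bound_nonneg[OF r] add_nonneg_nonneg)
  have w: "0 \<le> w x" "w x \<le> 1" if "x \<in> X" for x
    using that by (auto simp: w_def X_def fejer_coeff_nonneg fejer_coeff_le_1 intro!: mult_le_one)
  have "((\<lambda>z. \<Sum>x\<in>X. w x * f x z) has_integral (\<Sum>x\<in>X. w x * I x)) {t - r..t + r}"
    by (intro has_integral_sum has_integral_mult_right K I)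
  then have int: "((\<lambda>z. torus_kernel K u (k + s * z, z)) has_integral (\<Sum>x\<in>X. w x * I x)) {t - r..t + r}"
    by (simp add: kern)
  have "0 \<le> (\<Sum>x\<in>X. w x * I x)"
    using int by (rule has_integral_nonneg) (rule torus_kernel_nonneg)
  moreover have "(\<Sum>x\<in>X. w x * I x) \<le> (fejer_coeff K K)\<^sup>2 * (2 * r) + line_error K s r"
  proof -
    have "(\<Sum>x\<in>X. w x * I x) = w (K, K) * I (K, K) + (\<Sum>x\<in>X - {(K, K)}. w x * I x)"
      by (rule sum.remove) (use K in auto)
    also have "w (K, K) * I (K, K) \<le> (fejer_coeff K K)\<^sup>2 * (2 * r)"
    proof -
      have "M (K, K) / 2 = 2 * r"
        by (simp add: M_def c_def osc_bound_def)
      then have "I (K, K) \<le> 2 * r"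
        using I(2)[of "(K, K)"] by linarith
      then show ?thesis
        by (simp add: w_def power2_eq_square mult_left_mono)
    qed
    also have "(\<Sum>x\<in>X - {(K, K)}. w x * I x) \<le> (\<Sum>x\<in>X - {(K, K)}. M x)"
    proof (rule sum_mono)
      fix x assume x: "x \<in> X - {(K, K)}"
      have "w x * I x \<le> w x * M x"
        using I(2)[of x] M0[of x] w x by (intro mult_left_mono) auto
      also have "\<dots> \<le> 1 * M x"
        using w x M0 by (intro mult_right_mono) auto
      finally show "w x * I x \<le> M x" by simp
    qed
    also have "\<dots> = line_error K s r"
      unfolding line_error_def X_def by (rule sum.cong) (auto simp: M_def c_def algebra_simps)
    finally show ?thesis by simp
  qed
  ultimately show ?thesis
    using int by blast
qed

lemma nn_integral_kernel_line:
  fixes s k t r :: real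
  assumes r: "r \<ge> 0"
  shows "(\<integral>\<^sup>+z. ennreal (torus_kernel K u (k + s * z, z)) * indicator {t - r..t + r} z \<partial>lborel)
    \<le> ennreal ((fejer_coeff K K)\<^sup>2 * (2 * r) + line_error K s r)"
proof -
  obtain I where I: "((\<lambda>z. torus_kernel K u (k + s * z, z)) has_integral I) {t - r..t + r}"
    "0 \<le> I" "I \<le> (fejer_coeff K K)\<^sup>2 * (2 * r) + line_error K s r"
    using has_integral_kernel_line[OF r] by blast
  have "(\<integral>\<^sup>+z. ennreal (torus_kernel K u (k + s * z, z)) * indicator {t - r..t + r} z \<partial>lborel) = ennreal I"
    by (rule nn_integral_has_integral_lebesgue'[OF torus_kernel_nonneg I(1)])
  then show ?thesis
    using I by (simp add: ennreal_leI)
qed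

lemma has_integral_cos_power:
  "((\<lambda>x. cos (pi * (x - u)) ^ (2 * K)) has_integral fejer_coeff K K) {0..1}"
proof -
  have "((\<lambda>x. cos (2 * (real i - real K) * (pi * (x - u)))) has_integral (if i = K then 1 else 0)) {0..1}" for i
  proof (cases "i = K")
    case True
    then show ?thesis
      using has_integral_const_real[of "1::real" 0 1] by simp
  next
    case False
    define k where "k = int i - int K"
    have k: "real i - real K = of_int k" "k \<noteq> 0"
      using False by (auto simp: k_def)
    define G where "G x = sin (2 * of_int k * (pi * (x - u))) / (2 * of_int k * pi)" for x
    have "((\<lambda>x. cos (2 * of_int k * (pi * (x - u)))) has_integral G 1 - G 0) {0..1}"
    proof (rule fundamental_theorem_of_calculus)
      fix x
      have "(G has_real_derivative cos (2 * of_int k * (pi * (x - u)))) (at x within {0..1})"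
        unfolding G_def using k by (auto intro!: derivative_eq_intros)
      then show "(G has_vector_derivative cos (2 * of_int k * (pi * (x - u)))) (at x within {0..1})"
        by (simp add: has_real_derivative_iff_has_vector_derivative)
    qed simp
    moreover have "G 1 = G 0"
    proof -
      have "2 * of_int k * (pi * (1 - u)) = 2 * of_int k * (pi * (0 - u)) + 2 * pi * of_int k"
        by (simp add: algebra_simps)
      then have "sin (2 * of_int k * (pi * (1 - u))) = sin (2 * of_int k * (pi * (0 - u)))"
        by (simp only: sin_add sin_int_2pin cos_int_2pin)
      then show ?thesis
        by (simp add: G_def)
    qed
    ultimately show ?thesis
      using False by (simp add: k)
  qed
  then have "((\<lambda>x. \<Sum>i\<le>2 * K. fejer_coeff K i * cos (2 * (real i - real K) * (pi * (x - u)))) has_integral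
      (\<Sum>i\<le>2 * K. fejer_coeff K i * (if i = K then 1 else 0))) {0..1}"
    by (intro has_integral_sum has_integral_mult_right) auto
  moreover have "(\<Sum>i\<le>2 * K. fejer_coeff K i * (if i = K then 1 else 0)) = fejer_coeff K K"
    by (simp add: if_distrib sum.delta cong: if_cong)
  ultimately show ?thesis
    by (simp only: cos_power_expand)
qed

lemma nn_integral_cos_power:
  "(\<integral>\<^sup>+x. ennreal (cos (pi * (x - u)) ^ (2 * K)) * indicator {0<..<1} x \<partial>lborel) = ennreal (fejer_coeff K K)"
  using has_integral_cos_power[of u K]
  by (intro nn_integral_has_integral_lebesgue') (simp_all add: has_integral_Icc_iff_Ioo)

section \<open>Averaging the pair count\<close>

definition lattice_point :: "int \<times> int \<Rightarrow> real \<times> real" where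
  "lattice_point m = (of_int (fst m), of_int (snd m))"

text \<open>
  The open square suffices, since its boundary is a null set; its integer translates are disjoint.
\<close>

definition unit_square :: "(real \<times> real) set" where
  "unit_square = {0<..<1} \<times> {0<..<1}"

text \<open>
  A lattice pair \<open>(x, x + h)\<close> is close and of size at most \<open>L\<close> at \<open>p\<close> only if \<open>p - x\<close> lies in this strip: in
  terms of the vector \<open>w\<close> from the midpoint of the pair to \<open>p\<close>, the difference of the two values is twice the
  inner product of \<open>w\<close> and \<open>h\<close>, and their mean is \<open>|w|\<^sup>2 + |h|\<^sup>2/4\<close>.
\<close>

definition strip :: "real \<Rightarrow> real \<Rightarrow> int \<times> int \<Rightarrow> (real \<times> real) set" where
  "strip a L h = {z.
     \<bar>2 * ((fst z - of_int (fst h) / 2) * of_int (fst h) + (snd z - of_int (snd h) / 2) * of_int (snd h))\<bar> \<le> a \<and>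
     (fst z - of_int (fst h) / 2)\<^sup>2 + (snd z - of_int (snd h) / 2)\<^sup>2 + normsq h / 4 \<le> L}"

lemma strip_measurable [measurable]: "strip a L h \<in> sets borel"
proof (rule borel_closed)
  show "closed (strip a L h)"
    unfolding strip_def by (intro closed_Collect_conj closed_Collect_le continuous_intros)
qed

lemma unit_square_measurable [measurable]: "unit_square \<in> sets borel"
  unfolding unit_square_def borel_prod[symmetric] by (intro pair_measureI) auto

lemma nn_integral_translate:
  fixes g :: "real \<times> real \<Rightarrow> ennreal"
  assumes [measurable]: "g \<in> borel_measurable borel"
  shows "(\<integral>\<^sup>+p. g p \<partial>lborel) = (\<integral>\<^sup>+p. g (c + p) \<partial>lborel)"
proof -
  have "(\<integral>\<^sup>+p. g p \<partial>distr lborel borel ((+) c)) = (\<integral>\<^sup>+p. g (c + p) \<partial>lborel)"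
    by (rule nn_integral_distr) auto
  then show ?thesis
    by (simp add: lborel_distr_plus)
qed

text \<open>
  Summing over translates of the unit square unfolds to an integral over the plane.
\<close>

lemma unit_square_unfold:
  fixes G :: "real \<times> real \<Rightarrow> ennreal"
  assumes G [measurable]: "G \<in> borel_measurable borel" and B: "finite B"
  shows "(\<Sum>m\<in>B. \<integral>\<^sup>+p. G (p - lattice_point m) * indicator unit_square p \<partial>lborel) \<le> (\<integral>\<^sup>+p. G p \<partial>lborel)"
proof -
  define S where "S m = {p. lattice_point m + p \<in> unit_square}" for m
  have S [measurable]: "S m \<in> sets borel" for m
  proof -
    have "S m = (\<lambda>p. lattice_point m + p) -` unit_square \<inter> space borel"
      by (auto simp: S_def)
    also have "\<dots> \<in> sets borel"
      by (rule measurable_sets[OF _ unit_square_measurable]) measurable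
    finally show ?thesis .
  qed
  have disj: "disjoint_family_on S B"
    unfolding disjoint_family_on_def
  proof (intro ballI impI)
    fix m m' :: "int \<times> int" assume "m \<noteq> m'"
    show "S m \<inter> S m' = {}"
    proof (rule ccontr)
      assume "S m \<inter> S m' \<noteq> {}"
      then obtain x y where xy: "lattice_point m + (x, y) \<in> unit_square" "lattice_point m' + (x, y) \<in> unit_square"
        by (auto simp: S_def)
      have "\<bar>real_of_int (fst m) - of_int (fst m')\<bar> < 1" "\<bar>real_of_int (snd m) - of_int (snd m')\<bar> < 1"
        using xy by (auto simp: lattice_point_def unit_square_def)
      then have "fst m = fst m'" "snd m = snd m'"
        by linarith+
      then show False
        using \<open>m \<noteq> m'\<close> by (simp add: prod_eq_iff)
    qed
  qed
  have "(\<integral>\<^sup>+p. G (p - lattice_point m) * indicator unit_square p \<partial>lborel) = (\<integral>\<^sup>+p. G p * indicator (S m) p \<partial>lborel)" for m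
    by (subst nn_integral_translate[of _ "lattice_point m"]) (auto simp: S_def indicator_def intro!: nn_integral_cong)
  then have "(\<Sum>m\<in>B. \<integral>\<^sup>+p. G (p - lattice_point m) * indicator unit_square p \<partial>lborel) =
      (\<integral>\<^sup>+p. (\<Sum>m\<in>B. G p * indicator (S m) p) \<partial>lborel)"
    by (subst nn_integral_sum) auto
  also have "\<dots> = (\<integral>\<^sup>+p. G p * indicator (\<Union>m\<in>B. S m) p \<partial>lborel)"
    by (simp add: indicator_UN_disjoint[OF B disj] sum_distrib_left)
  also have "\<dots> \<le> (\<integral>\<^sup>+p. G p \<partial>lborel)"
    by (intro nn_integral_mono) (auto simp: indicator_def)
  finally show ?thesis .
qed

lemma nn_integral_kernel_square:
  "(\<integral>\<^sup>+p. ennreal (torus_kernel K u p) * indicator unit_square p \<partial>lborel) = ennreal ((fejer_coeff K K)\<^sup>2)"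
proof -
  define f where "f v x = ennreal (cos (pi * (x - v)) ^ (2 * K)) * indicator {0<..<1} x" for v x :: real
  have [measurable]: "f v \<in> borel_measurable borel" for v
    unfolding f_def by measurable
  have int: "(\<integral>\<^sup>+x. f v x \<partial>lborel) = ennreal (fejer_coeff K K)" for v
    unfolding f_def by (rule nn_integral_cos_power)
  have "(\<integral>\<^sup>+p. ennreal (torus_kernel K u p) * indicator unit_square p \<partial>lborel) =
      (\<integral>\<^sup>+p. f (fst u) (fst p) * f (snd u) (snd p) \<partial>(lborel \<Otimes>\<^sub>M lborel))"
    unfolding lborel_prod
    by (intro nn_integral_cong)
      (auto simp: f_def torus_kernel_def unit_square_def indicator_def ennreal_mult' mem_Times_iff)
  also have "\<dots> = (\<integral>\<^sup>+x. \<integral>\<^sup>+y. f (fst u) x * f (snd u) y \<partial>lborel \<partial>lborel)"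
    by (subst lborel.nn_integral_fst[symmetric]) auto
  also have "\<dots> = ennreal (fejer_coeff K K) * ennreal (fejer_coeff K K)"
    by (simp add: nn_integral_cmult nn_integral_multc int)
  finally show ?thesis
    by (simp add: power2_eq_square ennreal_mult fejer_coeff_nonneg)
qed

lemma normsq_pos: "h \<noteq> (0, 0) \<Longrightarrow> 0 < normsq h"
  by (cases h) (auto simp: normsq_def sum_power2_gt_zero_iff)

text \<open>
  On the line of all \<open>w\<close> with inner product \<open>s\<close> with \<open>(a\<^sub>1, a\<^sub>2)\<close>, parametrised by its second coordinate, the disc
  cuts out a segment centred at the foot of the perpendicular from the origin. With \<open>t\<close> the determinant of
  \<open>w\<close> and \<open>(a\<^sub>1, a\<^sub>2)\<close>, one has \<open>t\<^sup>2 + s\<^sup>2 = q |w|\<^sup>2\<close>.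
\<close>

lemma strip_chord:
  fixes w1 w2 s a1 a2 :: real
  assumes "w1 * a1 + w2 * a2 = s" "w1\<^sup>2 + w2\<^sup>2 + q / 4 \<le> L" "q = a1\<^sup>2 + a2\<^sup>2" "q > 0"
  shows "\<bar>w2 - s * a2 / q\<bar> \<le> sqrt (L - q / 4) * \<bar>a1\<bar> / sqrt q"
proof -
  define t where "t = w2 * a1 - w1 * a2"
  have t: "t\<^sup>2 + s\<^sup>2 = q * (w1\<^sup>2 + w2\<^sup>2)"
    unfolding t_def assms(1)[symmetric] assms(3) by algebra
  have "w2 * q - s * a2 = a1 * t"
    unfolding t_def assms(1)[symmetric] assms(3) by algebra
  then have eq: "w2 - s * a2 / q = a1 * t / q"
    using assms(4) by (simp add: field_simps)
  have "t\<^sup>2 \<le> q * (L - q / 4)"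
  proof -
    have "t\<^sup>2 \<le> q * (w1\<^sup>2 + w2\<^sup>2)"
      using t zero_le_power2[of s] by linarith
    also have "\<dots> \<le> q * (L - q / 4)"
      using assms(2,4) by (intro mult_left_mono) auto
    finally show ?thesis .
  qed
  then have "\<bar>t\<bar> \<le> sqrt (q * (L - q / 4))"
    by (simp add: real_le_rsqrt)
  then have "\<bar>a1\<bar> * \<bar>t\<bar> / q \<le> \<bar>a1\<bar> * (sqrt q * sqrt (L - q / 4)) / q"
    using assms(4) by (intro divide_right_mono mult_left_mono) (auto simp: real_sqrt_mult)
  also have "\<dots> = sqrt (L - q / 4) * \<bar>a1\<bar> * (sqrt q / q)"
    by simp
  also have "sqrt q / q = 1 / sqrt q"
    using assms(4) by (simp add: field_simps)
  finally show ?thesis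
    unfolding eq using assms(4) by (simp add: abs_mult)
qed

text \<open>
  Half the length of the projection to the second coordinate axis of the diameter, in the direction orthogonal
  to \<open>h\<close>, of the disc of squared radius \<open>L - |h|\<^sup>2/4\<close>.
\<close>

definition chord_half :: "real \<Rightarrow> int \<times> int \<Rightarrow> real" where
  "chord_half L h = sqrt (L - normsq h / 4) * \<bar>of_int (fst h)\<bar> / sqrt (normsq h)"

text \<open>
  The shear replacing the first coordinate by the inner product \<open>s\<close> of \<open>w\<close> with \<open>h\<close> takes the strip into a
  family of chords orthogonal to \<open>h\<close>, indexed by the \<open>s\<close> with \<open>|s| \<le> a/2\<close>. Its Jacobian is the reciprocal of the first coordinate of
  \<open>h\<close>, and along each chord the kernel is integrated by \<open>nn_integral_kernel_line\<close>.
\<close>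

lemma nn_integral_kernel_strip:
  assumes a: "a \<ge> 0" and h: "fst h \<noteq> 0" "normsq h \<le> 4 * L"
  shows "(\<integral>\<^sup>+z. ennreal (torus_kernel K u z) * indicator (strip a L h) z \<partial>lborel)
    \<le> ennreal (a / \<bar>of_int (fst h)\<bar> * ((fejer_coeff K K)\<^sup>2 * (2 * chord_half L h) +
        line_error K (- of_int (snd h) / of_int (fst h)) (chord_half L h)))"
proof -
  define h1 h2 q r where "h1 = real_of_int (fst h)" and "h2 = real_of_int (snd h)"
    and "q = normsq h" and "r = chord_half L h"
  have h1: "h1 \<noteq> 0"
    using h by (simp add: h1_def)
  have q: "0 < q" "q = h1\<^sup>2 + h2\<^sup>2" "q \<le> 4 * L"
    using h normsq_pos[of h] by (cases h, auto simp: q_def h1_def h2_def normsq_def)+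
  have r: "0 \<le> r"
    using q by (simp add: r_def chord_half_def q_def)
  have r_eq: "r = sqrt (L - q / 4) * \<bar>h1\<bar> / sqrt q"
    by (simp add: r_def chord_half_def q_def h1_def)
  define Bd where "Bd = (fejer_coeff K K)\<^sup>2 * (2 * r) + line_error K (- h2 / h1) r"
  define k where "k s = h1 / 2 + h2 / 2 * h2 / h1 + s / h1" for s
  define T where "T s = h2 / 2 + s * h2 / q" for s
  define f where "f z = ennreal (torus_kernel K u z) * indicator (strip a L h) z" for z
  define g where "g s z = (if \<bar>s\<bar> \<le> a / 2 then ennreal (torus_kernel K u (k s + (- h2 / h1) * z, z)) *
      (if \<bar>z - T s\<bar> \<le> r then 1 else 0) else 0)" for s z
  have [measurable]: "f \<in> borel_measurable borel"
    unfolding f_def by measurable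
  have [measurable]: "case_prod g \<in> borel_measurable (borel \<Otimes>\<^sub>M borel)"
    unfolding g_def k_def T_def by measurable
  have fg: "f (h1 / 2 - (z - h2 / 2) * h2 / h1 + (1 / h1) * s, z) \<le> g s z" for s z
  proof -
    define z1 where "z1 = h1 / 2 - (z - h2 / 2) * h2 / h1 + (1 / h1) * s"
    have z1: "z1 = k s + (- h2 / h1) * z"
      using h1 by (simp add: z1_def k_def field_simps)
    have s: "(z1 - h1 / 2) * h1 + (z - h2 / 2) * h2 = s"
      using h1 by (simp add: z1_def field_simps)
    show ?thesis
    proof (cases "(z1, z) \<in> strip a L h")
      case True
      then have st: "\<bar>2 * s\<bar> \<le> a" "(z1 - h1 / 2)\<^sup>2 + (z - h2 / 2)\<^sup>2 + q / 4 \<le> L"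
        using s by (auto simp: strip_def h1_def h2_def q_def)
      have "\<bar>(z - h2 / 2) - s * h2 / q\<bar> \<le> r"
        unfolding r_eq by (rule strip_chord[OF s st(2) q(2,1)])
      then have "\<bar>z - T s\<bar> \<le> r"
        by (simp add: T_def diff_diff_eq)
      moreover have "\<bar>s\<bar> \<le> a / 2"
        using st(1) by simp
      ultimately show ?thesis
        unfolding z1_def[symmetric] f_def g_def z1[symmetric] by (simp add: indicator_def)
    next
      case False
      then show ?thesis
        unfolding z1_def[symmetric] f_def by simp
    qed
  qed
  have "(\<integral>\<^sup>+z. f z \<partial>lborel) = (\<integral>\<^sup>+z. \<integral>\<^sup>+y. f (y, z) \<partial>lborel \<partial>lborel)"
    by (subst lborel_pair.nn_integral_snd) (simp_all add: lborel_prod)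
  also have "\<dots> = (\<integral>\<^sup>+z. ennreal (1 / \<bar>h1\<bar>) *
      (\<integral>\<^sup>+s. f (h1 / 2 - (z - h2 / 2) * h2 / h1 + (1 / h1) * s, z) \<partial>lborel) \<partial>lborel)"
    using h1 by (intro nn_integral_cong, subst nn_integral_real_affine[where c = "1 / h1"]) (auto simp: abs_divide)
  also have "\<dots> \<le> (\<integral>\<^sup>+z. ennreal (1 / \<bar>h1\<bar>) * (\<integral>\<^sup>+s. g s z \<partial>lborel) \<partial>lborel)"
    by (intro nn_integral_mono mult_left_mono fg) auto
  also have "\<dots> = ennreal (1 / \<bar>h1\<bar>) * (\<integral>\<^sup>+z. \<integral>\<^sup>+s. g s z \<partial>lborel \<partial>lborel)"
    by (rule nn_integral_cmult) measurable
  also have "(\<integral>\<^sup>+z. \<integral>\<^sup>+s. g s z \<partial>lborel \<partial>lborel) = (\<integral>\<^sup>+s. \<integral>\<^sup>+z. g s z \<partial>lborel \<partial>lborel)"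
    by (rule lborel_pair.Fubini') simp
  also have "\<dots> \<le> (\<integral>\<^sup>+s. ennreal Bd * indicator {- (a / 2)..a / 2} s \<partial>lborel)"
  proof (rule nn_integral_mono)
    fix s
    show "(\<integral>\<^sup>+z. g s z \<partial>lborel) \<le> ennreal Bd * indicator {- (a / 2)..a / 2} s"
    proof (cases "\<bar>s\<bar> \<le> a / 2")
      case True
      have "(\<integral>\<^sup>+z. g s z \<partial>lborel) = (\<integral>\<^sup>+z. ennreal (torus_kernel K u (k s + (- h2 / h1) * z, z)) *
          indicator {T s - r..T s + r} z \<partial>lborel)"
        using True by (intro nn_integral_cong) (auto simp: g_def indicator_def abs_le_iff)
      also have "\<dots> \<le> ennreal Bd"
        unfolding Bd_def by (rule nn_integral_kernel_line[OF r])
      finally have "(\<integral>\<^sup>+z. g s z \<partial>lborel) \<le> ennreal Bd" .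
      moreover have "s \<in> {- (a / 2)..a / 2}"
        using True by (auto simp: abs_le_iff)
      ultimately show ?thesis
        by simp
    next
      case False
      then show ?thesis
        by (simp add: g_def)
    qed
  qed
  also have "\<dots> = ennreal Bd * ennreal a"
    using a by (simp add: nn_integral_cmult_indicator)
  finally have "(\<integral>\<^sup>+z. f z \<partial>lborel) \<le> ennreal (1 / \<bar>h1\<bar>) * (ennreal Bd * ennreal a)"
    by (simp add: mult_left_mono)
  moreover have "0 \<le> Bd"
  proof -
    have "0 \<le> line_error K (- h2 / h1) r"
      unfolding line_error_def by (intro sum_nonneg) (auto intro!: add_nonneg_nonneg osc_bound_nonneg r)
    then show ?thesis
      using r by (simp add: Bd_def)
  qed
  ultimately show ?thesis
    using a by (simp add: f_def Bd_def r_def h1_def h2_def ennreal_mult[symmetric] mult.commute)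
qed

text \<open>
  For \<open>h\<close> on the second axis the shear degenerates, but these few strips only need the trivial bound by their
  area.
\<close>

lemma nn_integral_kernel_strip_axis:
  assumes a: "a \<ge> 0" and h: "fst h = 0" "snd h \<noteq> 0" and L: "L \<ge> 0"
  shows "(\<integral>\<^sup>+z. ennreal (torus_kernel K u z) * indicator (strip a L h) z \<partial>lborel)
    \<le> ennreal (2 * sqrt L * (a / \<bar>of_int (snd h)\<bar>))"
proof -
  define h2 where "h2 = real_of_int (snd h)"
  define e where "e = a / (2 * \<bar>h2\<bar>)"
  have h2: "h2 \<noteq> 0" and e: "0 \<le> e"
    using h a by (auto simp: h2_def e_def)
  have "strip a L h \<subseteq> {- sqrt L..sqrt L} \<times> {h2 / 2 - e..h2 / 2 + e}"
  proof
    fix z assume "z \<in> strip a L h"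
    then have z: "\<bar>2 * ((snd z - h2 / 2) * h2)\<bar> \<le> a" "(fst z)\<^sup>2 + (snd z - h2 / 2)\<^sup>2 + h2\<^sup>2 / 4 \<le> L"
      using h by (auto simp: strip_def h2_def normsq_def)
    have "(fst z)\<^sup>2 \<le> L"
      using z(2) zero_le_power2[of "snd z - h2 / 2"] zero_le_power2[of h2] by linarith
    then have "\<bar>fst z\<bar> \<le> sqrt L"
      by (simp add: real_le_rsqrt)
    moreover have "\<bar>snd z - h2 / 2\<bar> \<le> e"
    proof -
      have "\<bar>snd z - h2 / 2\<bar> * (2 * \<bar>h2\<bar>) \<le> a"
        using z(1) unfolding abs_mult by simp
      then show ?thesis
        unfolding e_def using h2 by (subst pos_le_divide_eq) auto
    qed
    ultimately show "z \<in> {- sqrt L..sqrt L} \<times> {h2 / 2 - e..h2 / 2 + e}"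
      by (cases z) (simp add: abs_le_iff)
  qed
  then have "(\<integral>\<^sup>+z. ennreal (torus_kernel K u z) * indicator (strip a L h) z \<partial>lborel) \<le>
      (\<integral>\<^sup>+z. indicator ({- sqrt L..sqrt L} \<times> {h2 / 2 - e..h2 / 2 + e}) z \<partial>(lborel \<Otimes>\<^sub>M lborel))"
    unfolding lborel_prod using torus_kernel_le_1
    by (intro nn_integral_mono) (auto simp: indicator_def)
  also have "\<dots> = emeasure (lborel \<Otimes>\<^sub>M lborel) ({- sqrt L..sqrt L} \<times> {h2 / 2 - e..h2 / 2 + e})"
    by (rule nn_integral_indicator) auto
  also have "\<dots> = ennreal (2 * sqrt L) * ennreal (2 * e)"
    using L e by (subst lborel.emeasure_pair_measure_Times) auto
  also have "\<dots> = ennreal (2 * sqrt L * (a / \<bar>of_int (snd h)\<bar>))"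
  proof -
    have "ennreal (2 * sqrt L) * ennreal (2 * e) = ennreal (2 * sqrt L * (2 * e))"
      using L e by (intro ennreal_mult[symmetric]) auto
    moreover have "2 * e = a / \<bar>of_int (snd h)\<bar>"
      by (simp add: e_def h2_def)
    ultimately show ?thesis
      by simp
  qed
  finally show ?thesis .
qed

text \<open>
  Sort the pairs \<open>(x, y)\<close> by \<open>h = y - x\<close> and \<open>m = x\<close>.
\<close>

lemma close_pairs_le_strips:
  assumes p: "p \<in> unit_square" and L: "L \<ge> 0"
  shows "of_nat (card (close_pairs a p L)) \<le>
    (\<Sum>h\<in>punctured_disc (2 * sqrt L). \<Sum>m\<in>{m. normsq m \<le> 2 * L + 4}. indicator (strip a L h) (p - lattice_point m) :: ennreal)"
proof -
  define H where "H = punctured_disc (2 * sqrt L)"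
  define B where "B = {m. normsq m \<le> 2 * L + 4}"
  have fin: "finite H" "finite B"
    by (auto simp: H_def B_def finite_punctured_disc finite_normsq_le)
  define Z where "Z = {z \<in> H \<times> B. p - lattice_point (snd z) \<in> strip a L (fst z)}"
  define \<phi> where "\<phi> = (\<lambda>(x, y). ((fst y - fst x, snd y - snd x), x) :: (int \<times> int) \<times> (int \<times> int))"
  have inj: "inj_on \<phi> (close_pairs a p L)"
    by (auto simp: inj_on_def \<phi>_def)
  have img: "\<phi> ` close_pairs a p L \<subseteq> Z"
  proof (rule image_subsetI)
    fix z assume z: "z \<in> close_pairs a p L"
    obtain x1 x2 y1 y2 where zeq: "z = ((x1, x2), (y1, y2))"
      by (metis surj_pair)
    define X1 X2 Y1 Y2 P1 P2 where "X1 = real_of_int x1" and "X2 = real_of_int x2"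
      and "Y1 = real_of_int y1" and "Y2 = real_of_int y2" and "P1 = fst p" and "P2 = snd p"
    note defs = X1_def X2_def Y1_def Y2_def P1_def P2_def
    have ne: "(y1 - x1, y2 - x2) \<noteq> (0, 0)"
      using z by (auto simp: zeq close_pairs_def)
    have le: "(X1 - P1)\<^sup>2 + (X2 - P2)\<^sup>2 \<le> L" "(Y1 - P1)\<^sup>2 + (Y2 - P2)\<^sup>2 \<le> L"
      and d: "\<bar>((X1 - P1)\<^sup>2 + (X2 - P2)\<^sup>2) - ((Y1 - P1)\<^sup>2 + (Y2 - P2)\<^sup>2)\<bar> \<le> a"
      using z by (auto simp: zeq close_pairs_def lattice_value_def defs)
    have mid: "(P1 - X1 - (Y1 - X1) / 2)\<^sup>2 + (P2 - X2 - (Y2 - X2) / 2)\<^sup>2 + ((Y1 - X1)\<^sup>2 + (Y2 - X2)\<^sup>2) / 4 =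
        (((X1 - P1)\<^sup>2 + (X2 - P2)\<^sup>2) + ((Y1 - P1)\<^sup>2 + (Y2 - P2)\<^sup>2)) / 2"
      by (simp add: power2_eq_square field_simps)
    have lin: "2 * ((P1 - X1 - (Y1 - X1) / 2) * (Y1 - X1) + (P2 - X2 - (Y2 - X2) / 2) * (Y2 - X2)) =
        ((X1 - P1)\<^sup>2 + (X2 - P2)\<^sup>2) - ((Y1 - P1)\<^sup>2 + (Y2 - P2)\<^sup>2)"
      by (simp add: power2_eq_square field_simps)
    have half: "(P1 - X1 - (Y1 - X1) / 2)\<^sup>2 + (P2 - X2 - (Y2 - X2) / 2)\<^sup>2 + ((Y1 - X1)\<^sup>2 + (Y2 - X2)\<^sup>2) / 4 \<le> L"
    proof -
      have "(v + w) / 2 \<le> L" if "v \<le> L" "w \<le> L" for v w :: real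
        using that by simp
      from this[OF le] show ?thesis
        unfolding mid .
    qed
    have "(Y1 - X1)\<^sup>2 + (Y2 - X2)\<^sup>2 \<le> 4 * L"
    proof -
      have "w \<le> 4 * L" if "u + v + w / 4 \<le> L" "0 \<le> u" "0 \<le> v" for u v w :: real
        using that by linarith
      from this[OF half] show ?thesis
        by simp
    qed
    then have "(y1 - x1, y2 - x2) \<in> H"
      using ne L by (simp add: H_def punctured_disc_def normsq_def defs power_mult_distrib)
    moreover have "(x1, x2) \<in> B"
    proof -
      have *: "s\<^sup>2 \<le> 2 * (s - t)\<^sup>2 + 2 * t\<^sup>2" for s t :: real
        using zero_le_power2[of "s - 2 * t"] by (simp add: power2_eq_square algebra_simps)
      have "P1\<^sup>2 \<le> 1" "P2\<^sup>2 \<le> 1"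
        using p by (auto simp: unit_square_def defs power_le_one)
      then have "X1\<^sup>2 + X2\<^sup>2 \<le> 2 * L + 4"
        using le(1) *[of X1 P1] *[of X2 P2] by argo
      then show ?thesis
        by (simp add: B_def normsq_def defs)
    qed
    moreover have "p - lattice_point (x1, x2) \<in> strip a L (y1 - x1, y2 - x2)"
      using half d unfolding lin[symmetric] by (simp add: strip_def lattice_point_def normsq_def defs)
    ultimately show "\<phi> z \<in> Z"
      by (simp add: Z_def \<phi>_def zeq)
  qed
  have "card (close_pairs a p L) \<le> card Z"
    by (rule card_inj_on_le[OF inj img]) (use fin in \<open>simp add: Z_def\<close>)
  then have "of_nat (card (close_pairs a p L)) \<le> (of_nat (card Z) :: ennreal)"
    by (simp add: of_nat_mono)
  also have "of_nat (card Z) = (\<Sum>z\<in>H \<times> B. indicator (strip a L (fst z)) (p - lattice_point (snd z)) :: ennreal)"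
  proof -
    have "(\<Sum>z\<in>H \<times> B. indicator (strip a L (fst z)) (p - lattice_point (snd z)) :: ennreal) =
        (\<Sum>z\<in>H \<times> B. if p - lattice_point (snd z) \<in> strip a L (fst z) then 1 else 0)"
      by (intro sum.cong refl) (simp add: indicator_def)
    also have "\<dots> = (\<Sum>z\<in>Z. 1)"
      unfolding Z_def using fin by (intro sum.inter_filter[symmetric]) simp
    finally show ?thesis
      by simp
  qed
  also have "\<dots> = (\<Sum>h\<in>H. \<Sum>m\<in>B. indicator (strip a L h) (p - lattice_point m))"
    unfolding sum.cartesian_product by (simp add: case_prod_beta)
  finally show ?thesis
    by (simp add: H_def B_def)
qed


text \<open>
  The hypothesis says that the pair count is at least \<open>D\<close> near every integer translate of \<open>u\<close>. Off these
  squares the kernel is at most \<open>\<eta> = cos (\<pi> d)\<^bsup>2K\<^esup>\<close>, so everywhere \<open>D\<close> times the kernel is at most the kernel times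
  the pair count plus \<open>D \<eta>\<close>. Integrating this over the unit square and unfolding gives the claim.
\<close>

lemma kernel_average_le:
  assumes a: "a \<ge> 0" and L: "L \<ge> 0" and D: "D \<ge> 0" and d: "0 \<le> d" "d \<le> 1 / 2"
    and low: "\<And>p m n. \<bar>fst p - of_int m - fst u\<bar> < d \<Longrightarrow> \<bar>snd p - of_int n - snd u\<bar> < d \<Longrightarrow>
      D \<le> real (card (close_pairs a p L))"
  shows "D * (fejer_coeff K K)\<^sup>2 \<le> D * cos (pi * d) ^ (2 * K) +
    (\<Sum>h\<in>punctured_disc (2 * sqrt L).
      if fst h \<noteq> 0 then a / \<bar>of_int (fst h)\<bar> * ((fejer_coeff K K)\<^sup>2 * (2 * chord_half L h) +
          line_error K (- of_int (snd h) / of_int (fst h)) (chord_half L h))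
      else 2 * sqrt L * (a / \<bar>of_int (snd h)\<bar>))"
proof -
  define H where "H = punctured_disc (2 * sqrt L)"
  define B where "B = {m. normsq m \<le> 2 * L + 4}"
  define \<eta> where "\<eta> = cos (pi * d) ^ (2 * K)"
  define bd where "bd h = (if fst h \<noteq> 0 then a / \<bar>of_int (fst h)\<bar> * ((fejer_coeff K K)\<^sup>2 * (2 * chord_half L h) +
          line_error K (- of_int (snd h) / of_int (fst h)) (chord_half L h))
      else 2 * sqrt L * (a / \<bar>of_int (snd h)\<bar>))" for h :: "int \<times> int"
  define G where "G h z = ennreal (torus_kernel K u z) * indicator (strip a L h) z" for h z
  have [measurable]: "G h \<in> borel_measurable borel" for h
    unfolding G_def by measurable
  have fin: "finite H" "finite B"
    by (auto simp: H_def B_def finite_punctured_disc finite_normsq_le)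
  have \<eta>: "0 \<le> \<eta>"
    by (simp add: \<eta>_def)
  have bd0: "0 \<le> bd h" if "h \<in> H" for h
  proof -
    have "normsq h \<le> 4 * L"
      using that L by (simp add: H_def punctured_disc_def power_mult_distrib)
    then have "0 \<le> chord_half L h"
      by (simp add: chord_half_def normsq_def)
    then have "0 \<le> line_error K s (chord_half L h)" for s
      unfolding line_error_def by (intro sum_nonneg) (auto intro!: add_nonneg_nonneg osc_bound_nonneg)
    then show ?thesis
      using a L \<open>0 \<le> chord_half L h\<close> by (simp add: bd_def)
  qed
  have G_le: "(\<integral>\<^sup>+z. G h z \<partial>lborel) \<le> ennreal (bd h)" if "h \<in> H" for h
  proof -
    have h: "h \<noteq> (0, 0)" "normsq h \<le> 4 * L"
      using that L by (auto simp: H_def punctured_disc_def power_mult_distrib)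
    show ?thesis
    proof (cases "fst h = 0")
      case True
      moreover from this h have "snd h \<noteq> 0"
        by (cases h) auto
      ultimately show ?thesis
        using nn_integral_kernel_strip_axis[OF a _ _ L] by (simp add: G_def bd_def)
    next
      case False
      then show ?thesis
        using nn_integral_kernel_strip[OF a False h(2)] by (simp add: G_def bd_def)
    qed
  qed
  have pointwise: "ennreal D * ennreal (torus_kernel K u p) \<le>
      ennreal (D * \<eta>) + (\<Sum>h\<in>H. \<Sum>m\<in>B. G h (p - lattice_point m))" if p: "p \<in> unit_square" for p
  proof (cases "\<exists>m n. \<bar>fst p - of_int m - fst u\<bar> < d \<and> \<bar>snd p - of_int n - snd u\<bar> < d")
    case True
    then have "D \<le> real (card (close_pairs a p L))"
      using low by blast
    then have "ennreal D \<le> of_nat (card (close_pairs a p L))"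
      by (metis ennreal_leI ennreal_of_nat_eq_real_of_nat)
    also have "\<dots> \<le> (\<Sum>h\<in>H. \<Sum>m\<in>B. indicator (strip a L h) (p - lattice_point m))"
      unfolding H_def B_def by (rule close_pairs_le_strips[OF p L])
    finally have "ennreal D * ennreal (torus_kernel K u p) \<le>
        (\<Sum>h\<in>H. \<Sum>m\<in>B. indicator (strip a L h) (p - lattice_point m)) * ennreal (torus_kernel K u p)"
      by (intro mult_right_mono) auto
    also have "\<dots> = (\<Sum>h\<in>H. \<Sum>m\<in>B. G h (p - lattice_point m))"
    proof -
      have "torus_kernel K u (p - lattice_point m) = torus_kernel K u p" for m
        unfolding lattice_point_def by (rule torus_kernel_periodic)
      then show ?thesis
        unfolding sum_distrib_right by (intro sum.cong refl) (simp add: G_def mult.commute)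
    qed
    finally show ?thesis
      by (simp add: add_increasing)
  next
    case False
    then have "torus_kernel K u p \<le> \<eta>"
      unfolding \<eta>_def using d by (intro torus_kernel_small) (auto simp: not_less)
    then have "ennreal D * ennreal (torus_kernel K u p) \<le> ennreal (D * \<eta>)"
      using D torus_kernel_nonneg by (simp add: ennreal_mult[symmetric] mult_left_mono ennreal_leI)
    then show ?thesis
      by (simp add: add_increasing2)
  qed
  have "ennreal D * ennreal ((fejer_coeff K K)\<^sup>2) =
      (\<integral>\<^sup>+p. ennreal D * (ennreal (torus_kernel K u p) * indicator unit_square p) \<partial>lborel)"
    by (simp add: nn_integral_cmult nn_integral_kernel_square)
  also have "\<dots> \<le> (\<integral>\<^sup>+p. ennreal (D * \<eta>) * indicator unit_square p +
      (\<Sum>h\<in>H. \<Sum>m\<in>B. G h (p - lattice_point m) * indicator unit_square p) \<partial>lborel)"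
  proof (rule nn_integral_mono)
    fix p
    show "ennreal D * (ennreal (torus_kernel K u p) * indicator unit_square p) \<le>
        ennreal (D * \<eta>) * indicator unit_square p +
        (\<Sum>h\<in>H. \<Sum>m\<in>B. G h (p - lattice_point m) * indicator unit_square p)"
      using pointwise[of p] by (cases "p \<in> unit_square") auto
  qed
  also have "\<dots> = ennreal (D * \<eta>) * emeasure lborel unit_square +
      (\<Sum>h\<in>H. \<Sum>m\<in>B. \<integral>\<^sup>+p. G h (p - lattice_point m) * indicator unit_square p \<partial>lborel)"
    by (subst nn_integral_add; (simp add: nn_integral_sum nn_integral_cmult_indicator)?)
  also have "emeasure lborel unit_square = 1"
    unfolding unit_square_def lborel_prod[symmetric] by (subst lborel.emeasure_pair_measure_Times) auto
  also have "(\<Sum>h\<in>H. \<Sum>m\<in>B. \<integral>\<^sup>+p. G h (p - lattice_point m) * indicator unit_square p \<partial>lborel) \<le>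
      (\<Sum>h\<in>H. \<integral>\<^sup>+z. G h z \<partial>lborel)"
    by (intro sum_mono unit_square_unfold fin) measurable
  also have "\<dots> \<le> (\<Sum>h\<in>H. ennreal (bd h))"
    by (intro sum_mono G_le)
  also have "\<dots> = ennreal (\<Sum>h\<in>H. bd h)"
    by (rule sum_ennreal) (rule bd0)
  finally have "ennreal (D * (fejer_coeff K K)\<^sup>2) \<le> ennreal (D * \<eta> + (\<Sum>h\<in>H. bd h))"
    using D \<eta> bd0 by (simp add: ennreal_mult ennreal_plus sum_nonneg add_mono)
  moreover have "0 \<le> D * \<eta> + (\<Sum>h\<in>H. bd h)"
    using D \<eta> bd0 by (simp add: sum_nonneg)
  ultimately have "D * (fejer_coeff K K)\<^sup>2 \<le> D * \<eta> + (\<Sum>h\<in>H. bd h)"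
    by (simp only: ennreal_le_iff)
  then show ?thesis
    unfolding H_def bd_def \<eta>_def .
qed

text \<open>
  Along a strip orthogonal to \<open>h\<close> the frequency is an integer \<open>v\<close>, the value of a linear form at \<open>h\<close>, over the
  first coordinate of \<open>h\<close>. The Jacobian cancels that coordinate.
\<close>

lemma osc_bound_slope:
  fixes h :: "int \<times> int" and v :: int
  assumes h: "fst h \<noteq> 0" "normsq h \<le> 4 * L" and b: "b = 2 * pi * (of_int v / of_int (fst h))"
  shows "osc_bound (chord_half L h) b / \<bar>of_int (fst h)\<bar> \<le>
    (if v \<noteq> 0 then 1 / (pi * \<bar>of_int v\<bar>) else 2 * sqrt L / \<bar>of_int (fst h)\<bar>)"
proof (cases "v = 0")
  case True
  have q: "0 < normsq h"
    using h by (intro normsq_pos) auto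
  have "(of_int (fst h))\<^sup>2 \<le> normsq h"
    by (simp add: normsq_def)
  then have "\<bar>of_int (fst h)\<bar> \<le> sqrt (normsq h)"
    by (simp add: real_le_rsqrt)
  then have "\<bar>of_int (fst h)\<bar> / sqrt (normsq h) \<le> 1"
    using q by simp
  then have "sqrt (L - normsq h / 4) * (\<bar>of_int (fst h)\<bar> / sqrt (normsq h)) \<le> sqrt L * 1"
    using h q by (intro mult_mono) auto
  then have "chord_half L h \<le> sqrt L"
    by (simp add: chord_half_def)
  then show ?thesis
    using True by (simp add: b osc_bound_def divide_right_mono)
next
  case False
  then have "osc_bound (chord_half L h) b = \<bar>of_int (fst h)\<bar> / (pi * \<bar>of_int v\<bar>)"
    using h by (simp add: osc_bound_def b abs_mult)
  then show ?thesis
    using False h by simp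
qed

lemma abs_coord_le_of_punctured_disc:
  assumes "h \<in> punctured_disc r" "0 \<le> r"
  shows "\<bar>fst h\<bar> \<le> int (nat \<lfloor>r\<rfloor>)" "\<bar>snd h\<bar> \<le> int (nat \<lfloor>r\<rfloor>)"
proof -
  have n: "normsq h \<le> r\<^sup>2"
    using assms by (simp add: punctured_disc_def)
  have *: "\<bar>k\<bar> \<le> int (nat \<lfloor>r\<rfloor>)" if "(real_of_int k)\<^sup>2 \<le> normsq h" for k
  proof -
    have "\<bar>real_of_int k\<bar> \<le> r"
      using order_trans[OF that n] assms(2) abs_le_square_iff[of "real_of_int k" r] by simp
    then show ?thesis
      by linarith
  qed
  show "\<bar>fst h\<bar> \<le> int (nat \<lfloor>r\<rfloor>)" "\<bar>snd h\<bar> \<le> int (nat \<lfloor>r\<rfloor>)"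
    by (rule *, simp add: normsq_def)+
qed

lemma sum_line_error_le:
  assumes L: "1 \<le> L" and H: "H \<subseteq> {h \<in> punctured_disc (2 * sqrt L). fst h \<noteq> 0}"
  shows "(\<Sum>h\<in>H. line_error K (- of_int (snd h) / of_int (fst h)) (chord_half L h) / \<bar>of_int (fst h)\<bar>)
    \<le> (2 * real K + 1)\<^sup>2 * (2 * ((40 * sqrt (real K) + 12) * (sqrt L * sqrt (sqrt L))))"
proof -
  define n where "n = nat \<lfloor>2 * sqrt L\<rfloor>"
  have n: "real n \<le> 2 * sqrt L"
    using L unfolding n_def by (intro of_nat_floor) simp
  define X where "X = {..2 * K} \<times> {..2 * K} - {(K, K)}"
  define e where "e v h = (if v \<noteq> 0 then 1 / (pi * \<bar>of_int v\<bar>) else 2 * sqrt L / \<bar>of_int (fst h)\<bar>)"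
    for v :: int and h :: "int \<times> int"
  define c where "c i = int i - int K" for i
  define Bd where "Bd = (40 * sqrt (real K) + 12) * (sqrt L * sqrt (sqrt L))"
  have H': "H \<subseteq> {h. fst h \<noteq> 0 \<and> \<bar>fst h\<bar> \<le> int n \<and> \<bar>snd h\<bar> \<le> int n}"
    using H abs_coord_le_of_punctured_disc[of _ "2 * sqrt L"] L unfolding n_def by fastforce
  have sum_e: "(\<Sum>h\<in>H. e (u * fst h + v * snd h) h) \<le> Bd"
    if "u \<noteq> 0 \<or> v \<noteq> 0" "\<bar>u\<bar> \<le> int K" "\<bar>v\<bar> \<le> int K" for u v
    unfolding e_def Bd_def by (rule sum_linear_form_le[OF that L n H'])
  have "line_error K (- of_int (snd h) / of_int (fst h)) (chord_half L h) / \<bar>of_int (fst h)\<bar> \<le>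
      (\<Sum>(i, j)\<in>X. e (c j * fst h + (- c i) * snd h) h + e ((- c j) * fst h + (- c i) * snd h) h)" if "h \<in> H" for h
  proof -
    have h: "fst h \<noteq> 0" "normsq h \<le> 4 * L"
      using that H L by (auto simp: punctured_disc_def power_mult_distrib)
    have c: "real i - real K = of_int (c i)" for i
      by (simp add: c_def)
    have 1: "osc_bound (chord_half L h) (2 * pi * ((real i - real K) * (- of_int (snd h) / of_int (fst h)) + (real j - real K)))
        / \<bar>of_int (fst h)\<bar> \<le> e (c j * fst h + (- c i) * snd h) h" for i j
      unfolding e_def using h by (intro osc_bound_slope) (auto simp: c field_simps)
    have 2: "osc_bound (chord_half L h) (2 * pi * ((real i - real K) * (- of_int (snd h) / of_int (fst h)) - (real j - real K)))
        / \<bar>of_int (fst h)\<bar> \<le> e ((- c j) * fst h + (- c i) * snd h) h" for i j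
      unfolding e_def using h by (intro osc_bound_slope) (auto simp: c field_simps)
    show ?thesis
      unfolding line_error_def X_def[symmetric] sum_divide_distrib
    proof (rule sum_mono)
      fix x :: "nat \<times> nat"
      obtain i j where x: "x = (i, j)"
        by (cases x)
      show "(case x of (i, j) \<Rightarrow>
          osc_bound (chord_half L h) (2 * pi * ((real i - real K) * (- of_int (snd h) / of_int (fst h)) + (real j - real K))) +
          osc_bound (chord_half L h) (2 * pi * ((real i - real K) * (- of_int (snd h) / of_int (fst h)) - (real j - real K))))
          / \<bar>of_int (fst h)\<bar> \<le>
          (case x of (i, j) \<Rightarrow> e (c j * fst h + (- c i) * snd h) h + e ((- c j) * fst h + (- c i) * snd h) h)"
        unfolding x prod.case add_divide_distrib by (rule add_mono[OF 1 2])
    qed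
  qed
  then have "(\<Sum>h\<in>H. line_error K (- of_int (snd h) / of_int (fst h)) (chord_half L h) / \<bar>of_int (fst h)\<bar>) \<le>
      (\<Sum>h\<in>H. \<Sum>(i, j)\<in>X. e (c j * fst h + (- c i) * snd h) h + e ((- c j) * fst h + (- c i) * snd h) h)"
    by (rule sum_mono)
  also have "\<dots> = (\<Sum>x\<in>X. \<Sum>h\<in>H. case x of (i, j) \<Rightarrow> e (c j * fst h + (- c i) * snd h) h + e ((- c j) * fst h + (- c i) * snd h) h)"
    by (rule sum.swap)
  also have "\<dots> \<le> (\<Sum>x\<in>X. 2 * Bd)"
  proof (rule sum_mono)
    fix x assume x: "x \<in> X"
    obtain i j where ij: "x = (i, j)"
      by (cases x)
    have c: "\<bar>c i\<bar> \<le> int K" "\<bar>c j\<bar> \<le> int K" "c i \<noteq> 0 \<or> c j \<noteq> 0"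
      using x by (auto simp: ij X_def c_def)
    have "(\<Sum>h\<in>H. e (c j * fst h + (- c i) * snd h) h) + (\<Sum>h\<in>H. e ((- c j) * fst h + (- c i) * snd h) h) \<le> Bd + Bd"
      using c by (intro add_mono sum_e) auto
    then show "(\<Sum>h\<in>H. case x of (i, j) \<Rightarrow> e (c j * fst h + (- c i) * snd h) h + e ((- c j) * fst h + (- c i) * snd h) h) \<le> 2 * Bd"
      by (simp add: ij sum.distrib)
  qed
  also have "\<dots> = real (card X) * (2 * Bd)"
    by simp
  also have "\<dots> \<le> (2 * real K + 1)\<^sup>2 * (2 * Bd)"
  proof (rule mult_right_mono)
    have "card X \<le> card ({..2 * K} \<times> {..2 * K})"
      unfolding X_def by (rule card_mono) auto
    then have "real (card X) \<le> real ((2 * K + 1) * (2 * K + 1))"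
      by (simp only: of_nat_le_iff card_cartesian_product card_atMost Suc_eq_plus1)
    then show "real (card X) \<le> (2 * real K + 1)\<^sup>2"
      by (simp add: power2_eq_square algebra_simps)
    show "0 \<le> 2 * Bd"
      using L by (simp add: Bd_def)
  qed
  finally show ?thesis
    by (simp add: Bd_def)
qed

text \<open>
  The estimate of \<open>kernel_average_le\<close> with the sums over \<open>h\<close> carried out. The constant \<open>C\<close> depends on \<open>K\<close>, \<open>a\<close> and \<open>e\<close>
  but not on \<open>L\<close>, \<open>D\<close>, \<open>d\<close> and \<open>u\<close>, and its term has order \<open>L\<^bsup>3/4\<^esup>\<close>.
\<close>

lemma kernel_average_error:
  assumes a: "a > 0" and e: "e > 0"
  obtains C where "C \<ge> 0"
    "\<And>L D d u. 1 \<le> L \<Longrightarrow> 0 \<le> D \<Longrightarrow> 0 \<le> d \<Longrightarrow> d \<le> 1 / 2 \<Longrightarrow>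
      (\<And>p m n. \<bar>fst p - of_int m - fst u\<bar> < d \<Longrightarrow> \<bar>snd p - of_int n - snd u\<bar> < d \<Longrightarrow>
        D \<le> real (card (close_pairs a p L))) \<Longrightarrow>
      D * (fejer_coeff K K)\<^sup>2 \<le> D * cos (pi * d) ^ (2 * K) +
        (fejer_coeff K K)\<^sup>2 * (a * (2 * pi * (pi + e) * L)) + C * (sqrt L * sqrt (sqrt L))"
proof -
  define c where "c = (fejer_coeff K K)\<^sup>2"
  define C where "C = c * a * 8 / e + a * ((2 * real K + 1)\<^sup>2 * (2 * (40 * sqrt (real K) + 12))) + 12 * a"
  have c: "0 \<le> c"
    by (simp add: c_def)
  have C0: "0 \<le> C"
    unfolding C_def using a e c by (intro add_nonneg_nonneg mult_nonneg_nonneg divide_nonneg_nonneg) auto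
  moreover have "D * c \<le> D * cos (pi * d) ^ (2 * K) + c * (a * (2 * pi * (pi + e) * L)) + C * (sqrt L * sqrt (sqrt L))"
    if L: "1 \<le> L" and D: "0 \<le> D" and d: "0 \<le> d" "d \<le> 1 / 2"
      and low: "\<And>p m n. \<bar>fst p - of_int m - fst u\<bar> < d \<Longrightarrow> \<bar>snd p - of_int n - snd u\<bar> < d \<Longrightarrow>
        D \<le> real (card (close_pairs a p L))" for L D d u
  proof -
    define H where "H = punctured_disc (2 * sqrt L)"
    define H1 where "H1 = {h \<in> H. fst h \<noteq> 0}"
    define H0 where "H0 = {h \<in> H. fst h = 0}"
    define W where "W = sqrt L * sqrt (sqrt L)"
    have fin: "finite H"
      by (simp add: H_def finite_punctured_disc)
    have sL: "1 \<le> sqrt L" "1 \<le> sqrt (sqrt L)"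
      using L by auto
    have sW: "sqrt L \<le> W"
      unfolding W_def using mult_left_mono[OF sL(2), of "sqrt L"] sL by simp
    define main where "main h = c * a * (sqrt ((2 * sqrt L)\<^sup>2 - normsq h) / sqrt (normsq h))" for h
    define err where "err h = line_error K (- of_int (snd h) / of_int (fst h)) (chord_half L h) / \<bar>of_int (fst h)\<bar>" for h
    have nn: "normsq h \<le> 4 * L" if "h \<in> H" for h
      using that L by (simp add: H_def punctured_disc_def power_mult_distrib)
    have main0: "0 \<le> main h" if "h \<in> H" for h
      using nn[OF that] a c L by (simp add: main_def power_mult_distrib normsq_def)
    have eq1: "a / \<bar>of_int (fst h)\<bar> * (c * (2 * chord_half L h) +
          line_error K (- of_int (snd h) / of_int (fst h)) (chord_half L h)) = main h + a * err h" if "h \<in> H1" for h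
    proof -
      have h: "fst h \<noteq> 0" "normsq h \<le> 4 * L"
        using that nn by (auto simp: H1_def)
      have "sqrt ((2 * sqrt L)\<^sup>2 - normsq h) = sqrt (4 * (L - normsq h / 4))"
        using L by (simp add: power_mult_distrib)
      also have "\<dots> = 2 * sqrt (L - normsq h / 4)"
        by (subst real_sqrt_mult) simp
      finally have "a / \<bar>of_int (fst h)\<bar> * (c * (2 * chord_half L h)) = main h"
        using h by (simp add: main_def chord_half_def)
      then show ?thesis
        by (simp add: distrib_left err_def)
    qed
    have "D * c \<le> D * cos (pi * d) ^ (2 * K) +
      (\<Sum>h\<in>H. if fst h \<noteq> 0 then a / \<bar>of_int (fst h)\<bar> * (c * (2 * chord_half L h) +
          line_error K (- of_int (snd h) / of_int (fst h)) (chord_half L h))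
        else 2 * sqrt L * (a / \<bar>of_int (snd h)\<bar>))"
      unfolding c_def H_def using a L by (intro kernel_average_le[OF _ _ D d low]) auto
    also have "(\<Sum>h\<in>H. if fst h \<noteq> 0 then a / \<bar>of_int (fst h)\<bar> * (c * (2 * chord_half L h) +
          line_error K (- of_int (snd h) / of_int (fst h)) (chord_half L h))
        else 2 * sqrt L * (a / \<bar>of_int (snd h)\<bar>)) =
        (\<Sum>h\<in>H1. a / \<bar>of_int (fst h)\<bar> * (c * (2 * chord_half L h) +
          line_error K (- of_int (snd h) / of_int (fst h)) (chord_half L h))) +
        (\<Sum>h\<in>H0. 2 * sqrt L * (a / \<bar>of_int (snd h)\<bar>))"
      using fin by (simp add: sum.If_cases H1_def H0_def Int_def)
    also have "(\<Sum>h\<in>H1. a / \<bar>of_int (fst h)\<bar> * (c * (2 * chord_half L h) +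
          line_error K (- of_int (snd h) / of_int (fst h)) (chord_half L h))) =
        (\<Sum>h\<in>H1. main h) + a * (\<Sum>h\<in>H1. err h)"
      unfolding sum_distrib_left sum.distrib[symmetric] by (rule sum.cong[OF refl eq1])
    also have "(\<Sum>h\<in>H1. main h) \<le> (\<Sum>h\<in>H. main h)"
      using fin main0 by (intro sum_mono2) (auto simp: H1_def)
    also have "\<dots> = c * a * (\<Sum>h\<in>H. sqrt ((2 * sqrt L)\<^sup>2 - normsq h) / sqrt (normsq h))"
      by (simp add: main_def sum_distrib_left)
    also have "\<dots> \<le> c * a * ((pi + e) * (pi / 2) * (2 * sqrt L)\<^sup>2 + 4 * (2 * sqrt L) / e)"
      unfolding H_def using a c L e by (intro mult_left_mono sum_radial_le) auto
    also have "\<dots> = c * (a * (2 * pi * (pi + e) * L)) + c * a * 8 / e * sqrt L"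
      using L by (simp add: power_mult_distrib algebra_simps)
    also have "\<dots> \<le> c * (a * (2 * pi * (pi + e) * L)) + c * a * 8 / e * W"
      using a c e sW by (intro add_left_mono mult_left_mono) auto
    also have "a * (\<Sum>h\<in>H1. err h) \<le> a * ((2 * real K + 1)\<^sup>2 * (2 * ((40 * sqrt (real K) + 12) * W)))"
      unfolding err_def W_def using a L by (intro mult_left_mono sum_line_error_le) (auto simp: H1_def H_def)
    also have "(\<Sum>h\<in>H0. 2 * sqrt L * (a / \<bar>of_int (snd h)\<bar>)) = 2 * sqrt L * a * (\<Sum>h\<in>H0. 1 / \<bar>real_of_int (snd h)\<bar>)"
      by (simp add: sum_distrib_left)
    also have "\<dots> \<le> 2 * sqrt L * a * (6 * sqrt (sqrt L))"
    proof (intro mult_left_mono sum_inverse_axis_le[OF L])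
      show "real (nat \<lfloor>2 * sqrt L\<rfloor>) \<le> 2 * sqrt L"
        using L by (intro of_nat_floor) simp
      show "H0 \<subseteq> {h. fst h = 0 \<and> snd h \<noteq> 0 \<and> \<bar>snd h\<bar> \<le> int (nat \<lfloor>2 * sqrt L\<rfloor>)}"
      proof
        fix h assume h: "h \<in> H0"
        then have "snd h \<noteq> 0"
          by (cases h) (auto simp: H0_def H_def punctured_disc_def)
        moreover have "\<bar>snd h\<bar> \<le> int (nat \<lfloor>2 * sqrt L\<rfloor>)"
          using h L by (intro abs_coord_le_of_punctured_disc) (auto simp: H0_def H_def)
        ultimately show "h \<in> {h. fst h = 0 \<and> snd h \<noteq> 0 \<and> \<bar>snd h\<bar> \<le> int (nat \<lfloor>2 * sqrt L\<rfloor>)}"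
          using h by (simp add: H0_def)
      qed
    qed (use a L in auto)
    finally have "D * c \<le> D * cos (pi * d) ^ (2 * K) + (c * (a * (2 * pi * (pi + e) * L)) + c * a * 8 / e * W +
        a * ((2 * real K + 1)\<^sup>2 * (2 * ((40 * sqrt (real K) + 12) * W))) + 2 * sqrt L * a * (6 * sqrt (sqrt L)))"
      by simp
    also have "\<dots> = D * cos (pi * d) ^ (2 * K) + c * (a * (2 * pi * (pi + e) * L)) + C * W"
      by (simp add: C_def W_def algebra_simps)
    finally show ?thesis
      by (simp add: W_def)
  qed
  ultimately show ?thesis
    using that[of C] unfolding c_def by blast
qed

lemma card_close_pairs_periodic:
  assumes "L > 0"
  shows "card (close_pairs a (p - (of_int m, of_int n)) L) = card (close_pairs a p L)"
proof -
  have "abs_torus (p - (of_int m, of_int n)) = abs_torus p"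
    by (auto simp: torus.abs_eq_iff torus_rel_def)
  then have "R2 (abs_torus (p - (of_int m, of_int n))) (- a) a L = R2 (abs_torus p) (- a) a L"
    by simp
  then show ?thesis
    using assms by (simp add: R2_eq_card_close_pairs)
qed

text \<open>
  The square of the mean of \<open>cos (\<pi> x)\<^bsup>2K\<^esup>\<close> decays only like \<open>1/K\<^sup>2\<close> at worst, by the bound on the central
  binomial coefficient, whereas \<open>w\<^bsup>2K\<^esup>\<close> decays exponentially.
\<close>

lemma exists_concentrated_kernel:
  assumes w: "0 \<le> w" "w < 1" and t: "0 < t"
  obtains K where "0 < fejer_coeff K K" "w ^ (2 * K) \<le> t * (fejer_coeff K K)\<^sup>2"
proof -
  have "(\<lambda>n. of_nat n * w ^ n) \<longlonglongrightarrow> 0"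
    using w by (intro powser_times_n_limit_0) auto
  then have "(\<lambda>n. 4 * (of_nat n * w ^ n)\<^sup>2) \<longlonglongrightarrow> 4 * 0\<^sup>2"
    by (intro tendsto_intros)
  then have "\<forall>\<^sub>F n in sequentially. 4 * (of_nat n * w ^ n)\<^sup>2 < t"
    using t by (intro order_tendstoD) auto
  then have "\<forall>\<^sub>F n in sequentially. 4 * (of_nat n * w ^ n)\<^sup>2 < t \<and> 0 < n"
    using eventually_gt_at_top[of "0::nat"] by eventually_elim auto
  then obtain K where K: "4 * (of_nat K * w ^ K)\<^sup>2 < t" "0 < K"
    by (auto simp: eventually_sequentially)
  have ge: "1 / (2 * real K) \<le> fejer_coeff K K"
    using central_binomial_lower_bound[OF K(2)] K(2) by (simp add: fejer_coeff_def field_simps)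
  have "w ^ (2 * K) = 4 * (of_nat K * w ^ K)\<^sup>2 * (1 / (2 * real K))\<^sup>2"
    using K(2) by (simp add: power_mult_distrib power_divide power_mult[symmetric] mult.commute)
  also have "\<dots> \<le> t * (fejer_coeff K K)\<^sup>2"
    using K ge t by (intro mult_mono power_mono) auto
  finally have "w ^ (2 * K) \<le> t * (fejer_coeff K K)\<^sup>2" .
  moreover have "0 < fejer_coeff K K"
    using ge K(2) by (intro less_le_trans[OF _ ge]) simp
  ultimately show ?thesis
    using that by blast
qed

text \<open>
  Otherwise the pair count would be at least \<open>\<pi>(2\<pi>a + e)L\<close> throughout \<open>U\<close> for all \<open>L \<ge> L0\<close>. Testing this with a
  kernel so concentrated at a point of \<open>U\<close> that the loss outside \<open>U\<close> costs only \<open>e/2\<close>, the average bounds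
  would give \<open>2\<pi>a + e/2 \<le> 2\<pi>a + e/4 + o(1)\<close>.
\<close>

lemma exists_low_pair_count:
  fixes U :: "(real \<times> real) set"
  assumes a: "a > 0" and e: "e > 0" and U: "open U" "U \<noteq> {}"
  shows "\<exists>p\<in>U. \<exists>L\<ge>L0. real (card (close_pairs a p L)) < pi * (2 * pi * a + e) * L"
proof (rule ccontr)
  assume "\<not> ?thesis"
  then have high: "\<And>p L. p \<in> U \<Longrightarrow> L0 \<le> L \<Longrightarrow> pi * (2 * pi * a + e) * L \<le> real (card (close_pairs a p L))"
    by (auto simp: not_less)
  obtain u where u: "u \<in> U"
    using U by auto
  obtain r where r: "r > 0" "ball u r \<subseteq> U"
    using U(1) u by (meson openE)
  define d where "d = min (r / 2) (1 / 2)"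
  have d: "0 < d" "d \<le> 1 / 2" "d \<le> r / 2"
    using r by (auto simp: d_def)
  have inU: "q \<in> U" if "\<bar>fst q - fst u\<bar> < d" "\<bar>snd q - snd u\<bar> < d" for q
  proof -
    have "dist u q \<le> \<bar>fst q - fst u\<bar> + \<bar>snd q - snd u\<bar>"
      unfolding dist_prod_def dist_real_def
      by (metis abs_minus_commute sqrt_sum_squares_le_sum_abs power2_abs)
    also have "\<dots> < r"
      using that d by linarith
    finally show ?thesis
      using r by auto
  qed
  define w where "w = cos (pi * d)"
  have w: "0 \<le> w" "w < 1"
  proof -
    have "0 < pi * d" "pi * d \<le> pi * (1 / 2)"
      using d by (auto intro!: mult_left_mono)
    moreover from this have "- (pi / 2) \<le> pi * d"
      using pi_gt_zero by linarith
    ultimately show "0 \<le> w" "w < 1"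
      using cos_monotone_0_pi[of 0 "pi * d"] unfolding w_def by (auto intro!: cos_ge_zero)
  qed
  define T where "T = 2 * pi * a + e"
  have T: "0 < T"
    using a e by (simp add: T_def add_pos_pos)
  obtain K where K: "0 < fejer_coeff K K" "w ^ (2 * K) \<le> e / (2 * T) * (fejer_coeff K K)\<^sup>2"
    using exists_concentrated_kernel[OF w, of "e / (2 * T)"] e T by auto
  define c where "c = (fejer_coeff K K)\<^sup>2"
  have c: "0 < c"
    using K by (simp add: c_def)
  \<comment> \<open>This choice makes the loss \<open>2\<pi>a e'\<close> in the main term equal to \<open>\<pi> e/4\<close>.\<close>
  define e' where "e' = e / (8 * a)"
  have e': "0 < e'"
    using a e by (simp add: e'_def)
  obtain C where C: "C \<ge> 0" "\<And>L D d u. 1 \<le> L \<Longrightarrow> 0 \<le> D \<Longrightarrow> 0 \<le> d \<Longrightarrow> d \<le> 1 / 2 \<Longrightarrow>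
      (\<And>p m n. \<bar>fst p - of_int m - fst u\<bar> < d \<Longrightarrow> \<bar>snd p - of_int n - snd u\<bar> < d \<Longrightarrow>
        D \<le> real (card (close_pairs a p L))) \<Longrightarrow>
      D * (fejer_coeff K K)\<^sup>2 \<le> D * cos (pi * d) ^ (2 * K) +
        (fejer_coeff K K)\<^sup>2 * (a * (2 * pi * (pi + e') * L)) + C * (sqrt L * sqrt (sqrt L))"
    using kernel_average_error[OF a e', of K] by blast
  \<comment> \<open>With \<open>L = s\<^sup>4\<close> the error term becomes \<open>C s\<^sup>3\<close>, and the third bound on \<open>s\<close> makes it smaller than the gain.\<close>
  define s where "s = max 1 (max \<bar>L0\<bar> (C / (pi * (e / 4) * c) + 1))"
  have s: "1 \<le> s" "\<bar>L0\<bar> \<le> s" "C / (pi * (e / 4) * c) < s"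
    by (auto simp: s_def)
  define L where "L = s ^ 4"
  have sL: "s \<le> L"
    unfolding L_def using s by (metis One_nat_def Suc_leI power_increasing power_one_right zero_less_numeral)
  have L: "1 \<le> L" "L0 \<le> L"
    using s sL by linarith+
  have sq: "sqrt L = s\<^sup>2" "sqrt (s\<^sup>2) = s"
    using s by (auto simp: L_def real_sqrt_unique)
  define D where "D = pi * T * L"
  have D: "0 \<le> D"
    using T L by (simp add: D_def)
  have "D * c \<le> D * w ^ (2 * K) + c * (a * (2 * pi * (pi + e') * L)) + C * (sqrt L * sqrt (sqrt L))"
    unfolding c_def w_def
  proof (rule C(2)[OF L(1) D])
    fix p :: "real \<times> real" and m n :: int
    assume p: "\<bar>fst p - of_int m - fst u\<bar> < d" "\<bar>snd p - of_int n - snd u\<bar> < d"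
    then have "p - (of_int m, of_int n) \<in> U"
      by (intro inU) auto
    then have "D \<le> real (card (close_pairs a (p - (of_int m, of_int n)) L))"
      unfolding D_def T_def using L by (intro high)
    then show "D \<le> real (card (close_pairs a p L))"
      using L by (simp add: card_close_pairs_periodic)
  qed (use d in auto)
  also have "D * w ^ (2 * K) \<le> D * (e / (2 * T) * c)"
    unfolding c_def using D K by (intro mult_left_mono) auto
  also have "D * (e / (2 * T) * c) = pi * (e / 2) * c * L"
    using T by (simp add: D_def)
  also have "c * (a * (2 * pi * (pi + e') * L)) = pi * (2 * pi * a + e / 4) * c * L"
    using a by (simp add: e'_def field_simps)
  also have "C * (sqrt L * sqrt (sqrt L)) = C * s ^ 3"
    unfolding sq by (simp add: power3_eq_cube power2_eq_square)
  finally have "pi * (e / 4) * c * L \<le> C * s ^ 3"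
    by (simp add: D_def T_def algebra_simps)
  then have "pi * (e / 4) * c * s * s ^ 3 \<le> C * s ^ 3"
    by (simp add: L_def power4_eq_xxxx power3_eq_cube mult_ac)
  then have "pi * (e / 4) * c * s \<le> C"
    using s by (simp only: mult_le_cancel_right_pos zero_less_power)
  moreover have "C < pi * (e / 4) * c * s"
    using s(3) e c by (simp add: field_simps)
  ultimately show False
    by linarith
qed

section \<open>Generic points\<close>

lemma exists_even_rational_point:
  fixes U :: "(real \<times> real) set"
  assumes "open U" "U \<noteq> {}"
  obtains N :: nat and b c :: int where "N > 0" "even N" "(of_int b / of_nat N, of_int c / of_nat N) \<in> U"
proof -
  obtain u where u: "u \<in> U"
    using assms by auto
  obtain r where r: "r > 0" "ball u r \<subseteq> U"
    using assms(1) u by (meson openE)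
  define N where "N = 2 * (nat \<lceil>1 / r\<rceil> + 1)"
  define b where "b = \<lfloor>real N * fst u\<rfloor>"
  define c where "c = \<lfloor>real N * snd u\<rfloor>"
  have N: "N > 0" "2 / real N < r"
  proof -
    have "1 / r < real (nat \<lceil>1 / r\<rceil> + 1)"
      by linarith
    then have "1 / r < real N / 2"
      by (simp add: N_def)
    then have "1 < real N / 2 * r"
      using r by (simp only: pos_divide_less_eq)
    moreover show "N > 0"
      by (simp add: N_def)
    ultimately show "2 / real N < r"
      by (simp add: pos_divide_less_eq mult.commute)
  qed
  have *: "\<bar>t - of_int \<lfloor>real N * t\<rfloor> / real N\<bar> \<le> 1 / real N" for t
  proof -
    have "\<bar>real N * t - of_int \<lfloor>real N * t\<rfloor>\<bar> \<le> 1"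
      by linarith
    then have "\<bar>real N * t - of_int \<lfloor>real N * t\<rfloor>\<bar> / real N \<le> 1 / real N"
      by (intro divide_right_mono) auto
    moreover have "t - of_int \<lfloor>real N * t\<rfloor> / real N = (real N * t - of_int \<lfloor>real N * t\<rfloor>) / real N"
      using N by (simp add: field_simps)
    ultimately show ?thesis
      by simp
  qed
  have "dist u (of_int b / of_nat N, of_int c / of_nat N) \<le>
      \<bar>fst u - of_int b / of_nat N\<bar> + \<bar>snd u - of_int c / of_nat N\<bar>"
    unfolding dist_prod_def dist_real_def fst_conv snd_conv
    using sqrt_sum_squares_le_sum_abs[of "fst u - of_int b / of_nat N" "snd u - of_int c / of_nat N"] by simp
  also have "\<dots> \<le> 1 / real N + 1 / real N"
    unfolding b_def c_def by (intro add_mono *)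
  also have "\<dots> < r"
    using N by simp
  finally have "(of_int b / of_nat N, of_int c / of_nat N) \<in> U"
    using r by auto
  moreover have "even N"
    by (simp add: N_def)
  ultimately show ?thesis
    using that N by blast
qed

text \<open>
  The points near which \<open>P\<close> holds throughout a neighbourhood, at one common parameter \<open>L \<ge> n\<close>. Taking open
  neighbourhoods makes this set open by construction.
\<close>

definition persists_beyond :: "(real \<times> real \<Rightarrow> real \<Rightarrow> bool) \<Rightarrow> nat \<Rightarrow> (real \<times> real) set" where
  "persists_beyond P n = \<Union>{V. open V \<and> (\<exists>L\<ge>real n. 1 \<le> L \<and> (\<forall>q\<in>V. P q L))}"

lemma open_persists_beyond: "open (persists_beyond P n)"
  by (auto simp: persists_beyond_def)

lemma persists_beyondD: "p \<in> persists_beyond P n \<Longrightarrow> \<exists>L\<ge>real n. 1 \<le> L \<and> P p L"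
  by (auto simp: persists_beyond_def)

lemma dense_persists_beyond:
  assumes "\<And>U. open U \<Longrightarrow> U \<noteq> {} \<Longrightarrow> \<exists>p\<in>U. \<exists>L\<ge>max (real n) 1. \<forall>\<^sub>F q in nhds p. P q L"
  shows "closure (persists_beyond P n) = UNIV"
proof (rule ccontr)
  assume "closure (persists_beyond P n) \<noteq> UNIV"
  then have "- closure (persists_beyond P n) \<noteq> {}"
    by auto
  moreover have "open (- closure (persists_beyond P n))"
    by auto
  ultimately obtain p L where p: "p \<in> - closure (persists_beyond P n)" and L: "max (real n) 1 \<le> L"
    and ev: "\<forall>\<^sub>F q in nhds p. P q L"
    using assms by blast
  obtain V where V: "open V" "p \<in> V" "\<forall>q\<in>V. P q L"
    using ev unfolding eventually_nhds by blast
  have "p \<in> persists_beyond P n"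
    unfolding persists_beyond_def using V L by (intro UnionI[of V]) auto
  then show False
    using p closure_subset by blast
qed

text \<open>
  The second bound feeds the crossing argument for (ii).
\<close>

definition high_at :: "real \<Rightarrow> real \<times> real \<Rightarrow> real \<Rightarrow> bool" where
  "high_at a p L \<longleftrightarrow> pi * L * (ln L / ln (ln (ln L))) \<le> real (card (close_pairs a p L)) \<and>
     pi * L * (2 * pi * a) \<le> real (card (close_pairs a p L))"

text \<open>
  At a rational point the pair count exceeds \<open>k L ln L\<close>, which eventually beats both bounds in \<open>high_at\<close>: once
  \<open>ln (ln (ln L)) \<ge> \<pi>/k\<close> for the first, and once \<open>ln L \<ge> 2\<pi>\<^sup>2a/k\<close> for the second.
\<close>

lemma exists_high_pair_count:
  fixes U :: "(real \<times> real) set"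
  assumes a: "a > 0" and U: "open U" "U \<noteq> {}"
  shows "\<exists>p\<in>U. \<exists>L\<ge>L0. \<forall>\<^sub>F q in nhds p. high_at a q L"
proof -
  obtain N :: nat and b c :: int where N: "N > 0" "even N" and pU: "(of_int b / of_nat N, of_int c / of_nat N) \<in> U"
    using exists_even_rational_point[OF U] by blast
  define p where "p = (real_of_int b / of_nat N, real_of_int c / of_nat N)"
  obtain k where k: "k > 0" "\<forall>\<^sub>F L in at_top. k * L * ln L \<le> card (equal_pairs p L)"
    using card_equal_pairs_rational[OF N, of b c] unfolding p_def by blast
  have ln3: "filterlim (\<lambda>L::real. ln (ln (ln L))) at_top at_top"
    by (intro filterlim_compose[OF ln_at_top] ln_at_top filterlim_ident)
  have "\<forall>\<^sub>F L :: real in at_top. max 1 L0 \<le> L" "\<forall>\<^sub>F L in at_top. 2 * pi * pi * a / k \<le> ln L"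
      "\<forall>\<^sub>F L :: real in at_top. pi / k \<le> ln (ln (ln L))"
    using ln_at_top ln3 by (simp_all add: filterlim_at_top eventually_ge_at_top del: max.bounded_iff)
  with k(2) have "\<forall>\<^sub>F L in at_top. max 1 L0 \<le> L \<and>
      pi * L * (ln L / ln (ln (ln L))) \<le> real (card (equal_pairs p L)) \<and>
      pi * L * (2 * pi * a) \<le> real (card (equal_pairs p L))"
  proof eventually_elim
    case (elim L)
    have L: "1 \<le> L" "0 \<le> ln L"
      using elim(2) by auto
    have pk: "0 < pi / k"
      using k(1) by simp
    moreover from this elim(4) have "0 < ln (ln (ln L))"
      by linarith
    ultimately have "pi / ln (ln (ln L)) \<le> pi / (pi / k)"
      by (intro divide_left_mono elim(4) mult_pos_pos) auto
    then have "pi / ln (ln (ln L)) \<le> k"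
      by simp
    then have "(pi / ln (ln (ln L))) * (L * ln L) \<le> k * (L * ln L)"
      using L by (intro mult_right_mono) auto
    then have 1: "pi * L * (ln L / ln (ln (ln L))) \<le> k * L * ln L"
      by (simp add: mult_ac)
    have "2 * pi * pi * a \<le> k * ln L"
      using elim(3) k(1) by (simp add: field_simps)
    then have "(2 * pi * pi * a) * L \<le> (k * ln L) * L"
      using L by (intro mult_right_mono) auto
    then have 2: "pi * L * (2 * pi * a) \<le> k * L * ln L"
      by (simp add: mult_ac)
    show ?case
      using 1 2 elim(1,2) by linarith
  qed
  then obtain L where L: "max 1 L0 \<le> L"
    "pi * L * (ln L / ln (ln (ln L))) \<le> real (card (equal_pairs p L))"
    "pi * L * (2 * pi * a) \<le> real (card (equal_pairs p L))"
    by (auto simp: eventually_at_top_linorder)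
  have "\<forall>\<^sub>F q in nhds p. equal_pairs p L \<subseteq> close_pairs a q L"
    by (rule eventually_close_pairs_superset[OF finite_equal_pairs a]) (auto simp: equal_pairs_def)
  then have "\<forall>\<^sub>F q in nhds p. high_at a q L"
  proof eventually_elim
    case (elim q)
    then have "card (equal_pairs p L) \<le> card (close_pairs a q L)"
      by (rule card_mono[OF finite_close_pairs])
    then show ?case
      using L unfolding high_at_def by linarith
  qed
  then show ?thesis
    using pU L(1) unfolding p_def by (intro bexI exI[of _ L]) auto
qed

definition low_at :: "real \<Rightarrow> real \<Rightarrow> real \<times> real \<Rightarrow> real \<Rightarrow> bool" where
  "low_at a e p L \<longleftrightarrow> real (card (close_pairs a p L)) < pi * (2 * pi * a + e) * L"

lemma exists_low_near:
  fixes U :: "(real \<times> real) set"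
  assumes "a > 0" "e > 0" "open U" "U \<noteq> {}"
  shows "\<exists>p\<in>U. \<exists>L\<ge>L0. \<forall>\<^sub>F q in nhds p. low_at a e q L"
proof -
  obtain p L where p: "p \<in> U" and L: "L0 \<le> L" and low: "real (card (close_pairs a p L)) < pi * (2 * pi * a + e) * L"
    using exists_low_pair_count[OF assms] by blast
  have "\<forall>\<^sub>F q in nhds p. low_at a e q L"
    using eventually_close_pairs_subset[where p = p and a = a and L = L]
  proof eventually_elim
    case (elim q)
    then have "card (close_pairs a q L) \<le> card (close_pairs a p L)"
      by (rule card_mono[OF finite_close_pairs])
    then show ?case
      using low unfolding low_at_def by linarith
  qed
  then show ?thesis
    using p L by blast
qed

lemma tendsto_along_sequence:
  fixes f :: "real \<Rightarrow> real"
  assumes f: "\<And>n :: nat. \<exists>L\<ge>real n. c \<le> f L \<and> f L \<le> c + 1 / (real n + 1)"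
  shows "\<exists>L :: nat \<Rightarrow> real. strict_mono L \<and> filterlim L at_top sequentially \<and> (\<lambda>j. f (L j)) \<longlonglongrightarrow> c"
proof -
  define Q where "Q n L \<longleftrightarrow> real n \<le> L \<and> c \<le> f L \<and> f L \<le> c + 1 / (real n + 1)" for n :: nat and L
  have "\<exists>L. \<forall>n. Q n (L n) \<and> L n < L (Suc n)"
  proof (rule dependent_nat_choice)
    show "\<exists>x. Q 0 x"
      using f[of 0] unfolding Q_def by blast
    fix x :: real and n :: nat
    define k where "k = max (Suc n) (nat \<lceil>x\<rceil> + 1)"
    obtain L where L: "real k \<le> L" "c \<le> f L" "f L \<le> c + 1 / (real k + 1)"
      using f[of k] by blast
    have "1 / (real k + 1) \<le> 1 / (real (Suc n) + 1)"
      by (intro divide_left_mono) (auto simp: k_def)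
    moreover have "real (Suc n) \<le> real k" "x < real k"
      unfolding k_def by linarith+
    ultimately show "\<exists>y. Q (Suc n) y \<and> x < y"
      using L unfolding Q_def by (intro exI[of _ L]) linarith
  qed
  then obtain L where Q: "\<And>n. Q n (L n)" and inc: "\<And>n. L n < L (Suc n)"
    by blast
  have "strict_mono L"
    using inc by (simp add: strict_mono_Suc_iff)
  moreover have "filterlim L at_top sequentially"
    by (rule filterlim_at_top_mono[OF filterlim_real_sequentially]) (use Q in \<open>simp add: Q_def\<close>)
  moreover have "(\<lambda>j. f (L j)) \<longlonglongrightarrow> c"
  proof (rule tendsto_sandwich[where f = "\<lambda>_. c" and h = "\<lambda>j. c + 1 / (real j + 1)"])
    show "(\<lambda>j. c + 1 / (real j + 1)) \<longlonglongrightarrow> c"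
      using tendsto_add[OF tendsto_const[of c] LIMSEQ_inverse_real_of_nat]
      by (simp add: inverse_eq_divide add.commute)
  qed (use Q in \<open>auto simp: Q_def\<close>)
  ultimately show ?thesis
    by blast
qed

theorem theorem1p13:
  fixes a :: real
  assumes "a > 0"
  shows "\<exists>C :: torus set. second_category C \<and>
    (\<forall>t\<in>C. \<forall>L0. \<exists>L\<ge>L0. R2 t (- a) a L \<ge> ln L / ln (ln (ln L))) \<and>
    (\<forall>t\<in>C. \<exists>L :: nat \<Rightarrow> real. strict_mono L \<and> filterlim L at_top sequentially \<and>
       (\<lambda>j. R2 t (- a) a (L j)) \<longlonglongrightarrow> 2 * pi * a)"
proof -
  define C where "C = {t. (\<forall>L0. \<exists>L\<ge>L0. R2 t (- a) a L \<ge> ln L / ln (ln (ln L))) \<and>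
    (\<exists>L :: nat \<Rightarrow> real. strict_mono L \<and> filterlim L at_top sequentially \<and>
       (\<lambda>j. R2 t (- a) a (L j)) \<longlonglongrightarrow> 2 * pi * a)}"
  define \<W> where "\<W> = range (persists_beyond (high_at a)) \<union>
    range (\<lambda>n. persists_beyond (low_at a (1 / (real n + 1))) n)"
  have "second_category C"
  proof (rule second_category_torusI[of \<W>])
    show "countable \<W>"
      by (simp add: \<W>_def)
    show "open W" if "W \<in> \<W>" for W
      using that open_persists_beyond by (auto simp: \<W>_def)
    show "closure W = UNIV" if "W \<in> \<W>" for W
    proof -
      have "closure (persists_beyond (high_at a) n) = UNIV" for n
        by (rule dense_persists_beyond, rule exists_high_pair_count[OF assms])
      moreover have "closure (persists_beyond (low_at a (1 / (real n + 1))) n) = UNIV" for n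
        by (rule dense_persists_beyond, rule exists_low_near[OF assms]) auto
      ultimately show ?thesis
        using that unfolding \<W>_def by blast
    qed
  next
    fix p assume p: "p \<in> \<Inter>\<W>"
    have high: "\<exists>L\<ge>real n. 1 \<le> L \<and> high_at a p L" for n
      using p by (intro persists_beyondD) (auto simp: \<W>_def)
    have low: "\<exists>L\<ge>real n. 1 \<le> L \<and> low_at a (1 / (real n + 1)) p L" for n
      using p by (intro persists_beyondD) (auto simp: \<W>_def)
    have R2: "R2 (abs_torus p) (- a) a L = card (close_pairs a p L) / (pi * L)" for L
      by (rule R2_eq_card_close_pairs)
    have "\<exists>L\<ge>L0. R2 (abs_torus p) (- a) a L \<ge> ln L / ln (ln (ln L))" for L0
    proof -
      obtain L where L: "real (nat \<lceil>L0\<rceil>) \<le> L" "1 \<le> L" "high_at a p L"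
        using high by blast
      then have "ln L / ln (ln (ln L)) \<le> R2 (abs_torus p) (- a) a L"
        unfolding R2 high_at_def by (subst pos_le_divide_eq) (auto simp: mult_ac)
      moreover have "L0 \<le> L"
        using L(1) by linarith
      ultimately show ?thesis
        by blast
    qed
    moreover have "\<exists>L\<ge>real n. 2 * pi * a \<le> R2 (abs_torus p) (- a) a L \<and>
        R2 (abs_torus p) (- a) a L \<le> 2 * pi * a + 1 / (real n + 1)" for n :: nat
    proof -
      obtain L1 where L1: "real n \<le> L1" "1 \<le> L1" "high_at a p L1"
        using high by blast
      define k where "k = max n (nat \<lceil>L1\<rceil>)"
      have k: "real n \<le> real k" "L1 \<le> real k"
        unfolding k_def by linarith+
      obtain L2 where L2: "real k \<le> L2" "1 \<le> L2" "low_at a (1 / (real k + 1)) p L2"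
        using low by blast
      have "1 / (real k + 1) \<le> 1 / (real n + 1)"
        using k by (intro divide_left_mono) auto
      then have "pi * (2 * pi * a + 1 / (real k + 1)) * L2 \<le> pi * (2 * pi * a + 1 / (real n + 1)) * L2"
        using L2 by (intro mult_right_mono mult_left_mono) auto
      then have low2: "real (card (close_pairs a p L2)) \<le> pi * (2 * pi * a + 1 / (real n + 1)) * L2"
        using L2(3) unfolding low_at_def by linarith
      obtain L where L: "L1 \<le> L" "pi * (2 * pi * a) * L \<le> real (card (close_pairs a p L))"
        "real (card (close_pairs a p L)) \<le> pi * (2 * pi * a + 1 / (real n + 1)) * L"
      proof (rule monotone_meets_line[of "\<lambda>L. real (card (close_pairs a p L))" "pi * (2 * pi * a)"
            "pi * (2 * pi * a + 1 / (real n + 1))" L1 L2])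
        show "real (card (close_pairs a p L)) \<le> real (card (close_pairs a p L'))" if "L \<le> L'" for L L'
          using card_close_pairs_mono[OF that] by simp
        show "pi * (2 * pi * a) \<le> pi * (2 * pi * a + 1 / (real n + 1))"
          by (intro mult_left_mono) auto
        show "pi * (2 * pi * a) * L1 \<le> real (card (close_pairs a p L1))"
          using L1(3) unfolding high_at_def by (simp add: mult_ac)
      qed (use assms L1 L2 k low2 in auto)
      have pos: "0 < pi * L"
        using L(1) L1(2) by simp
      have "2 * pi * a \<le> R2 (abs_torus p) (- a) a L"
        unfolding R2 using L(2) by (subst pos_le_divide_eq[OF pos]) (simp add: mult_ac)
      moreover have "R2 (abs_torus p) (- a) a L \<le> 2 * pi * a + 1 / (real n + 1)"
        unfolding R2 using L(3) by (subst pos_divide_le_eq[OF pos]) (simp add: mult_ac)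
      moreover have "real n \<le> L"
        using L(1) L1(1) by linarith
      ultimately show ?thesis
        by blast
    qed
    then have "\<exists>L :: nat \<Rightarrow> real. strict_mono L \<and> filterlim L at_top sequentially \<and>
        (\<lambda>j. R2 (abs_torus p) (- a) a (L j)) \<longlonglongrightarrow> 2 * pi * a"
      by (rule tendsto_along_sequence)
    ultimately show "abs_torus p \<in> C"
      unfolding C_def by blast
  qed
  then show ?thesis
    by (intro exI[of _ C]) (auto simp: C_def)
qed

end
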